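(* Let $\mathsf{M}_1,\dots,\mathsf{M}_s$ be matroids and suppose the direct sum $\mathsf{M}=\mathsf{M}_1\oplus\cdots\oplus\mathsf{M}_s$ is extremal. Then each of $\mathsf{M}_1,\dots,\mathsf{M}_s$ is extremal.
   Context: For integers $0\le r\le n$, $\overline{\mathcal{M}}_{r,n}$ is the set of matroids with ground set $[n]=\{1,\dots,n\}$ and rank $r$, and $\mathcal{M}_{r,n}$ the set of their isomorphism classes; $[\mathsf{M}]$ is the class of $\mathsf{M}$. The base polytope $\mathscr{P}(\mathsf{M})\subseteq\mathbb{R}^n$ is the convex hull of the $0/1$ indicator vectors of the bases of $\mathsf{M}$; $\mathbf{1}_X$ is the indicator function of $X\subseteq\mathbb{R}^n$. A Schubert matroid is a matroid whose lattice of cyclic flats is a chain; $\overline{\mathcal{S}}_{r,n}\subseteq\overline{\mathcal{M}}_{r,n}$ is the set of Schubert matroids and $\mathcal{S}_{r,n}$ the set of their isomorphism classes. For each $\mathsf{M}\in\overline{\mathcal{M}}_{r,n}$ there are unique integers $a_{\mathsf{S}}(\mathsf{M})$ ($\mathsf{S}\in\overline{\mathcal{S}}_{r,n}$) with $\mathbf{1}_{\mathscr{P}(\mathsf{M})}=\sum_{\mathsf{S}}a_{\mathsf{S}}(\mathsf{M})\mathbf{1}_{\mathscr{P}(\mathsf{S})}$. Let $p_{[\mathsf{M}]}\in\mathbb{Z}^{\mathcal{S}_{r,n}}$ be the vector whose coordinate at $c\in\mathcal{S}_{r,n}$ is $\sum_{\mathsf{S}\in c}a_{\mathsf{S}}(\mathsf{M})$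 (it depends only on $[\mathsf{M}]$), and $\Omega_{r,n}=\operatorname{conv}\{p_{[\mathsf{M}]}:[\mathsf{M}]\in\mathcal{M}_{r,n}\}$. A matroid of rank $r$ on an $n$-element set is called extremal if, after identifying its ground set with $[n]$ by any bijection, $p_{[\mathsf{M}]}$ is a vertex of $\Omega_{r,n}$ (this does not depend on the bijection). *)

theory Defs
  imports "HOL-Analysis.Analysis" "HOL-Analysis.Finite_Function_Topology"
begin

section \<open>Matroids on finite ground sets\<close>

record 'a matroid =
  ground :: "'a set"
  bases :: "'a set set"

definition is_matroid :: "'a matroid \<Rightarrow> bool" where
  "is_matroid M \<longleftrightarrow>
     finite (ground M) \<and> bases M \<noteq> {} \<and> (\<forall>B\<in>bases M. B \<subseteq> ground M) \<and>
     (\<forall>B\<in>bases M. \<forall>B'\<in>bases M. \<forall>x\<in>B - B'. \<exists>y\<in>B' - B. insert y (B - {x}) \<in> bases M)"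

definition rank_in :: "'a matroid \<Rightarrow> 'a set \<Rightarrow> nat" where
  "rank_in M X = Max ((\<lambda>B. card (B \<inter> X)) ` bases M)"

definition matroid_rank :: "'a matroid \<Rightarrow> nat" where
  "matroid_rank M = rank_in M (ground M)"

definition indep_in :: "'a matroid \<Rightarrow> 'a set \<Rightarrow> bool" where
  "indep_in M I \<longleftrightarrow> (\<exists>B\<in>bases M. I \<subseteq> B)"

definition circuits :: "'a matroid \<Rightarrow> 'a set set" where
  "circuits M = {C. C \<subseteq> ground M \<and> \<not> indep_in M C \<and> (\<forall>D. D \<subset> C \<longrightarrow> indep_in M D)}"

definition flats :: "'a matroid \<Rightarrow> 'a set set" where
  "flats M = {F. F \<subseteq> ground M \<and> (\<forall>e\<in>ground M - F. rank_in M F < rank_in M (insert e F))}"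

definition cyclic_flats :: "'a matroid \<Rightarrow> 'a set set" where
  "cyclic_flats M = {F \<in> flats M. \<exists>\<C>\<subseteq>circuits M. F = \<Union>\<C>}"

definition is_schubert :: "'a matroid \<Rightarrow> bool" where
  "is_schubert M \<longleftrightarrow> is_matroid M \<and> chain\<^sub>\<subseteq> (cyclic_flats M)"

definition map_matroid :: "('a \<Rightarrow> 'b) \<Rightarrow> 'a matroid \<Rightarrow> 'b matroid" where
  "map_matroid f M = \<lparr>ground = f ` ground M, bases = image f ` bases M\<rparr>"

definition matroid_iso :: "'a matroid \<Rightarrow> 'b matroid \<Rightarrow> bool" where
  "matroid_iso M N \<longleftrightarrow> (\<exists>f. bij_betw f (ground M) (ground N) \<and> map_matroid f M = N)"

text \<open>The direct sum of \<open>M 1, \<dots>, M s\<close>, formed on the disjoint union of the ground sets;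
  the summands need not have disjoint ground sets.\<close>

definition direct_sum :: "nat \<Rightarrow> (nat \<Rightarrow> 'a matroid) \<Rightarrow> (nat \<times> 'a) matroid" where
  "direct_sum s M =
     \<lparr>ground = (SIGMA i:{1..s}. ground (M i)),
      bases = {(SIGMA i:{1..s}. B i) | B. \<forall>i\<in>{1..s}. B i \<in> bases (M i)}\<rparr>"

section \<open>Matroids and Schubert matroids on \<open>{1..n}\<close>\<close>

definition matroids :: "nat \<Rightarrow> nat \<Rightarrow> nat matroid set" where
  "matroids r n = {M. is_matroid M \<and> ground M = {1..n} \<and> matroid_rank M = r}"

definition schuberts :: "nat \<Rightarrow> nat \<Rightarrow> nat matroid set" where
  "schuberts r n = {M \<in> matroids r n. is_schubert M}"

definition iso_rel :: "nat \<Rightarrow> nat \<Rightarrow> (nat matroid \<times> nat matroid) set" where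
  "iso_rel r n = {(M, N). M \<in> matroids r n \<and> N \<in> matroids r n \<and> matroid_iso M N}"

definition schubert_classes :: "nat \<Rightarrow> nat \<Rightarrow> nat matroid set set" where
  "schubert_classes r n = schuberts r n // iso_rel r n"

text \<open>Because \<open>n\<close> varies, \<open>\<real>\<^sup>n\<close> is realised inside the real vector space of finitely supported
  functions, as the functions supported on \<open>{1..n}\<close>; \<open>Poly_Mapping.single i 1\<close> is the
  \<open>i\<close>-th standard basis vector. The same is done for the coordinate space indexed by
  \<^term>\<open>schubert_classes r n\<close>.\<close>

definition base_polytope :: "nat matroid \<Rightarrow> (nat \<Rightarrow>\<^sub>0 real) set" where
  "base_polytope M = convex hull ((\<lambda>B. \<Sum>i\<in>B. Poly_Mapping.single i 1) ` bases M)"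

text \<open>Every \<open>M\<close> in \<^term>\<open>matroids r n\<close> has unique integer coefficients over
  \<^term>\<open>schuberts r n\<close>; extending them by zero to all other arguments
  makes the function below unique.\<close>

definition schubert_coeff :: "nat \<Rightarrow> nat \<Rightarrow> nat matroid \<Rightarrow> nat matroid \<Rightarrow> int" where
  "schubert_coeff r n M =
     (THE a. (\<forall>S. S \<notin> schuberts r n \<longrightarrow> a S = 0) \<and>
        (\<forall>x. indicator (base_polytope M) x =
              (\<Sum>S\<in>schuberts r n. a S * indicator (base_polytope S) x)))"

text \<open>The integer vector of the isomorphism class of \<open>M\<close>, computed from the representative \<open>M\<close>
  (on which it does not depend) and regarded as a real vector.\<close>

definition class_vec :: "nat \<Rightarrow> nat \<Rightarrow> nat matroid \<Rightarrow> (nat matroid set \<Rightarrow>\<^sub>0 real)" where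
  "class_vec r n M =
     (\<Sum>c\<in>schubert_classes r n.
        Poly_Mapping.single c (real_of_int (\<Sum>S\<in>c. schubert_coeff r n M S)))"

definition Omega :: "nat \<Rightarrow> nat \<Rightarrow> (nat matroid set \<Rightarrow>\<^sub>0 real) set" where
  "Omega r n = convex hull (class_vec r n ` matroids r n)"

definition extremal :: "'a matroid \<Rightarrow> bool" where
  "extremal M \<longleftrightarrow> is_matroid M \<and>
     (let r = matroid_rank M; n = card (ground M) in
      \<forall>f. bij_betw f (ground M) {1..n} \<longrightarrow>
          class_vec r n (map_matroid f M) extreme_point_of Omega r n)"

end

(*
  The class vector of M is equivalent to Derksen's G-invariant, which counts the complete flags of
  subsets of the ground set by their words of rank jumps: G is valuative, so it is a linear function
  of the class vector, and the G-invariants of the Schubert classes are linearly independent. The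
  G-invariant of a direct sum is the shuffle product of the G-invariants of the summands, and the
  shuffle algebra has no zero divisors. Replacing the summand M_i by other matroids of the same rank
  and size therefore induces an injective affine map from Omega for M_i into Omega for the direct
  sum, and an injective affine map reflects extreme points.
*)
theory Submission
  imports Defs "HOL-Combinatorics.Multiset_Permutations"
begin

section \<open>Rank functions\<close>

text \<open>\<open>schubert_coeff\<close> is a definite description, so existence and uniqueness of
  Schubert expansions have to be proved before class vectors can be handled at all. Uniqueness and
  the valuativity of G have the same source: in a linear relation between indicator functions of
  base polytopes, each indicator may be replaced by the truth value of "the polytope meets K", for
  any closed convex K. The detour through G avoids the difficulty that a direct sum of Schubert
  matroids is in general not Schubert (two copies of the rank 1 uniform matroid on two elements
  already fail), so the expansions of the summands do not simply combine into that of the sum. The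
  affine map is never built as a function on the polytope. That it is well defined and injective is
  one equivalence: real coefficients on the matroids that may replace \<open>M i\<close> annihilate
  their class vectors exactly when they annihilate the class vectors of the resulting direct sums.
  Extremality is pulled back by carrying the coefficients of convex combinations from one family to
  the other.\<close>

lemma matroid_finite:
  assumes "is_matroid M"
  shows "finite (ground M)" "finite (bases M)" "bases M \<noteq> {}"
    "B \<in> bases M \<Longrightarrow> B \<subseteq> ground M" "B \<in> bases M \<Longrightarrow> finite B"
proof -
  show 1: "finite (ground M)" and 3: "bases M \<noteq> {}" using assms by (auto simp: is_matroid_def)
  have sub: "B \<subseteq> ground M" if "B \<in> bases M" for B using assms that by (auto simp: is_matroid_def)
  show "finite (bases M)" using 1 sub by (meson Pow_iff finite_Pow_iff finite_subset subsetI)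
  show "B \<in> bases M \<Longrightarrow> B \<subseteq> ground M" by (rule sub)
  show "B \<in> bases M \<Longrightarrow> finite B" using 1 sub finite_subset by blast
qed

lemma basis_exchange:
  assumes "is_matroid M" "B \<in> bases M" "B' \<in> bases M" "x \<in> B - B'"
  obtains y where "y \<in> B' - B" "insert y (B - {x}) \<in> bases M"
  using assms unfolding is_matroid_def by blast

text \<open>Exchanging an element of \<open>B - B'\<close> keeps the size of \<open>B\<close> and
  shrinks the difference, so one inequality follows by induction; the other is its mirror
  image.\<close>

lemma bases_card_eq:
  assumes M: "is_matroid M" and "B \<in> bases M" "B' \<in> bases M"
  shows "card B = card B'"
proof -
  have le: "card B \<le> card B'" if "B \<in> bases M" "B' \<in> bases M" for B B'
    using that
  proof (induction "card (B - B')" arbitrary: B rule: less_induct)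
    case less
    note fin = matroid_finite(5)[OF M]
    show ?case
    proof (cases "B \<subseteq> B'")
      case True
      then show ?thesis using fin less.prems by (auto intro: card_mono)
    next
      case False
      then obtain x where x: "x \<in> B - B'" by blast
      obtain y where y: "y \<in> B' - B" and b: "insert y (B - {x}) \<in> bases M"
        using basis_exchange[OF M less.prems x] by blast
      have "insert y (B - {x}) - B' = (B - B') - {x}" using x y by blast
      then have "card (insert y (B - {x}) - B') < card (B - B')"
        using x fin[OF less.prems(1)] by (metis card_Diff1_less finite_Diff)
      then have "card (insert y (B - {x})) \<le> card B'" using less.hyps b less.prems by blast
      moreover have "card (insert y (B - {x})) = card B"
        using x y fin[OF less.prems(1)] card_Suc_Diff1[of B x] by simp
      ultimately show ?thesis by simp
    qed
  qed
  show ?thesis using le assms by (meson le_antisym)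
qed

lemma rank_ge_card_Int: 
  assumes "is_matroid M" "B \<in> bases M"
  shows "card (B \<inter> X) \<le> rank_in M X"
  unfolding rank_in_def using matroid_finite[OF assms(1)] assms(2) by (intro Max_ge) auto

lemma rank_attained:
  assumes "is_matroid M"
  obtains B where "B \<in> bases M" "card (B \<inter> X) = rank_in M X"
proof -
  have "rank_in M X \<in> (\<lambda>B. card (B \<inter> X)) ` bases M"
    unfolding rank_in_def using matroid_finite[OF assms] by (intro Max_in) auto
  then show ?thesis using that by auto
qed

lemma rank_leI:
  assumes "is_matroid M" "\<And>B. B \<in> bases M \<Longrightarrow> card (B \<inter> X) \<le> k"
  shows "rank_in M X \<le> k"
  using rank_attained[OF assms(1), of X] assms(2) by metis

lemma rank_empty: "is_matroid M \<Longrightarrow> rank_in M {} = 0"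
  using rank_leI[of M "{}" 0] by simp

lemma rank_mono:
  assumes "is_matroid M" "X \<subseteq> Y"
  shows "rank_in M X \<le> rank_in M Y"
proof (rule rank_leI[OF assms(1)])
  fix B assume B: "B \<in> bases M"
  have "card (B \<inter> X) \<le> card (B \<inter> Y)"
    using matroid_finite(5)[OF assms(1) B] assms(2) by (intro card_mono) auto
  also have "\<dots> \<le> rank_in M Y" using rank_ge_card_Int[OF assms(1) B] .
  finally show "card (B \<inter> X) \<le> rank_in M Y" .
qed

lemma rank_le_card: "is_matroid M \<Longrightarrow> finite X \<Longrightarrow> rank_in M X \<le> card X"
  by (auto intro!: rank_leI card_mono)

lemma rank_Int_ground:
  assumes "is_matroid M"
  shows "rank_in M (X \<inter> ground M) = rank_in M X"
proof -
  have "B \<inter> (X \<inter> ground M) = B \<inter> X" if "B \<in> bases M" for B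
    using matroid_finite(4)[OF assms that] by blast
  then show ?thesis unfolding rank_in_def by (metis (mono_tags, lifting) image_cong)
qed

lemma card_basis:
  assumes "is_matroid M" "B \<in> bases M"
  shows "card B = matroid_rank M"
proof -
  obtain B' where B': "B' \<in> bases M" "card (B' \<inter> ground M) = matroid_rank M"
    using rank_attained[OF assms(1)] unfolding matroid_rank_def by blast
  then have "B' \<inter> ground M = B'" using matroid_finite(4)[OF assms(1)] by blast
  then show ?thesis using bases_card_eq[OF assms B'(1)] B'(2) by simp
qed

text \<open>Every element of \<open>B0\<close> outside \<open>I \<union> B\<close> can be exchanged
  for one of \<open>B\<close> without touching \<open>I\<close>.\<close>

lemma basis_extend:
  assumes M: "is_matroid M" and "B0 \<in> bases M" "I \<subseteq> B0" and B: "B \<in> bases M"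
  obtains B' where "B' \<in> bases M" "I \<subseteq> B'" "B' \<subseteq> I \<union> B"
proof -
  have "\<exists>B'\<in>bases M. I \<subseteq> B' \<and> B' \<subseteq> I \<union> B"
    using assms(2,3)
  proof (induction "card (B0 - (I \<union> B))" arbitrary: B0 rule: less_induct)
    case less
    show ?case
    proof (cases "B0 \<subseteq> I \<union> B")
      case True
      then show ?thesis using less.prems by blast
    next
      case False
      then obtain x where x: "x \<in> B0 - (I \<union> B)" by blast
      then obtain y where y: "y \<in> B - B0" and b: "insert y (B0 - {x}) \<in> bases M"
        using basis_exchange[OF M less.prems(1) B] by blast
      have "insert y (B0 - {x}) - (I \<union> B) = (B0 - (I \<union> B)) - {x}" using x y by blast
      then have "card (insert y (B0 - {x}) - (I \<union> B)) < card (B0 - (I \<union> B))"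
        using x matroid_finite(5)[OF M less.prems(1)] by (metis card_Diff1_less finite_Diff)
      moreover have "I \<subseteq> insert y (B0 - {x})" using x less.prems by blast
      ultimately show ?thesis using less.hyps b by blast
    qed
  qed
  then show ?thesis using that by blast
qed

text \<open>The greedy principle: a basis optimal below the top member of the chain is kept there
  and refilled from a basis that is optimal for the top. This later makes prescribed ranks on a
  chain detectable at a single vertex.\<close>

lemma chain_basis:
  assumes M: "is_matroid M" and "finite C" "chain\<^sub>\<subseteq> C"
  obtains B where "B \<in> bases M" "\<And>X. X \<in> C \<Longrightarrow> card (B \<inter> X) = rank_in M X"
proof -
  have "\<exists>B\<in>bases M. \<forall>X\<in>C. card (B \<inter> X) = rank_in M X" using assms(2,3)
  proof (induction "card C" arbitrary: C rule: less_induct)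
    case less
    show ?case
    proof (cases "C = {}")
      case True
      then show ?thesis using matroid_finite(3)[OF M] by blast
    next
      case False
      define Y where "Y = \<Union>C"
      have YC: "Y \<in> C" unfolding Y_def
        by (rule Union_in_chain[OF less.prems(1) False])
          (use less.prems(2) in \<open>auto simp: chain_subset_def subset_chain_def\<close>)
      define C' where "C' = C - {Y}"
      have "card C' < card C" unfolding C'_def using YC less.prems(1) by (rule card_Diff1_less[rotated])
      moreover have "finite C'" "chain\<^sub>\<subseteq> C'" using less.prems by (auto simp: C'_def chain_subset_def)
      ultimately obtain B where B: "B \<in> bases M" "\<And>X. X \<in> C' \<Longrightarrow> card (B \<inter> X) = rank_in M X"
        using less.hyps by blast
      \<comment> \<open>\<open>X\<close> is the second largest member of the chain, or empty if
        there is none.\<close>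
      define X where "X = \<Union>C'"
      have XY: "X \<subseteq> Y" unfolding X_def Y_def C'_def by blast
      have cX: "card (B \<inter> X) = rank_in M X"
      proof (cases "C' = {}")
        case True
        then show ?thesis by (simp add: X_def rank_empty[OF M])
      next
        case False
        have "X \<in> C'" unfolding X_def 
          by (rule Union_in_chain[OF _ False])
            (use \<open>finite C'\<close> \<open>chain\<^sub>\<subseteq> C'\<close> in \<open>auto simp: chain_subset_def subset_chain_def\<close>)
        then show ?thesis using B(2) by blast
      qed
      obtain B2 where B2: "B2 \<in> bases M" "card (B2 \<inter> Y) = rank_in M Y" 
        using rank_attained[OF M] by blast
      obtain B' where B': "B' \<in> bases M" "B \<inter> X \<subseteq> B'" "B' \<subseteq> (B \<inter> X) \<union> B2"
        using basis_extend[OF M B(1) _ B2(1), of "B \<inter> X"] by blast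
      note fin = matroid_finite(5)[OF M]
      \<comment> \<open>\<open>B' - Y\<close> consists of elements of \<open>B2\<close> only, so
        \<open>B'\<close> wastes no more elements outside \<open>Y\<close> than \<open>B2\<close>
        does; equal cardinalities turn this into optimality on \<open>Y\<close>.\<close>
      have "card (B' - Y) \<le> card (B2 - Y)"
        using B' XY fin[OF B2(1)] by (intro card_mono) auto
      moreover have "card (B' - Y) + card (B' \<inter> Y) = card B'"
        using fin[OF B'(1)] by (metis add.commute card_Int_Diff)
      moreover have "card (B2 - Y) + card (B2 \<inter> Y) = card B2"
        using fin[OF B2(1)] by (metis add.commute card_Int_Diff)
      moreover have "card B' = card B2" using bases_card_eq[OF M] B' B2 by blast
      ultimately have "card (B' \<inter> Y) \<ge> rank_in M Y" using B2(2) by simp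
      then have cY: "card (B' \<inter> Y) = rank_in M Y" using rank_ge_card_Int[OF M B'(1)] le_antisym by blast
      have "card (B' \<inter> Z) = rank_in M Z" if "Z \<in> C'" for Z
      proof -
        have "card (B \<inter> Z) \<le> card (B' \<inter> Z)"
          using fin[OF B'(1)] B'(2) that unfolding X_def by (intro card_mono) auto
        then show ?thesis using B(2)[OF that] rank_ge_card_Int[OF M B'(1), of Z] by simp
      qed
      then show ?thesis using cY B'(1) C'_def by (intro bexI[of _ B']) auto
    qed
  qed
  then show ?thesis using that by blast
qed

text \<open>One basis attains the ranks of both \<open>X \<inter> Y\<close> and
  \<open>X \<union> Y\<close>, which form a chain; on it the inequality comes from the modularity of
  cardinality.\<close>

lemma rank_submodular:
  assumes M: "is_matroid M"
  shows "rank_in M (X \<union> Y) + rank_in M (X \<inter> Y) \<le> rank_in M X + rank_in M Y"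
proof -
  obtain B where B: "B \<in> bases M" "\<And>Z. Z \<in> {X \<inter> Y, X \<union> Y} \<Longrightarrow> card (B \<inter> Z) = rank_in M Z"
    using chain_basis[OF M, of "{X \<inter> Y, X \<union> Y}"] by (auto simp: chain_subset_def)
  have fin: "finite B" using matroid_finite(5)[OF M B(1)] .
  have "card (B \<inter> (X \<union> Y)) + card (B \<inter> (X \<inter> Y)) = card (B \<inter> X) + card (B \<inter> Y)"
    using card_Un_Int[of "B \<inter> X" "B \<inter> Y"] fin
    by (simp add: Int_Un_distrib Int_assoc Int_left_commute)
  then show ?thesis using B rank_ge_card_Int[OF M B(1), of X] rank_ge_card_Int[OF M B(1), of Y] by simp
qed

section \<open>The base polytope\<close>

lemma lookup_scaleR: "Poly_Mapping.lookup (c *\<^sub>R x) i = c *\<^sub>R Poly_Mapping.lookup x i"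
proof -
  have "finite {i. c *\<^sub>R Poly_Mapping.lookup x i \<noteq> 0}"
    by (rule finite_subset[OF _ finite_keys[of x]]) (auto simp: in_keys_iff)
  then show ?thesis by (simp add: scaleR_poly_mapping_def Abs_poly_mapping_inverse)
qed

abbreviation weight :: "('a \<Rightarrow>\<^sub>0 real) \<Rightarrow> 'a set \<Rightarrow> real" where
  "weight x A \<equiv> sum (Poly_Mapping.lookup x) A"

abbreviation basis_vec :: "'a set \<Rightarrow> 'a \<Rightarrow>\<^sub>0 real" where
  "basis_vec B \<equiv> \<Sum>i\<in>B. Poly_Mapping.single i 1"

lemma weight_add: "weight (x + y) A = weight x A + weight y A"
  by (simp add: lookup_add sum.distrib)

lemma weight_diff: "weight (x - y) A = weight x A - weight y A"
  by (simp add: lookup_minus sum_subtractf)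

lemma weight_scaleR: "weight (c *\<^sub>R x) A = c * weight x A"
  by (simp add: lookup_scaleR sum_distrib_left)

lemma lookup_basis_vec:
  assumes "finite B"
  shows "Poly_Mapping.lookup (basis_vec B) j = of_bool (j \<in> B)"
  using assms by (simp add: lookup_sum lookup_single when_def of_bool_def sum.delta)

lemma weight_basis_vec:
  assumes "finite B" "finite A"
  shows "weight (basis_vec B) A = card (B \<inter> A)"
  using assms by (simp add: lookup_basis_vec of_bool_def sum.If_cases Int_commute)

lemma weight_Un_Int:
  assumes "finite A" "finite B"
  shows "weight x (A \<union> B) + weight x (A \<inter> B) = weight x A + weight x B"
  using assms by (rule sum.union_inter)

text \<open>Edmonds' description of the base polytope by inequalities. Nonnegativity of the
  coordinates is a consequence, see \<open>rank_polytope_cube\<close>.\<close>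

definition rank_polytope :: "'a matroid \<Rightarrow> ('a \<Rightarrow>\<^sub>0 real) set" where
  "rank_polytope M = {x. (\<forall>i. i \<notin> ground M \<longrightarrow> Poly_Mapping.lookup x i = 0) \<and>
     (\<forall>A\<subseteq>ground M. weight x A \<le> rank_in M A) \<and> weight x (ground M) = matroid_rank M}"

text \<open>Uncrossing: on a lattice of sets where the rank is modular, a maximal chain already
  decides. A basis optimal on the chain is optimal on all of \<open>T\<close>, by induction along
  the chain.\<close>

lemma tight_basis:
  assumes M: "is_matroid M" and T: "T \<subseteq> Pow (ground M)" "{} \<in> T" "ground M \<in> T"
    and un: "\<And>X Y. X \<in> T \<Longrightarrow> Y \<in> T \<Longrightarrow> X \<union> Y \<in> T"
    and int: "\<And>X Y. X \<in> T \<Longrightarrow> Y \<in> T \<Longrightarrow> X \<inter> Y \<in> T"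
    and modular: "\<And>X Y. X \<in> T \<Longrightarrow> Y \<in> T \<Longrightarrow>
       rank_in M (X \<union> Y) + rank_in M (X \<inter> Y) = rank_in M X + rank_in M Y"
  obtains B where "B \<in> bases M" "\<And>A. A \<in> T \<Longrightarrow> card (B \<inter> A) = rank_in M A"
proof -
  note finE = matroid_finite(1)[OF M]
  have finT: "finite T" using T(1) finE finite_subset by blast
  let ?S = "{C. C \<subseteq> T \<and> chain\<^sub>\<subseteq> C}"
  have "finite ?S" using finT by simp
  moreover have "{} \<in> ?S" by (auto simp: chain_subset_def)
  ultimately obtain C where C: "C \<in> ?S" "\<And>C'. C' \<in> ?S \<Longrightarrow> C \<subseteq> C' \<Longrightarrow> C' = C"
    using finite_has_maximal[of ?S] by (metis (no_types, lifting) empty_iff)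
  have finC: "finite C" using C(1) finT finite_subset by blast
  have ins: "Z \<in> C" if "Z \<in> T" "\<And>X. X \<in> C \<Longrightarrow> X \<subseteq> Z \<or> Z \<subseteq> X" for Z
  proof -
    have "insert Z C \<in> ?S" using C(1) that unfolding chain_subset_def by auto
    then show ?thesis using C(2)[of "insert Z C"] by blast
  qed
  have E: "ground M \<in> C" using ins[of "ground M"] T C(1) by blast
  have empt: "{} \<in> C" using ins[of "{}"] T by blast
  obtain B where B: "B \<in> bases M" "\<And>X. X \<in> C \<Longrightarrow> card (B \<inter> X) = rank_in M X"
    using chain_basis[OF M finC] C(1) by blast
  have fB: "finite B" using matroid_finite(5)[OF M B(1)] .
  have *: "card (B \<inter> (A \<inter> D)) = rank_in M (A \<inter> D)" if "A \<in> T" "D \<in> C" for A D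
    using that(2)
  proof (induction "card D" arbitrary: D rule: less_induct)
    case less
    show ?case
    proof (cases "D = {}")
      case True
      then show ?thesis by (simp add: rank_empty[OF M])
    next
      case False
      define L where "L = {X \<in> C. X \<subset> D}"
      have "{} \<in> L" using False empt by (auto simp: L_def)
      moreover have "finite L" using finC by (simp add: L_def)
      moreover have "subset.chain L L" 
        using C(1) by (auto simp: L_def chain_subset_def subset_chain_def)
      ultimately have "\<Union>L \<in> L" using Union_in_chain[of L L] by blast
      then have D': "\<Union>L \<in> C" "\<Union>L \<subset> D" unfolding L_def by auto
      \<comment> \<open>\<open>D'\<close> is the predecessor of \<open>D\<close> in the chain. The
        set \<open>Z\<close> lies between them and is comparable with every member, so maximality
        puts it into the chain and leaves no room strictly between \<open>D'\<close> and
        \<open>D\<close>.\<close>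
      define D' where "D' = \<Union>L"
      define Z where "Z = (A \<inter> D) \<union> D'"
      have DT: "D \<in> T" "D' \<in> T" using less.prems D' C(1) unfolding D'_def by auto
      have "finite D" using DT T finE by (meson PowD finite_subset subsetD)
      then have "card D' < card D" using D' unfolding D'_def by (simp add: psubset_card_mono)
      then have IH: "card (B \<inter> (A \<inter> D')) = rank_in M (A \<inter> D')" using less.hyps D' unfolding D'_def by blast
      have ZT: "Z \<in> T" unfolding Z_def by (intro un int DT that(1))
      have "Z \<in> C"
      proof (rule ins[OF ZT])
        fix X assume X: "X \<in> C"
        show "X \<subseteq> Z \<or> Z \<subseteq> X"
        proof (cases "X \<subset> D")
          case True
          then have "X \<subseteq> D'" using X unfolding D'_def L_def by blast
          then show ?thesis unfolding Z_def by blast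
        next
          case False
          then have "D \<subseteq> X" using X less.prems C(1) unfolding chain_subset_def by blast
          then show ?thesis using D' unfolding Z_def D'_def by blast
        qed
      qed
      then consider "Z = D" | "Z \<subseteq> D'" using D' unfolding D'_def Z_def L_def by blast
      then show ?thesis
      proof cases
        case 2
        then have "A \<inter> D = A \<inter> D'" using D' unfolding Z_def D'_def by blast
        then show ?thesis using IH by simp
      next
        case 1
        have i: "(A \<inter> D) \<inter> D' = A \<inter> D'" using D' unfolding D'_def by blast
        have u: "(A \<inter> D) \<union> D' = D" using 1 Z_def by simp
        have "rank_in M D + rank_in M (A \<inter> D') = rank_in M (A \<inter> D) + rank_in M D'"
          using modular[of "A \<inter> D" D'] int[OF that(1) DT(1)] DT(2) i u by simp
        moreover have "card (B \<inter> (A \<inter> D)) + card (B \<inter> D') = card (B \<inter> D) + card (B \<inter> (A \<inter> D'))"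
        proof -
          have a: "(B \<inter> (A \<inter> D)) \<union> (B \<inter> D') = B \<inter> D" using u by blast
          have b: "(B \<inter> (A \<inter> D)) \<inter> (B \<inter> D') = B \<inter> (A \<inter> D')" using i by blast
          show ?thesis using card_Un_Int[of "B \<inter> (A \<inter> D)" "B \<inter> D'"] fB unfolding a b by simp
        qed
        moreover have "card (B \<inter> D) = rank_in M D" "card (B \<inter> D') = rank_in M D'"
          using B(2) less.prems D' unfolding D'_def by auto
        ultimately show ?thesis using IH by simp
      qed
    qed
  qed
  have "card (B \<inter> A) = rank_in M A" if "A \<in> T" for A
  proof -
    have "A \<inter> ground M = A" using that T by blast
    then show ?thesis using *[OF that E] by simp
  qed
  then show ?thesis using that B(1) by blast
qed

lemma basis_vec_in_base_polytope: "B \<in> bases M \<Longrightarrow> basis_vec B \<in> base_polytope M"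
  unfolding base_polytope_def by (intro hull_inc imageI)

lemma base_polytope_subset_rank_polytope:
  fixes M :: "nat matroid"
  assumes M: "is_matroid M"
  shows "base_polytope M \<subseteq> rank_polytope M"
  unfolding base_polytope_def
proof (rule hull_minimal)
  show "basis_vec ` bases M \<subseteq> rank_polytope M"
  proof
    fix x assume "x \<in> basis_vec ` bases M"
    then obtain B where B: "B \<in> bases M" "x = basis_vec B" by blast
    note f = matroid_finite(5)[OF M B(1)]
    have "B \<inter> ground M = B" using matroid_finite(4)[OF M B(1)] by blast
    then have "weight x (ground M) = matroid_rank M"
      using weight_basis_vec[OF f matroid_finite(1)[OF M]] card_basis[OF M B(1)] B(2) by simp
    moreover have "weight x A \<le> rank_in M A" if "A \<subseteq> ground M" for A
      using weight_basis_vec[OF f finite_subset[OF that matroid_finite(1)[OF M]]]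
        rank_ge_card_Int[OF M B(1), of A] B(2) by simp
    moreover have "Poly_Mapping.lookup x i = 0" if "i \<notin> ground M" for i
      using matroid_finite(4)[OF M B(1)] that B(2) lookup_basis_vec[OF f] by auto
    ultimately show "x \<in> rank_polytope M" by (simp add: rank_polytope_def)
  qed
  show "convex (rank_polytope M)"
  proof (rule convexI)
    fix x y :: "nat \<Rightarrow>\<^sub>0 real" and u v :: real
    assume a: "x \<in> rank_polytope M" "y \<in> rank_polytope M" "0 \<le> u" "0 \<le> v" "u + v = 1"
    have "u * weight x A + v * weight y A \<le> rank_in M A" if "A \<subseteq> ground M" for A
    proof -
      have "u * weight x A + v * weight y A \<le> u * rank_in M A + v * rank_in M A"
        using a that by (intro add_mono mult_left_mono) (auto simp: rank_polytope_def)
      also have "\<dots> = rank_in M A" using a(5) by (metis distrib_right mult_1)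
      finally show ?thesis .
    qed
    moreover have "u * weight x (ground M) + v * weight y (ground M) = matroid_rank M"
      using a by (simp add: rank_polytope_def) (metis distrib_right mult_1)
    ultimately show "u *\<^sub>R x + v *\<^sub>R y \<in> rank_polytope M"
      using a unfolding rank_polytope_def weight_add weight_scaleR mem_Collect_eq
      by (auto simp: lookup_add lookup_scaleR)
  qed
qed

text \<open>Take a basis \<open>B\<close> that is tight wherever \<open>x\<close> is tight and move
  from \<open>x\<close> away from the vertex of \<open>B\<close> until a further inequality becomes
  tight. The end point has fewer slack inequalities, and \<open>x\<close> lies between it and the
  vertex.\<close>

lemma rank_polytope_subset_base_polytope:
  fixes M :: "nat matroid"
  assumes M: "is_matroid M"
  shows "rank_polytope M \<subseteq> base_polytope M"
proof
  fix x assume "x \<in> rank_polytope M"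
  then show "x \<in> base_polytope M"
  proof (induction "card {A \<in> Pow (ground M). weight x A < rank_in M A}" arbitrary: x rule: less_induct)
    case less
    note finE = matroid_finite(1)[OF M]
    have x0: "Poly_Mapping.lookup x i = 0" if "i \<notin> ground M" for i
      using less.prems that by (simp add: rank_polytope_def)
    have xle: "weight x A \<le> rank_in M A" if "A \<subseteq> ground M" for A
      using less.prems that by (simp add: rank_polytope_def)
    have xE: "weight x (ground M) = matroid_rank M" using less.prems by (simp add: rank_polytope_def)
    define T where "T = {A. A \<subseteq> ground M \<and> weight x A = rank_in M A}"
    have T2: "weight x (X \<union> Y) = rank_in M (X \<union> Y) \<and> weight x (X \<inter> Y) = rank_in M (X \<inter> Y) \<and>
        rank_in M (X \<union> Y) + rank_in M (X \<inter> Y) = rank_in M X + rank_in M Y"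
      if "X \<in> T" "Y \<in> T" for X Y
    proof -
      have XY: "X \<subseteq> ground M" "Y \<subseteq> ground M" "weight x X = rank_in M X" "weight x Y = rank_in M Y"
        using that by (auto simp: T_def)
      have "weight x (X \<union> Y) + weight x (X \<inter> Y) = weight x X + weight x Y"
        using XY finE finite_subset by (intro weight_Un_Int) blast+
      moreover have "weight x (X \<union> Y) \<le> rank_in M (X \<union> Y)" "weight x (X \<inter> Y) \<le> rank_in M (X \<inter> Y)"
        using XY(1,2) by (auto intro!: xle)
      moreover have "real (rank_in M (X \<union> Y)) + rank_in M (X \<inter> Y) \<le> real (rank_in M X) + rank_in M Y"
        using rank_submodular[OF M, of X Y] by (metis of_nat_add of_nat_le_iff)
      ultimately show ?thesis using XY by linarith
    qed
    have T: "T \<subseteq> Pow (ground M)" "{} \<in> T" "ground M \<in> T"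
      using xE by (auto simp: T_def rank_empty[OF M] matroid_rank_def)
    have Tun: "X \<union> Y \<in> T" and Tint: "X \<inter> Y \<in> T" if "X \<in> T" "Y \<in> T" for X Y
    proof -
      have "X \<subseteq> ground M" "Y \<subseteq> ground M" using that by (auto simp: T_def)
      then show "X \<union> Y \<in> T" "X \<inter> Y \<in> T" using T2[OF that] by (auto simp: T_def)
    qed
    obtain B where B: "B \<in> bases M" "\<And>A. A \<in> T \<Longrightarrow> card (B \<inter> A) = rank_in M A"
      using tight_basis[OF M T Tun Tint conjunct2[OF conjunct2[OF T2]]] by metis
    have fB: "finite B" using matroid_finite(5)[OF M B(1)] .
    define N where "N = {A. A \<subseteq> ground M \<and> card (B \<inter> A) < rank_in M A}"
    \<comment> \<open>For \<open>A\<close> in \<open>N\<close>, the point \<open>x'\<close> built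
      below with parameter \<open>t < 1\<close> satisfies the inequality for \<open>A\<close>
      exactly if \<open>t \<le> q A\<close>. The minimum of \<open>q\<close> is thus the first
      parameter at which a new inequality becomes tight.\<close>
    define q where "q A = (rank_in M A - weight x A) / (real (rank_in M A) - card (B \<inter> A))" for A
    have finN: "finite N" using finE by (simp add: N_def)
    have Nx: "weight x A < rank_in M A" if "A \<in> N" for A
      using that xle[of A] B(2)[of A] by (force simp: N_def T_def)
    have notN: "card (B \<inter> A) = rank_in M A" if "A \<notin> N" "A \<subseteq> ground M" for A
      using that rank_ge_card_Int[OF M B(1), of A] by (auto simp: N_def)
    show ?case
    proof (cases "\<forall>A\<in>N. q A \<ge> 1")
      case True
      \<comment> \<open>Nothing stops the ray before \<open>t = 1\<close>: then \<open>x\<close> is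
        bounded by the vertex on every set, in particular in each coordinate, and equal total
        weights force equality.\<close>
      have le: "weight x A \<le> card (B \<inter> A)" if "A \<subseteq> ground M" for A
      proof (cases "A \<in> N")
        case True
        then have "real (rank_in M A) - card (B \<inter> A) > 0" by (simp add: N_def)
        moreover have "q A \<ge> 1" using True \<open>\<forall>A\<in>N. q A \<ge> 1\<close> by blast
        ultimately show ?thesis unfolding q_def by (simp add: le_divide_eq)
      next
        case False
        then show ?thesis using notN that xle by metis
      qed
      have e: "Poly_Mapping.lookup x i \<le> of_bool (i \<in> B)" if "i \<in> ground M" for i
        using le[of "{i}"] that by (auto split: if_splits)
      have BE: "B \<inter> ground M = B" using matroid_finite(4)[OF M B(1)] by blast
      have "(\<Sum>i\<in>ground M. of_bool (i \<in> B) - Poly_Mapping.lookup x i) = 0"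
        using xE card_basis[OF M B(1)] weight_basis_vec[OF fB finE] BE
        by (simp add: sum_subtractf lookup_basis_vec[OF fB])
      then have "\<forall>i\<in>ground M. of_bool (i \<in> B) - Poly_Mapping.lookup x i = 0"
        using e by (subst (asm) sum_nonneg_eq_0_iff[OF finE]) auto
      then have "x = basis_vec B"
        using x0 matroid_finite(4)[OF M B(1)] by (intro poly_mapping_eqI) (force simp: lookup_basis_vec[OF fB])
      then show ?thesis using basis_vec_in_base_polytope[OF B(1)] by simp
    next
      case False
      then have Nne: "N \<noteq> {}" by blast
      define t where "t = Min (q ` N)"
      have tle: "t \<le> q A" if "A \<in> N" for A using that finN by (simp add: t_def)
      have "t \<in> q ` N" unfolding t_def using finN Nne by (intro Min_in) auto
      then obtain A0 where A0: "A0 \<in> N" "t = q A0" by blast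
      have t1: "t < 1" using False tle by force
      have t0: "0 < t" unfolding A0(2) q_def using Nx[OF A0(1)] A0(1) by (simp add: N_def)
      define x' where "x' = (1 / (1 - t)) *\<^sub>R (x - t *\<^sub>R basis_vec B)"
      have w': "weight x' A = (weight x A - t * card (B \<inter> A)) / (1 - t)" if "A \<subseteq> ground M" for A
        unfolding x'_def weight_scaleR weight_diff
        using weight_basis_vec[OF fB finite_subset[OF that finE]] by simp
      have tight: "weight x' A = rank_in M A" if "A \<subseteq> ground M" "weight x A = rank_in M A" for A
      proof -
        have "card (B \<inter> A) = rank_in M A" using B(2) that by (simp add: T_def)
        then have "weight x' A = ((1 - t) * rank_in M A) / (1 - t)" using w' that by (simp add: left_diff_distrib)
        then show ?thesis using t1 by simp
      qed
      have "weight x' A \<le> rank_in M A" if A: "A \<subseteq> ground M" for A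
      proof (cases "A \<in> N")
        case True
        then have "t * (real (rank_in M A) - card (B \<inter> A)) \<le> rank_in M A - weight x A"
          using tle[OF True] unfolding q_def N_def by (simp add: le_divide_eq)
        then show ?thesis unfolding w'[OF A] using t1 by (simp add: divide_le_eq algebra_simps)
      next
        case False
        then have "weight x A - t * card (B \<inter> A) \<le> (1 - t) * rank_in M A"
          using notN[OF False A] xle[OF A] by (simp add: left_diff_distrib)
        then show ?thesis unfolding w'[OF A] using t1 by (simp add: divide_le_eq mult.commute)
      qed
      moreover have "weight x' (ground M) = matroid_rank M"
        using tight[of "ground M"] xE by (simp add: matroid_rank_def)
      moreover have "Poly_Mapping.lookup x' i = 0" if "i \<notin> ground M" for i
        using that x0 matroid_finite(4)[OF M B(1)]
        by (auto simp: x'_def lookup_scaleR lookup_minus lookup_basis_vec[OF fB])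
      ultimately have x'Q: "x' \<in> rank_polytope M" by (simp add: rank_polytope_def)
      have new: "weight x' A0 = rank_in M A0"
      proof -
        have A0E: "A0 \<subseteq> ground M" and "real (rank_in M A0) - card (B \<inter> A0) > 0" using A0 by (auto simp: N_def)
        then have "t * (real (rank_in M A0) - card (B \<inter> A0)) = rank_in M A0 - weight x A0"
          unfolding A0(2) q_def by simp
        then show ?thesis unfolding w'[OF A0E] using t1 by (simp add: divide_eq_eq algebra_simps)
      qed
      have "{A \<in> Pow (ground M). weight x' A < rank_in M A} \<subset> {A \<in> Pow (ground M). weight x A < rank_in M A}"
      proof
        show "{A \<in> Pow (ground M). weight x' A < rank_in M A} \<subseteq> {A \<in> Pow (ground M). weight x A < rank_in M A}"
        proof safe
          fix A assume A: "A \<subseteq> ground M" "weight x' A < rank_in M A"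
          then show "weight x A < rank_in M A" using tight[OF A(1)] xle[OF A(1)] by fastforce
        qed
        show "{A \<in> Pow (ground M). weight x' A < rank_in M A} \<noteq> {A \<in> Pow (ground M). weight x A < rank_in M A}"
          using new Nx[OF A0(1)] A0(1) unfolding N_def by (metis (mono_tags, lifting) Pow_iff less_irrefl mem_Collect_eq)
      qed
      then have "x' \<in> base_polytope M"
        using less.hyps[OF _ x'Q] finE by (simp add: psubset_card_mono)
      moreover have "x = t *\<^sub>R basis_vec B + (1 - t) *\<^sub>R x'"
        using t1 by (simp add: x'_def)
      moreover have "convex (base_polytope M)" by (simp add: base_polytope_def)
      ultimately show ?thesis
        using convexD[of "base_polytope M" "basis_vec B" x' t "1 - t"] t0 t1
          basis_vec_in_base_polytope[OF B(1)] by simp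
    qed
  qed
qed

theorem base_polytope_eq_rank_polytope:
  fixes M :: "nat matroid"
  assumes "is_matroid M"
  shows "base_polytope M = rank_polytope M"
  by (intro equalityI base_polytope_subset_rank_polytope rank_polytope_subset_base_polytope assms)

text \<open>The lower bound compares the total weight with the inequality for the complement of
  \<open>i\<close>.\<close>

lemma rank_polytope_cube:
  fixes M :: "nat matroid"
  assumes M: "is_matroid M" and x: "x \<in> rank_polytope M" and i: "i \<in> ground M"
  shows "0 \<le> Poly_Mapping.lookup x i" "Poly_Mapping.lookup x i \<le> 1"
proof -
  have "weight x (ground M - {i}) \<le> rank_in M (ground M - {i})" using x by (auto simp: rank_polytope_def)
  also have "\<dots> \<le> weight x (ground M)"
    using rank_mono[OF M, of "ground M - {i}" "ground M"] x by (auto simp: rank_polytope_def matroid_rank_def)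
  also have "\<dots> = Poly_Mapping.lookup x i + weight x (ground M - {i})"
    using matroid_finite(1)[OF M] i by (simp add: sum.remove)
  finally show "0 \<le> Poly_Mapping.lookup x i" by simp
  have "weight x {i} \<le> rank_in M {i}" using x i unfolding rank_polytope_def by blast
  moreover have "rank_in M {i} \<le> 1" using rank_le_card[OF M, of "{i}"] by simp
  ultimately show "Poly_Mapping.lookup x i \<le> 1" by simp
qed

section \<open>Nested matroids\<close>

lemma chain_Union_in: "finite C \<Longrightarrow> C \<noteq> {} \<Longrightarrow> chain\<^sub>\<subseteq> C \<Longrightarrow> \<Union>C \<in> C"
  by (rule Union_in_chain) (auto simp: chain_subset_def subset_chain_def)

text \<open>\<open>\<rho>\<close> is an arbitrary function, read only on \<open>C\<close> and
  \<open>E\<close>; the locale below asks of it only that some basis exists. For a chain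
  \<open>C\<close> containing \<open>E\<close> this is then a Schubert matroid, also called a nested
  matroid.\<close>

definition nested :: "'a set \<Rightarrow> 'a set set \<Rightarrow> ('a set \<Rightarrow> nat) \<Rightarrow> 'a matroid" where
  "nested E C \<rho> = \<lparr>ground = E,
     bases = {B. B \<subseteq> E \<and> card B = \<rho> E \<and> (\<forall>A\<in>C. card (B \<inter> A) \<le> \<rho> A)}\<rparr>"

lemma ground_nested [simp]: "ground (nested E C \<rho>) = E"
  by (simp add: nested_def)

lemma bases_nested: "B \<in> bases (nested E C \<rho>) \<longleftrightarrow>
    B \<subseteq> E \<and> card B = \<rho> E \<and> (\<forall>A\<in>C. card (B \<inter> A) \<le> \<rho> A)"
  by (simp add: nested_def)

locale nested_chain =
  fixes E :: "'a set" and C :: "'a set set" and \<rho> :: "'a set \<Rightarrow> nat"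
  assumes finE: "finite E" and CE: "C \<subseteq> Pow E" and chain: "chain\<^sub>\<subseteq> C" and EC: "E \<in> C"
    and nonempty: "bases (nested E C \<rho>) \<noteq> {}"
begin

definition feasible :: "'a set \<Rightarrow> bool" where
  "feasible J \<longleftrightarrow> J \<subseteq> E \<and> (\<forall>A\<in>C. card (J \<inter> A) \<le> \<rho> A)"

lemma basis_feasible: "B \<in> bases (nested E C \<rho>) \<longleftrightarrow> feasible B \<and> card B = \<rho> E"
  by (auto simp: bases_nested feasible_def)

lemma feasible_finite: "feasible J \<Longrightarrow> finite J"
  using finE finite_subset by (auto simp: feasible_def)

lemma feasible_card_le: "feasible J \<Longrightarrow> card J \<le> \<rho> E"
  using EC by (auto simp: feasible_def dest!: bspec[of _ _ E] simp: Int_absorb2)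

lemma feasible_subset:
  assumes "feasible J" "I \<subseteq> J"
  shows "feasible I"
proof -
  have "card (I \<inter> A) \<le> card (J \<inter> A)" for A
    using assms feasible_finite by (intro card_mono) auto
  then show ?thesis using assms unfolding feasible_def by (meson order_trans)
qed

text \<open>Only the largest tight member of the chain obstructs the enlargement of a feasible set.\<close>

lemma feasible_maximal:
  assumes J: "feasible J" and Y: "Y \<subseteq> E"
    and max: "\<And>y. y \<in> Y - J \<Longrightarrow> \<not> feasible (insert y J)"
  shows "Y \<subseteq> J \<or> (\<exists>A\<in>C. card (J \<inter> A) = \<rho> A \<and> Y \<subseteq> J \<union> A)"
proof -
  define T where "T = {A \<in> C. card (J \<inter> A) = \<rho> A}"
  have y: "\<exists>A\<in>T. y \<in> A" if y: "y \<in> Y - J" for y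
  proof -
    obtain A where A: "A \<in> C" "card (insert y J \<inter> A) > \<rho> A"
      using max[OF y] J Y y unfolding feasible_def by fastforce
    have JA: "card (J \<inter> A) \<le> \<rho> A" using J A(1) by (simp add: feasible_def)
    have "y \<in> A" 
    proof (rule ccontr)
      assume "y \<notin> A"
      then have "insert y J \<inter> A = J \<inter> A" by blast
      then show False using A JA by simp
    qed
    then have "card (insert y J \<inter> A) = Suc (card (J \<inter> A))"
      using y feasible_finite[OF J] by simp
    then show ?thesis using A JA \<open>y \<in> A\<close> by (auto simp: T_def)
  qed
  show ?thesis
  proof (cases "T = {}")
    case True
    then show ?thesis using y by blast
  next
    case False
    have "finite T" using CE finE by (auto simp: T_def intro: finite_subset)
    moreover have "chain\<^sub>\<subseteq> T" using chain by (auto simp: T_def chain_subset_def)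
    ultimately have "\<Union>T \<in> T" using False chain_Union_in by blast
    moreover have "Y \<subseteq> J \<union> \<Union>T" using y by blast
    ultimately show ?thesis unfolding T_def by blast
  qed
qed

text \<open>If nothing of \<open>B\<close> can be added and \<open>B\<close> is not inside
  \<open>J\<close>, a tight \<open>A\<close> covers \<open>B - J\<close>. Inside \<open>A\<close>
  the set \<open>B\<close> is no larger than the tight \<open>J\<close>, outside it is contained in
  \<open>J\<close>, which contradicts \<open>card J < \<rho> E\<close>.\<close>

lemma feasible_augment:
  assumes J: "feasible J" "card J < \<rho> E" and B: "B \<in> bases (nested E C \<rho>)"
  obtains y where "y \<in> B - J" "feasible (insert y J)"
proof -
  have fB: "finite B" "card B = \<rho> E" "feasible B" using B feasible_finite by (auto simp: basis_feasible)
  have fJ: "finite J" using feasible_finite J by blast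
  have "\<not> (\<forall>y\<in>B - J. \<not> feasible (insert y J))"
  proof
    assume "\<forall>y\<in>B - J. \<not> feasible (insert y J)"
    then consider "B \<subseteq> J" | A where "A \<in> C" "card (J \<inter> A) = \<rho> A" "B \<subseteq> J \<union> A"
      using feasible_maximal[OF J(1), of B] fB(3) unfolding feasible_def by blast
    then show False
    proof cases
      case 1
      then show False using fJ fB J(2) card_mono[of J B] by simp
    next
      case 2
      have "card B = card (B \<inter> A) + card (B - A)" using fB by (metis card_Int_Diff)
      also have "card (B \<inter> A) \<le> card (J \<inter> A)" using fB 2 by (simp add: feasible_def)
      also have "card (B - A) \<le> card (J - A)" using fJ 2 by (intro card_mono) auto
      also have "card (J \<inter> A) + card (J - A) = card J" using fJ by (metis card_Int_Diff)
      finally show False using fB J(2) by simp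
    qed
  qed
  then show ?thesis using that by blast
qed

lemma nested_matroid: "is_matroid (nested E C \<rho>)"
  unfolding is_matroid_def
proof (intro conjI ballI)
  show "finite (ground (nested E C \<rho>))" using finE by simp
  show "bases (nested E C \<rho>) \<noteq> {}" by (rule nonempty)
  show "B \<subseteq> ground (nested E C \<rho>)" if "B \<in> bases (nested E C \<rho>)" for B
    using that by (simp add: bases_nested)
  fix B B' x
  assume B: "B \<in> bases (nested E C \<rho>)" and B': "B' \<in> bases (nested E C \<rho>)" and x: "x \<in> B - B'"
  have fB: "finite B" "card B = \<rho> E" "feasible B" using B feasible_finite by (auto simp: basis_feasible)
  have "feasible (B - {x})" using feasible_subset fB by blast
  moreover have "card (B - {x}) < \<rho> E" using fB x by (metis DiffD1 card_Diff1_less)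
  ultimately obtain y where y: "y \<in> B' - (B - {x})" "feasible (insert y (B - {x}))"
    using feasible_augment[OF _ _ B'] by blast
  have "y \<in> B' - B" using y x by blast
  moreover from this have "card (insert y (B - {x})) = \<rho> E"
    using fB x card_Suc_Diff1[of B x] by simp
  ultimately show "\<exists>y\<in>B' - B. insert y (B - {x}) \<in> bases (nested E C \<rho>)"
    using y(2) basis_feasible by blast
qed

lemma feasible_extend:
  assumes "feasible J"
  obtains B where "B \<in> bases (nested E C \<rho>)" "J \<subseteq> B"
proof -
  have "\<exists>B\<in>bases (nested E C \<rho>). J \<subseteq> B" using assms
  proof (induction "\<rho> E - card J" arbitrary: J rule: less_induct)
    case less
    show ?case
    proof (cases "card J = \<rho> E")
      case True
      then show ?thesis using less.prems basis_feasible by blast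
    next
      case False
      then have lt: "card J < \<rho> E" using feasible_card_le[OF less.prems] by simp
      then obtain y where y: "y \<notin> J" "feasible (insert y J)"
        using feasible_augment[OF less.prems lt] nonempty by blast
      have "\<rho> E - card (insert y J) < \<rho> E - card J"
        using lt y feasible_finite[OF less.prems] by simp
      then show ?thesis using less.hyps[OF _ y(2)] by blast
    qed
  qed
  then show ?thesis using that by blast
qed

lemma rank_feasible:
  assumes "feasible J" "J \<subseteq> X"
  shows "card J \<le> rank_in (nested E C \<rho>) X"
proof -
  obtain B where B: "B \<in> bases (nested E C \<rho>)" "J \<subseteq> B" using feasible_extend[OF assms(1)] .
  have "card J \<le> card (B \<inter> X)"
    using B assms matroid_finite(5)[OF nested_matroid B(1)] by (intro card_mono) auto
  then show ?thesis using rank_ge_card_Int[OF nested_matroid B(1)] order_trans by blast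
qed

lemma rank_nested_le: "A \<in> C \<Longrightarrow> rank_in (nested E C \<rho>) A \<le> \<rho> A"
  by (rule rank_leI[OF nested_matroid]) (simp add: bases_nested)

lemma matroid_rank_nested: "matroid_rank (nested E C \<rho>) = \<rho> E"
proof -
  obtain B where "B \<in> bases (nested E C \<rho>)" using nonempty by blast
  then show ?thesis using card_basis[OF nested_matroid] by (metis bases_nested)
qed

text \<open>A maximal feasible subset \<open>J\<close> of \<open>X\<close> is either
  \<open>X\<close> or blocked by a tight \<open>A\<close> with
  \<open>X \<subseteq> J \<union> A\<close>. This is the lower half of the rank formula, the minimum
  of \<open>card X\<close> and of \<open>\<rho> A + card (X - A)\<close> over \<open>A\<close> in
  \<open>C\<close>.\<close>

lemma rank_nested_ge:
  assumes X: "X \<subseteq> E"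
  shows "card X \<le> rank_in (nested E C \<rho>) X \<or>
    (\<exists>A\<in>C. \<rho> A + card (X - A) \<le> rank_in (nested E C \<rho>) X)"
proof -
  let ?S = "{J. feasible J \<and> J \<subseteq> X}"
  have fX: "finite X" using X finE finite_subset by blast
  have "finite ?S" using fX by simp
  moreover have "{} \<in> ?S" by (auto simp: feasible_def)
  ultimately obtain J where J: "J \<in> ?S" "\<And>J'. J' \<in> ?S \<Longrightarrow> J \<subseteq> J' \<Longrightarrow> J' = J"
    using finite_has_maximal[of ?S] by (metis (no_types, lifting) empty_iff)
  have "\<not> feasible (insert y J)" if "y \<in> X - J" for y
    using J(1) J(2)[of "insert y J"] that by blast
  then consider "X \<subseteq> J" | A where "A \<in> C" "card (J \<inter> A) = \<rho> A" "X \<subseteq> J \<union> A"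
    using feasible_maximal[of J X] J(1) X by blast
  then show ?thesis
  proof cases
    case 1
    then show ?thesis using rank_feasible[of J X] J(1) by auto
  next
    case 2
    have fJ: "finite J" using J(1) feasible_finite by blast
    have "card (X - A) \<le> card (J - A)" using fJ 2 by (intro card_mono) auto
    then have "\<rho> A + card (X - A) \<le> card J" using 2 fJ by (metis add_left_mono card_Int_Diff)
    then show ?thesis using rank_feasible[of J X] J(1) 2(1) by fastforce
  qed
qed

text \<open>A circuit violates the bound of some \<open>A\<close> in \<open>C\<close>; minimality
  puts it inside \<open>A\<close> with rank at least \<open>\<rho> A\<close>, so it spans
  \<open>A\<close> and every flat containing it contains \<open>A\<close>. A cyclic flat is
  therefore a union of members of the chain; the empty union accounts for \<open>{}\<close>.\<close>

lemma cyclic_flats_nested: "cyclic_flats (nested E C \<rho>) \<subseteq> insert {} C"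
proof
  let ?N = "nested E C \<rho>"
  note M = nested_matroid
  fix F assume "F \<in> cyclic_flats ?N"
  then obtain K where F: "F \<in> flats ?N" and K: "K \<subseteq> circuits ?N" "F = \<Union>K"
    unfolding cyclic_flats_def by blast
  have FE: "F \<subseteq> E" using F by (simp add: flats_def)
  have *: "\<exists>A\<in>C. k \<subseteq> A \<and> A \<subseteq> F" if "k \<in> K" for k
  proof -
    have k: "k \<subseteq> E" "\<not> indep_in ?N k" "\<And>D. D \<subset> k \<Longrightarrow> indep_in ?N D"
      using K that unfolding circuits_def by auto
    have fk: "finite k" using k(1) finE finite_subset by blast
    have "\<not> feasible k" using k(2) feasible_extend unfolding indep_in_def by blast
    then obtain A where A: "A \<in> C" "card (k \<inter> A) > \<rho> A" using k(1) by (auto simp: feasible_def not_le)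
    have le: "card (D \<inter> A) \<le> \<rho> A" if D: "D \<subset> k" for D
    proof -
      obtain B where B: "B \<in> bases ?N" "D \<subseteq> B" using k(3)[OF D] unfolding indep_in_def by blast
      have "card (D \<inter> A) \<le> card (B \<inter> A)"
        using B matroid_finite(5)[OF M B(1)] by (intro card_mono) auto
      then show ?thesis using B(1) A(1) by (auto simp: bases_nested)
    qed
    have kA: "k \<subseteq> A"
    proof (rule ccontr)
      assume "\<not> k \<subseteq> A"
      then have "k \<inter> A \<subset> k" by blast
      then show False using le[of "k \<inter> A"] A(2) by simp
    qed
    have "k \<noteq> {}" using k(2) nonempty by (auto simp: indep_in_def)
    then obtain a where a: "a \<in> k" by blast
    obtain B where B: "B \<in> bases ?N" "k - {a} \<subseteq> B" using k(3)[of "k - {a}"] a unfolding indep_in_def by blast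
    have kF: "k \<subseteq> F" using K that by blast
    have "\<rho> A \<le> card (k - {a})" using A(2) kA a fk by (simp add: Int_absorb2)
    also have "\<dots> \<le> card (B \<inter> (F \<inter> A))"
      using B matroid_finite(5)[OF M B(1)] kA kF by (intro card_mono) auto
    also have "\<dots> \<le> rank_in ?N (F \<inter> A)" by (rule rank_ge_card_Int[OF M B(1)])
    finally have "rank_in ?N (F \<inter> A) \<ge> rank_in ?N A" using rank_nested_le[OF A(1)] by simp
    then have u: "rank_in ?N (F \<union> A) \<le> rank_in ?N F" using rank_submodular[OF M, of F A] by simp
    have "A \<subseteq> F"
    proof
      fix e assume e: "e \<in> A"
      show "e \<in> F"
      proof (rule ccontr)
        assume "e \<notin> F"
        then have "rank_in ?N F < rank_in ?N (insert e F)"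
          using F e A(1) CE unfolding flats_def by auto
        also have "\<dots> \<le> rank_in ?N (F \<union> A)" using e by (intro rank_mono[OF M]) auto
        finally show False using u by simp
      qed
    qed
    then show ?thesis using A(1) kA by blast
  qed
  define T where "T = {A \<in> C. A \<subseteq> F \<and> (\<exists>k\<in>K. k \<subseteq> A)}"
  have FT: "F = \<Union>T" using * K(2) unfolding T_def by blast
  show "F \<in> insert {} C"
  proof (cases "T = {}")
    case True
    then show ?thesis using FT by blast
  next
    case False
    have "finite T" using CE finE by (auto simp: T_def intro: finite_subset)
    moreover have "chain\<^sub>\<subseteq> T" using chain by (auto simp: T_def chain_subset_def)
    ultimately have "\<Union>T \<in> T" using False chain_Union_in by blast
    then have "\<Union>T \<in> C" by (simp add: T_def)
    then show ?thesis using FT by simp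
  qed
qed

lemma nested_schubert: "is_schubert (nested E C \<rho>)"
  unfolding is_schubert_def
proof
  show "is_matroid (nested E C \<rho>)" by (rule nested_matroid)
  have "chain\<^sub>\<subseteq> (insert {} C)" using chain by (auto simp: chain_subset_def)
  then show "chain\<^sub>\<subseteq> (cyclic_flats (nested E C \<rho>))"
    using cyclic_flats_nested unfolding chain_subset_def by blast
qed

end

text \<open>The bounds on the chain and the unit cube imply all rank inequalities, by
  \<open>rank_nested_ge\<close>. Up to conditions independent of \<open>C\<close>, membership is
  thus one condition per member of \<open>C\<close>, as inclusion-exclusion over subchains
  requires.\<close>

lemma base_polytope_nested:
  fixes E :: "nat set"
  assumes "nested_chain E C \<rho>"
  shows "x \<in> base_polytope (nested E C \<rho>) \<longleftrightarrow>
    (\<forall>i. i \<notin> E \<longrightarrow> Poly_Mapping.lookup x i = 0) \<and>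
    (\<forall>i\<in>E. 0 \<le> Poly_Mapping.lookup x i \<and> Poly_Mapping.lookup x i \<le> 1) \<and>
    weight x E = \<rho> E \<and> (\<forall>A\<in>C. weight x A \<le> \<rho> A)"
proof -
  interpret nested_chain E C \<rho> by fact
  let ?N = "nested E C \<rho>"
  note M = nested_matroid
  show ?thesis unfolding base_polytope_eq_rank_polytope[OF M]
  proof (intro iffI conjI ballI)
    assume x: "x \<in> rank_polytope ?N"
    show "\<forall>i. i \<notin> E \<longrightarrow> Poly_Mapping.lookup x i = 0" "weight x E = \<rho> E"
      using x by (auto simp: rank_polytope_def matroid_rank_nested)
    show "0 \<le> Poly_Mapping.lookup x i" "Poly_Mapping.lookup x i \<le> 1" if "i \<in> E" for i
      using rank_polytope_cube[OF M x] that by auto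
    show "weight x A \<le> \<rho> A" if A: "A \<in> C" for A
    proof -
      have "weight x A \<le> rank_in ?N A" using x A CE by (auto simp: rank_polytope_def)
      then show ?thesis using rank_nested_le[OF A] by linarith
    qed
  next
    assume x: "(\<forall>i. i \<notin> E \<longrightarrow> Poly_Mapping.lookup x i = 0) \<and>
      (\<forall>i\<in>E. 0 \<le> Poly_Mapping.lookup x i \<and> Poly_Mapping.lookup x i \<le> 1) \<and>
      weight x E = \<rho> E \<and> (\<forall>A\<in>C. weight x A \<le> \<rho> A)"
    have le_card: "weight x X \<le> card X" if "X \<subseteq> E" for X
      using sum_bounded_above[of X "Poly_Mapping.lookup x" 1] x that by auto
    have "weight x X \<le> rank_in ?N X" if X: "X \<subseteq> E" for X
      using rank_nested_ge[OF X]
    proof (elim disjE bexE)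
      assume "card X \<le> rank_in ?N X"
      then show ?thesis using le_card[OF X] by linarith
    next
      fix A assume A: "A \<in> C" "\<rho> A + card (X - A) \<le> rank_in ?N X"
      have AE: "A \<subseteq> E" using A CE by auto
      have fX: "finite X" using X finE finite_subset by blast
      have "weight x X = weight x (X \<inter> A) + weight x (X - A)"
        using fX by (rule sum.Int_Diff)
      also have "weight x (X \<inter> A) \<le> weight x A"
        using AE x finE by (intro sum_mono2) (auto intro: finite_subset)
      also have "weight x A \<le> \<rho> A" using x A(1) by blast
      also have "weight x (X - A) \<le> card (X - A)" using X by (intro le_card) auto
      finally have "weight x X \<le> real (\<rho> A + card (X - A))" by simp
      then show ?thesis using A(2) by linarith
    qed
    then show "x \<in> rank_polytope ?N" using x by (simp add: rank_polytope_def matroid_rank_nested)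
  qed
qed

section \<open>Circuits, closures and cyclic flats\<close>

lemma dependent_contains_circuit:
  assumes M: "is_matroid M" and X: "X \<subseteq> ground M" "\<not> indep_in M X"
  obtains K where "K \<in> circuits M" "K \<subseteq> X"
proof -
  let ?S = "{K. K \<subseteq> X \<and> \<not> indep_in M K}"
  have "finite X" using X(1) matroid_finite(1)[OF M] finite_subset by blast
  then have "finite ?S" by simp
  moreover have "X \<in> ?S" using X by simp
  ultimately obtain K where K: "K \<in> ?S" "\<And>K'. K' \<in> ?S \<Longrightarrow> K' \<subseteq> K \<Longrightarrow> K' = K"
    using finite_has_minimal[of ?S] by (metis (no_types, lifting) empty_iff)
  have "K \<in> circuits M" unfolding circuits_def using K X by blast
  then show ?thesis using that K by blast
qed

lemma circuit_rank:
  assumes M: "is_matroid M" and K: "K \<in> circuits M"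
  shows "rank_in M K < card K"
proof -
  have fK: "finite K" using K matroid_finite(1)[OF M] by (auto simp: circuits_def intro: finite_subset)
  obtain B where B: "B \<in> bases M" "card (B \<inter> K) = rank_in M K" using rank_attained[OF M] .
  have "\<not> K \<subseteq> B" using K B(1) by (auto simp: circuits_def indep_in_def)
  then have "B \<inter> K \<subset> K" by blast
  then show ?thesis using B(2) fK psubset_card_mono by metis
qed

definition matroid_closure :: "'a matroid \<Rightarrow> 'a set \<Rightarrow> 'a set" where
  "matroid_closure M X = {e \<in> ground M. rank_in M (insert e X) = rank_in M X}"

lemma subset_closure: "X \<subseteq> ground M \<Longrightarrow> X \<subseteq> matroid_closure M X"
  by (auto simp: matroid_closure_def insert_absorb)

text \<open>A basis attaining both ranks cannot meet the closure outside \<open>X\<close>, since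
  such an element alone would raise the rank of \<open>X\<close>.\<close>

lemma rank_closure:
  assumes M: "is_matroid M" and X: "X \<subseteq> ground M"
  shows "rank_in M (matroid_closure M X) = rank_in M X"
proof -
  let ?L = "matroid_closure M X"
  have XL: "X \<subseteq> ?L" by (rule subset_closure[OF X])
  obtain B where B: "B \<in> bases M" "\<And>Z. Z \<in> {X, ?L} \<Longrightarrow> card (B \<inter> Z) = rank_in M Z"
    using chain_basis[OF M, of "{X, ?L}"] XL by (auto simp: chain_subset_def)
  have "B \<inter> ?L \<subseteq> X"
  proof (rule ccontr)
    assume "\<not> B \<inter> ?L \<subseteq> X"
    then obtain e where e: "e \<in> B" "e \<in> ?L" "e \<notin> X" by blast
    have "B \<inter> insert e X = insert e (B \<inter> X)" using e by blast
    then have "card (B \<inter> insert e X) = Suc (card (B \<inter> X))"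
      using e matroid_finite(5)[OF M B(1)] by simp
    then show False
      using e B(2)[of X] rank_ge_card_Int[OF M B(1), of "insert e X"] by (simp add: matroid_closure_def)
  qed
  then have "B \<inter> ?L = B \<inter> X" using XL by blast
  then show ?thesis using B(2) by (metis insertI1 insertI2 singletonI)
qed

lemma closure_circuit_cyclic_flat:
  assumes M: "is_matroid M" and K: "K \<in> circuits M"
  shows "matroid_closure M K \<in> cyclic_flats M"
proof -
  let ?L = "matroid_closure M K"
  have KE: "K \<subseteq> ground M" using K by (simp add: circuits_def)
  have KL: "K \<subseteq> ?L" by (rule subset_closure[OF KE])
  have LE: "?L \<subseteq> ground M" by (auto simp: matroid_closure_def)
  have flat: "?L \<in> flats M" unfolding flats_def
  proof (intro CollectI conjI ballI LE)
    fix e assume e: "e \<in> ground M - ?L"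
    have "rank_in M K \<noteq> rank_in M (insert e K)" using e by (auto simp: matroid_closure_def)
    moreover have "rank_in M K \<le> rank_in M (insert e K)" by (intro rank_mono[OF M]) auto
    moreover have "rank_in M (insert e K) \<le> rank_in M (insert e ?L)" using KL by (intro rank_mono[OF M]) auto
    ultimately show "rank_in M ?L < rank_in M (insert e ?L)" using rank_closure[OF M KE] by simp
  qed
  have "\<exists>k\<in>circuits M. e \<in> k \<and> k \<subseteq> ?L" if e: "e \<in> ?L" for e
  proof (cases "e \<in> K")
    case True
    then show ?thesis using K KL by blast
  next
    case False
    obtain B where B: "B \<in> bases M" "card (B \<inter> K) = rank_in M K" using rank_attained[OF M] .
    let ?I = "B \<inter> K"
    have fI: "finite ?I" using matroid_finite(5)[OF M B(1)] by simp
    \<comment> \<open>\<open>?I\<close> is a maximal independent subset of \<open>K\<close>; adding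
      \<open>e\<close> from the closure makes it dependent, and the resulting circuit has to use
      \<open>e\<close>. So circuits cover the closure.\<close>
    have "\<not> indep_in M (insert e ?I)"
    proof
      assume "indep_in M (insert e ?I)"
      then obtain B' where B': "B' \<in> bases M" "insert e ?I \<subseteq> B'" unfolding indep_in_def by blast
      have "Suc (rank_in M K) = card (insert e ?I)" using False fI B(2) by simp
      also have "\<dots> \<le> card (B' \<inter> insert e K)"
        using B' matroid_finite(5)[OF M B'(1)] by (intro card_mono) auto
      also have "\<dots> \<le> rank_in M (insert e K)" by (rule rank_ge_card_Int[OF M B'(1)])
      finally show False using e by (simp add: matroid_closure_def)
    qed
    moreover have "insert e ?I \<subseteq> ground M" using e LE KE by blast
    ultimately obtain k where k: "k \<in> circuits M" "k \<subseteq> insert e ?I"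
      using dependent_contains_circuit[OF M] by blast
    have "e \<in> k"
    proof (rule ccontr)
      assume "e \<notin> k"
      then have "k \<subseteq> B" using k(2) by blast
      then show False using k(1) B(1) by (auto simp: circuits_def indep_in_def)
    qed
    then show ?thesis using k KL e by blast
  qed
  then have "?L = \<Union>{k \<in> circuits M. k \<subseteq> ?L}" by blast
  moreover have "{k \<in> circuits M. k \<subseteq> ?L} \<subseteq> circuits M" by blast
  ultimately have "\<exists>\<C>\<subseteq>circuits M. ?L = \<Union>\<C>" by metis
  then show ?thesis using flat by (simp add: cyclic_flats_def)
qed

text \<open>A dependent \<open>B\<close> contains a circuit, and the closure of that circuit is a
  cyclic flat in which \<open>B\<close> exceeds the rank. Hence ground set, rank and the cyclic
  flats with their ranks determine a matroid.\<close>

lemma basisI_cyclic_flats: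
  assumes M: "is_matroid M" and B: "B \<subseteq> ground M" "card B = matroid_rank M"
    and F: "\<And>F. F \<in> cyclic_flats M \<Longrightarrow> card (B \<inter> F) \<le> rank_in M F"
  shows "B \<in> bases M"
proof (rule ccontr)
  assume nB: "B \<notin> bases M"
  have fB: "finite B" using B(1) matroid_finite(1)[OF M] finite_subset by blast
  have "\<not> indep_in M B"
  proof
    assume "indep_in M B"
    then obtain B' where B': "B' \<in> bases M" "B \<subseteq> B'" unfolding indep_in_def by blast
    then have "B = B'" using card_basis[OF M B'(1)] B(2) matroid_finite(5)[OF M B'(1)] by (simp add: card_subset_eq)
    then show False using nB B' by simp
  qed
  then obtain K where K: "K \<in> circuits M" "K \<subseteq> B" using dependent_contains_circuit[OF M B(1)] by blast
  have KE: "K \<subseteq> ground M" using K B by blast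
  have "card K \<le> card (B \<inter> matroid_closure M K)"
    using K fB subset_closure[OF KE] by (intro card_mono) auto
  also have "\<dots> \<le> rank_in M (matroid_closure M K)" using F closure_circuit_cyclic_flat[OF M K(1)] .
  also have "\<dots> = rank_in M K" by (rule rank_closure[OF M KE])
  finally show False using circuit_rank[OF M K(1)] by simp
qed

section \<open>Linear relations between indicator functions of polytopes\<close>

text \<open>The value of the combination at \<open>c\<close> minus its value just to the right of
  \<open>c\<close> is the total coefficient of the intervals ending at \<open>c\<close>. Every
  nonempty interval has exactly one right end, so summing over \<open>c\<close> counts each
  once.\<close>

lemma sum_nonempty_intervals:
  fixes J :: "'i \<Rightarrow> real set" and b :: "'i \<Rightarrow> real"
  assumes fin: "finite I" and J: "\<And>i. i \<in> I \<Longrightarrow> compact (J i)" "\<And>i. i \<in> I \<Longrightarrow> convex (J i)"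
    and rel: "\<And>t. (\<Sum>i\<in>I. b i * indicator (J i) t) = 0"
  shows "(\<Sum>i\<in>I. b i * of_bool (J i \<noteq> {})) = 0"
proof -
  define I' where "I' = {i \<in> I. J i \<noteq> {}}"
  have finI': "finite I'" using fin by (simp add: I'_def)
  have "\<exists>l u. J i = {l..u} \<and> l \<le> u" if i: "i \<in> I'" for i
  proof -
    have "connected (J i) \<and> compact (J i)" using i J convex_connected by (auto simp: I'_def)
    then obtain l u where "J i = {l..u}" using connected_compact_interval_1[of "J i"] by auto
    then show ?thesis using i by (auto simp: I'_def)
  qed
  then obtain l u where lu: "\<And>i. i \<in> I' \<Longrightarrow> J i = {l i..u i}" "\<And>i. i \<in> I' \<Longrightarrow> l i \<le> u i" by metis
  have rel': "(\<Sum>i\<in>I'. b i * indicator (J i) t) = 0" for t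
  proof -
    have "(\<Sum>i\<in>I'. b i * indicator (J i) t) = (\<Sum>i\<in>I. b i * indicator (J i) t)"
      using fin by (intro sum.mono_neutral_left) (auto simp: I'_def)
    then show ?thesis using rel by simp
  qed
  have end0: "(\<Sum>i\<in>{i \<in> I'. u i = c}. b i) = 0" for c
  proof -
    define D where "D = {d \<in> u ` I' \<union> l ` I'. d > c}"
    \<comment> \<open>\<open>m\<close> is at most the next end point to the right of
      \<open>c\<close>, and \<open>c + 1\<close> keeps the minimum defined when there is none. No
      interval begins or ends strictly between \<open>c\<close> and \<open>m\<close>.\<close>
    define m where "m = Min (insert (c + 1) D)"
    have finD: "finite D" using finI' by (simp add: D_def)
    have "m \<in> insert (c + 1) D" unfolding m_def by (rule Min_in) (use finD in auto)
    then have "c < m" by (auto simp: D_def)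
    then obtain c' where c': "c < c'" "c' < m" using dense by blast
    have le: "m \<le> d" if "d \<in> D" for d using that finD by (simp add: m_def)
    have mu: "m \<le> u i" if "i \<in> I'" "c < u i" for i using that by (intro le) (auto simp: D_def)
    have ml: "m \<le> l i" if "i \<in> I'" "c < l i" for i using that by (intro le) (auto simp: D_def)
    have "b i * indicator (J i) c - b i * indicator (J i) c' = (if u i = c then b i else 0)"
      if i: "i \<in> I'" for i
      using lu[OF i] mu[OF i] ml[OF i] c' by (auto simp: indicator_def)
    then have "(\<Sum>i\<in>I'. b i * indicator (J i) c) - (\<Sum>i\<in>I'. b i * indicator (J i) c') =
        (\<Sum>i\<in>I'. if u i = c then b i else 0)"
      by (simp flip: sum_subtractf)
    then show ?thesis using rel' finI' by (simp add: sum.inter_filter)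
  qed
  have "(\<Sum>i\<in>I. b i * of_bool (J i \<noteq> {})) = (\<Sum>i\<in>I'. b i)"
    unfolding I'_def using fin by (simp add: sum.inter_filter of_bool_def if_distrib cong: if_cong)
  also have "\<dots> = (\<Sum>c\<in>u ` I'. \<Sum>i\<in>{i \<in> I'. u i = c}. b i)"
    by (rule sum.image_gen[OF finI'])
  finally show ?thesis by (simp add: end0)
qed

lemma bounded_linear_lookup: "bounded_linear (\<lambda>x :: 'a \<Rightarrow>\<^sub>0 real. Poly_Mapping.lookup x k)"
proof (rule bounded_linear_intro[where K = 1])
  fix x :: "'a \<Rightarrow>\<^sub>0 real"
  have "norm (Poly_Mapping.lookup x k) \<le> norm x"
  proof (cases "k \<in> Poly_Mapping.keys x")
    case True
    moreover have "norm x = (\<Sum>n\<in>Poly_Mapping.keys x. norm (Poly_Mapping.lookup x n))"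
      by (simp add: norm_poly_mapping_def dist_poly_mapping_def)
    ultimately show ?thesis
      by (simp only:) (intro member_le_sum[where f = "\<lambda>n. norm (Poly_Mapping.lookup x n)"], auto)
  next
    case False
    then show ?thesis by (simp add: in_keys_iff)
  qed
  then show "norm (Poly_Mapping.lookup x k) \<le> norm x * 1" by simp
qed (simp_all add: lookup_add lookup_scaleR)

text \<open>The Euler characteristic of the relation: project away one coordinate at a time, the
  fibres of a projection being compact intervals.\<close>

lemma sum_nonempty_convex:
  fixes P :: "'i \<Rightarrow> ('a \<Rightarrow>\<^sub>0 real) set" and b :: "'i \<Rightarrow> real"
  assumes "finite K" and fin: "finite I"
    and "\<And>i. i \<in> I \<Longrightarrow> compact (P i)" "\<And>i. i \<in> I \<Longrightarrow> convex (P i)"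
    and "\<And>i x k. i \<in> I \<Longrightarrow> x \<in> P i \<Longrightarrow> k \<notin> K \<Longrightarrow> Poly_Mapping.lookup x k = 0"
    and "\<And>x. (\<Sum>i\<in>I. b i * indicator (P i) x) = 0"
  shows "(\<Sum>i\<in>I. b i * of_bool (P i \<noteq> {})) = 0"
  using assms(1,3-)
proof (induction K arbitrary: P rule: finite_induct)
  case empty
  have "P i \<noteq> {} \<longleftrightarrow> 0 \<in> P i" if i: "i \<in> I" for i
  proof -
    have "x = 0" if "x \<in> P i" for x
      using empty.prems(3)[OF i that] by (intro poly_mapping_eqI) simp
    then show ?thesis by blast
  qed
  then have "(\<Sum>i\<in>I. b i * of_bool (P i \<noteq> {})) = (\<Sum>i\<in>I. b i * indicator (P i) 0)"
    by (intro sum.cong) (auto simp: indicator_def)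
  then show ?case using empty.prems(4) by simp
next
  case (insert k K)
  let ?e = "Poly_Mapping.single k (1 :: real)"
  let ?L = "\<lambda>x :: 'a \<Rightarrow>\<^sub>0 real. Poly_Mapping.lookup x k"
  define \<pi> where "\<pi> x = x - ?L x *\<^sub>R ?e" for x
  have e: "Poly_Mapping.lookup ?e j = (if j = k then 1 else 0)" for j by (simp add: lookup_single when_def)
  have bl: "bounded_linear \<pi>" unfolding \<pi>_def
    by (intro bounded_linear_sub bounded_linear_ident bounded_linear_scaleR_const bounded_linear_lookup)
  have \<pi>k: "?L (\<pi> x) = 0" for x by (simp add: \<pi>_def lookup_minus lookup_scaleR e)
  have "(\<Sum>i\<in>I. b i * of_bool (\<pi> ` P i \<noteq> {})) = 0"
  proof (rule insert.IH)
    fix i assume i: "i \<in> I"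
    show "compact (\<pi> ` P i)"
      using insert.prems(1)[OF i] bl by (intro compact_continuous_image linear_continuous_on)
    show "convex (\<pi> ` P i)"
      using insert.prems(2)[OF i] bl by (intro convex_linear_image) (simp_all add: bounded_linear.linear)
    fix y j assume "y \<in> \<pi> ` P i" "j \<notin> K"
    then obtain x where x: "x \<in> P i" "y = \<pi> x" by blast
    show "Poly_Mapping.lookup y j = 0"
    proof (cases "j = k")
      case True
      then show ?thesis using x \<pi>k by simp
    next
      case False
      then show ?thesis using x insert.prems(3)[OF i x(1), of j] \<open>j \<notin> K\<close>
        by (simp add: \<pi>_def lookup_minus lookup_scaleR e)
    qed
  next
    fix y
    show "(\<Sum>i\<in>I. b i * indicator (\<pi> ` P i) y) = 0"
    proof (cases "?L y = 0")
      case False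
      then have "y \<notin> \<pi> ` P i" for i using \<pi>k by auto
      then show ?thesis by simp
    next
      case True
      \<comment> \<open>\<open>J i\<close> is the fibre of \<open>P i\<close> over \<open>y\<close>,
        nonempty exactly when \<open>y\<close> lies in the projection; the one-dimensional case for
        the fibres is therefore the relation between the projections at \<open>y\<close>.\<close>
      define J where "J i = (\<lambda>t. y + t *\<^sub>R ?e) -` P i" for i
      have Lt: "?L (y + t *\<^sub>R ?e) = t" for t using True by (simp add: lookup_add lookup_scaleR e)
      have "(\<Sum>i\<in>I. b i * of_bool (J i \<noteq> {})) = 0"
      proof (rule sum_nonempty_intervals[OF fin])
        fix i assume i: "i \<in> I"
        have "closed (J i)" unfolding J_def
          by (intro continuous_closed_vimage compact_imp_closed insert.prems(1)[OF i] continuous_intros)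
        moreover have "J i \<subseteq> ?L ` P i"
        proof
          fix t assume "t \<in> J i"
          then show "t \<in> ?L ` P i" using Lt[of t] unfolding J_def by (metis imageI vimageE)
        qed
        moreover have "compact (?L ` P i)"
          using insert.prems(1)[OF i] bounded_linear_lookup
          by (intro compact_continuous_image linear_continuous_on)
        ultimately show "compact (J i)"
          using compact_eq_bounded_closed bounded_subset by blast
        show "convex (J i)"
        proof (rule convexI)
          fix s t u v :: real assume a: "s \<in> J i" "t \<in> J i" "0 \<le> u" "0 \<le> v" "u + v = 1"
          have "u *\<^sub>R (y + s *\<^sub>R ?e) + v *\<^sub>R (y + t *\<^sub>R ?e) \<in> P i"
            using a insert.prems(2)[OF i] unfolding J_def by (intro convexD) auto
          moreover have "u *\<^sub>R (y + s *\<^sub>R ?e) + v *\<^sub>R (y + t *\<^sub>R ?e) =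
              (u + v) *\<^sub>R y + (u * s + v * t) *\<^sub>R ?e" by (simp add: scaleR_add_right scaleR_add_left)
          ultimately show "u *\<^sub>R s + v *\<^sub>R t \<in> J i" using a(5) by (simp add: J_def)
        qed
      next
        fix t
        have "(\<Sum>i\<in>I. b i * indicator (P i) (y + t *\<^sub>R ?e)) = 0" by (rule insert.prems(4))
        then show "(\<Sum>i\<in>I. b i * indicator (J i) t) = 0" by (simp add: J_def indicator_def)
      qed
      moreover have "y \<in> \<pi> ` P i \<longleftrightarrow> J i \<noteq> {}" for i
      proof
        assume "y \<in> \<pi> ` P i"
        then obtain x where x: "x \<in> P i" "y = \<pi> x" by blast
        then have "?L x \<in> J i" by (simp add: J_def \<pi>_def)
        then show "J i \<noteq> {}" by blast
      next
        assume "J i \<noteq> {}"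
        then obtain t where t: "y + t *\<^sub>R ?e \<in> P i" by (auto simp: J_def)
        have "\<pi> (y + t *\<^sub>R ?e) = y" using Lt[of t] by (simp add: \<pi>_def)
        then show "y \<in> \<pi> ` P i" using t by (metis imageI)
      qed
      ultimately show ?thesis by (simp add: indicator_def of_bool_def)
    qed
  qed
  then show ?case by simp
qed

section \<open>Valuative tests on base polytopes\<close>

lemma base_polytope_compact_convex:
  assumes "is_matroid M"
  shows "compact (base_polytope M)" "convex (base_polytope M)"
  using matroid_finite(2)[OF assms] by (simp_all add: base_polytope_def finite_imp_compact_convex_hull)

text \<open>An indexed family rather than a set of matroids, so that a matroid may occur twice: the
  expansion of \<open>M\<close> is used below with \<open>M\<close> as an additional member, even if
  \<open>M\<close> is itself Schubert.\<close>

definition polytope_relation :: "nat set \<Rightarrow> 'i set \<Rightarrow> ('i \<Rightarrow> nat matroid) \<Rightarrow> ('i \<Rightarrow> real) \<Rightarrow> bool" where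
  "polytope_relation E I m b \<longleftrightarrow> finite I \<and> (\<forall>i\<in>I. is_matroid (m i) \<and> ground (m i) = E) \<and>
     (\<forall>x. (\<Sum>i\<in>I. b i * indicator (base_polytope (m i)) x) = 0)"

text \<open>Multiplying the relation by the indicator of \<open>K\<close> replaces each polytope by
  its compact convex intersection with \<open>K\<close>, whose Euler characteristic is 1 or 0
  according to whether it is nonempty.\<close>

lemma polytope_relation_meets:
  assumes rel: "polytope_relation E I m b" and K: "closed K" "convex K"
  shows "(\<Sum>i\<in>I. b i * of_bool (base_polytope (m i) \<inter> K \<noteq> {})) = 0"
proof (cases "I = {}")
  case False
  have M: "is_matroid (m i)" "ground (m i) = E" if "i \<in> I" for i
    using rel that by (auto simp: polytope_relation_def)
  have "finite E" using False M matroid_finite(1) by blast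
  then show ?thesis
  proof (rule sum_nonempty_convex)
    show "finite I" using rel by (simp add: polytope_relation_def)
    show "compact (base_polytope (m i) \<inter> K)" "convex (base_polytope (m i) \<inter> K)" if "i \<in> I" for i
      using base_polytope_compact_convex[OF M(1)[OF that]] K by (auto intro: compact_Int_closed convex_Int)
    show "Poly_Mapping.lookup x k = 0" if "i \<in> I" "x \<in> base_polytope (m i) \<inter> K" "k \<notin> E" for i x k
      using that M base_polytope_subset_rank_polytope[of "m i"] by (auto simp: rank_polytope_def)
    show "(\<Sum>i\<in>I. b i * indicator (base_polytope (m i) \<inter> K) x) = 0" for x
    proof (cases "x \<in> K")
      case True
      then show ?thesis using rel by (simp add: polytope_relation_def indicator_def)
    qed (simp add: indicator_def)
  qed
qed simp

lemma closed_convex_weight_ge: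
  fixes \<CC> :: "'a set set" and c :: real
  shows "closed {x. c \<le> (\<Sum>A\<in>\<CC>. weight x A)}" "convex {x. c \<le> (\<Sum>A\<in>\<CC>. weight x A)}"
proof -
  have bl: "bounded_linear (\<lambda>x. \<Sum>A\<in>\<CC>. weight x A)"
    by (intro bounded_linear_sum bounded_linear_lookup)
  then show "closed {x. c \<le> (\<Sum>A\<in>\<CC>. weight x A)}"
    by (intro closed_Collect_le linear_continuous_on continuous_intros)
  have "{x. c \<le> (\<Sum>A\<in>\<CC>. weight x A)} = (\<lambda>x. \<Sum>A\<in>\<CC>. weight x A) -` {c..}" by auto
  then show "convex {x. c \<le> (\<Sum>A\<in>\<CC>. weight x A)}"
    using bl by (simp add: convex_linear_vimage bounded_linear.linear)
qed

text \<open>Having prescribed ranks on a chain is a valuative property: it is a difference of the two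
  properties of meeting \<open>{x. \<forall>A\<in>C. x(A) \<ge> \<rho> A}\<close> and of meeting its subset cut out by
  \<open>\<Sum>A\<in>C. x(A) \<ge> (\<Sum>A\<in>C. \<rho> A) + 1\<close>.\<close>

lemma polytope_relation_ranks:
  assumes rel: "polytope_relation E I m b" and C: "C \<subseteq> Pow E" "chain\<^sub>\<subseteq> C"
  shows "(\<Sum>i\<in>I. b i * of_bool (\<forall>A\<in>C. rank_in (m i) A = \<rho> A)) = 0"
proof (cases "I = {}")
  case False
  have M: "is_matroid (m i)" "ground (m i) = E" if "i \<in> I" for i
    using rel that by (auto simp: polytope_relation_def)
  have finE: "finite E" using False M matroid_finite(1) by blast
  have finC: "finite C" using C(1) finE finite_subset by auto
  define K where "K = {x. \<forall>A\<in>C. real (\<rho> A) \<le> weight x A}"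
  define K' where "K' = K \<inter> {x. 1 + (\<Sum>A\<in>C. real (\<rho> A)) \<le> (\<Sum>A\<in>C. weight x A)}"
  have "K = (\<Inter>A\<in>C. {x. real (\<rho> A) \<le> (\<Sum>A\<in>{A}. weight x A)})" by (auto simp: K_def)
  then have K: "closed K" "convex K"
    using closed_convex_weight_ge[of _ "{_}"] by (auto intro!: closed_INT convex_INT)
  then have K': "closed K'" "convex K'"
    unfolding K'_def by (auto intro!: closed_Int convex_Int closed_convex_weight_ge)
  have ind: "of_bool (\<forall>A\<in>C. rank_in (m i) A = \<rho> A) =
     of_bool (base_polytope (m i) \<inter> K \<noteq> {}) - (of_bool (base_polytope (m i) \<inter> K' \<noteq> {}) :: real)"
    if i: "i \<in> I" for i
  proof -
    let ?r = "rank_in (m i)"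
    \<comment> \<open>One vertex attains the maximal weights of all members of the chain
      simultaneously, so it lies in \<open>K\<close>, or in \<open>K'\<close>, as soon as any point
      of the polytope does. The gap 1 in \<open>K'\<close> expresses strict inequality because ranks
      are integers.\<close>
    obtain B where B: "B \<in> bases (m i)" "\<And>A. A \<in> C \<Longrightarrow> card (B \<inter> A) = ?r A"
      using chain_basis[OF M(1)[OF i] finC C(2)] by blast
    have w: "weight (basis_vec B) A = ?r A" if "A \<in> C" for A
      using weight_basis_vec[OF matroid_finite(5)[OF M(1)[OF i] B(1)], of A] B(2)[OF that] that C(1) finE
      by (auto intro: finite_subset)
    have up: "weight x A \<le> ?r A" if "x \<in> base_polytope (m i)" "A \<in> C" for x A
    proof -
      have "x \<in> rank_polytope (m i)" using base_polytope_subset_rank_polytope[OF M(1)[OF i]] that(1) by blast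
      moreover have "A \<subseteq> ground (m i)" using that(2) C(1) M(2)[OF i] by auto
      ultimately show ?thesis by (simp add: rank_polytope_def)
    qed
    have "base_polytope (m i) \<inter> K \<noteq> {} \<longleftrightarrow> (\<forall>A\<in>C. \<rho> A \<le> ?r A)"
    proof
      assume "base_polytope (m i) \<inter> K \<noteq> {}"
      then obtain x where "x \<in> base_polytope (m i)" "x \<in> K" by blast
      then show "\<forall>A\<in>C. \<rho> A \<le> ?r A" using up unfolding K_def by fastforce
    next
      assume "\<forall>A\<in>C. \<rho> A \<le> ?r A"
      then have "basis_vec B \<in> K" using w by (simp add: K_def)
      then show "base_polytope (m i) \<inter> K \<noteq> {}" using basis_vec_in_base_polytope[OF B(1)] by blast
    qed
    moreover have "base_polytope (m i) \<inter> K' \<noteq> {} \<longleftrightarrow> (\<forall>A\<in>C. \<rho> A \<le> ?r A) \<and> sum \<rho> C < sum ?r C"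
    proof
      assume "base_polytope (m i) \<inter> K' \<noteq> {}"
      then obtain x where x: "x \<in> base_polytope (m i)" "x \<in> K'" by blast
      have "1 + (\<Sum>A\<in>C. real (\<rho> A)) \<le> (\<Sum>A\<in>C. weight x A)" using x(2) by (simp add: K'_def)
      also have "\<dots> \<le> (\<Sum>A\<in>C. real (?r A))" using up[OF x(1)] by (intro sum_mono)
      finally have "real (Suc (sum \<rho> C)) \<le> real (sum ?r C)" by simp
      then have "sum \<rho> C < sum ?r C" by linarith
      moreover have "\<forall>A\<in>C. \<rho> A \<le> ?r A" using up[OF x(1)] x(2) unfolding K_def K'_def by fastforce
      ultimately show "(\<forall>A\<in>C. \<rho> A \<le> ?r A) \<and> sum \<rho> C < sum ?r C" by blast
    next
      assume a: "(\<forall>A\<in>C. \<rho> A \<le> ?r A) \<and> sum \<rho> C < sum ?r C"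
      then have "real (Suc (sum \<rho> C)) \<le> real (sum ?r C)" by (simp only: of_nat_le_iff Suc_le_eq)
      then have "basis_vec B \<in> K'" using a w by (simp add: K_def K'_def)
      then show "base_polytope (m i) \<inter> K' \<noteq> {}" using basis_vec_in_base_polytope[OF B(1)] by blast
    qed
    moreover have "(\<forall>A\<in>C. ?r A = \<rho> A) \<longleftrightarrow> (\<forall>A\<in>C. \<rho> A \<le> ?r A) \<and> \<not> sum \<rho> C < sum ?r C"
    proof
      assume "\<forall>A\<in>C. ?r A = \<rho> A"
      then show "(\<forall>A\<in>C. \<rho> A \<le> ?r A) \<and> \<not> sum \<rho> C < sum ?r C" by simp
    next
      assume a: "(\<forall>A\<in>C. \<rho> A \<le> ?r A) \<and> \<not> sum \<rho> C < sum ?r C"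
      show "\<forall>A\<in>C. ?r A = \<rho> A"
      proof (rule ccontr)
        assume "\<not> (\<forall>A\<in>C. ?r A = \<rho> A)"
        then have "\<exists>A\<in>C. \<rho> A < ?r A" using a by fastforce
        then have "sum \<rho> C < sum ?r C" using a finC by (intro sum_strict_mono_ex1) auto
        then show False using a by simp
      qed
    qed
    ultimately show ?thesis by (auto simp: of_bool_def)
  qed
  have "(\<Sum>i\<in>I. b i * of_bool (\<forall>A\<in>C. rank_in (m i) A = \<rho> A)) =
     (\<Sum>i\<in>I. b i * of_bool (base_polytope (m i) \<inter> K \<noteq> {})) -
     (\<Sum>i\<in>I. b i * of_bool (base_polytope (m i) \<inter> K' \<noteq> {}))"
    by (simp add: ind right_diff_distrib sum_subtractf)
  then show ?thesis using polytope_relation_meets[OF rel K] polytope_relation_meets[OF rel K'] by simp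
qed simp

section \<open>Schubert expansions\<close>

lemma chain_subset_mono: "C \<subseteq> D \<Longrightarrow> chain\<^sub>\<subseteq> D \<Longrightarrow> chain\<^sub>\<subseteq> C"
  unfolding chain_subset_def by (meson subsetD)

lemma chain_subset_insert_top: "C \<subseteq> Pow E \<Longrightarrow> chain\<^sub>\<subseteq> C \<Longrightarrow> chain\<^sub>\<subseteq> (insert E C)"
  by (auto simp: chain_subset_def)

text \<open>The chain complex of \<open>V\<close> is a cone up to homotopy (\<open>A \<subseteq> A \<union> A0 \<supseteq> A0\<close>); the involution below adds
  or removes \<open>m \<union> A0\<close>, where \<open>m\<close> is the largest member of the chain not containing \<open>A0\<close>.\<close>

lemma alternating_sum_chains:
  fixes V :: "'a set set"
  assumes fin: "finite V" and A0: "A0 \<in> V" and up: "\<And>A. A \<in> V \<Longrightarrow> A \<union> A0 \<in> V"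
  shows "(\<Sum>D | D \<subseteq> V \<and> chain\<^sub>\<subseteq> D. (-1) ^ card D) = (0::int)"
proof -
  let ?S = "{D. D \<subseteq> V \<and> chain\<^sub>\<subseteq> D}"
  define low where "low D = {A \<in> D. \<not> A0 \<subseteq> A}" for D
  define t where "t D = \<Union>(low D) \<union> A0" for D
  define \<iota> where "\<iota> D = (if t D \<in> D then D - {t D} else insert (t D) D)" for D
  have low_in: "low D = {} \<or> \<Union>(low D) \<in> low D" if "D \<in> ?S" for D
  proof -
    have "finite (low D)" using that fin by (auto simp: low_def intro: finite_subset)
    moreover have "chain\<^sub>\<subseteq> (low D)" using that by (auto simp: low_def chain_subset_def)
    ultimately show ?thesis using chain_Union_in by blast
  qed
  have tV: "t D \<in> V" if "D \<in> ?S" for D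
  proof (cases "low D = {}")
    case True
    then show ?thesis using A0 by (simp add: t_def)
  next
    case False
    then have "\<Union>(low D) \<in> V" using low_in[OF that] that by (auto simp: low_def)
    then show ?thesis unfolding t_def by (rule up)
  qed
  have comparable: "X \<subseteq> t D \<or> t D \<subseteq> X" if D: "D \<in> ?S" and X: "X \<in> D" for D X
  proof (cases "A0 \<subseteq> X")
    case False
    then show ?thesis using X by (auto simp: t_def low_def)
  next
    case True
    have "\<Union>(low D) \<subseteq> X"
    proof (cases "low D = {}")
      case False
      then have m: "\<Union>(low D) \<in> D" "\<not> A0 \<subseteq> \<Union>(low D)" using low_in[OF D] by (auto simp: low_def)
      then show ?thesis using D X True unfolding chain_subset_def by blast
    qed simp
    then show ?thesis using True by (simp add: t_def)
  qed
  \<comment> \<open>\<open>t D\<close> contains \<open>A0\<close>, so toggling it leaves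
    \<open>low D\<close> and hence \<open>t D\<close> itself unchanged; this makes
    \<open>\<iota>\<close> an involution.\<close>
  have low_\<iota>: "low (\<iota> D) = low D" for D
  proof -
    have "A0 \<subseteq> t D" by (simp add: t_def)
    then have "low (D - {t D}) = low D" "low (insert (t D) D) = low D" unfolding low_def by blast+
    then show ?thesis by (simp add: \<iota>_def)
  qed
  then have t\<iota>: "t (\<iota> D) = t D" for D by (simp add: t_def)
  have \<iota>S: "\<iota> D \<in> ?S" if D: "D \<in> ?S" for D
  proof -
    have "\<iota> D \<subseteq> insert (t D) D" by (auto simp: \<iota>_def)
    moreover have "chain\<^sub>\<subseteq> (insert (t D) D)" using D comparable[OF D] by (auto simp: chain_subset_def)
    ultimately have "chain\<^sub>\<subseteq> (\<iota> D)" by (rule chain_subset_mono)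
    moreover have "\<iota> D \<subseteq> V" using tV[OF D] D by (auto simp: \<iota>_def)
    ultimately show ?thesis by blast
  qed
  have \<iota>\<iota>: "\<iota> (\<iota> D) = D" for D
  proof -
    have "\<iota> (\<iota> D) = (if t D \<in> \<iota> D then \<iota> D - {t D} else insert (t D) (\<iota> D))"
      unfolding \<iota>_def[of "\<iota> D"] t\<iota> ..
    moreover have "\<iota> D = (if t D \<in> D then D - {t D} else insert (t D) D)" by (rule \<iota>_def)
    ultimately show ?thesis by (simp add: insert_absorb split: if_splits)
  qed
  have sign: "(-1) ^ card (\<iota> D) = - ((-1) ^ card D :: int)" if "D \<in> ?S" for D
  proof -
    have fD: "finite D" using that fin finite_subset by blast
    show ?thesis
    proof (cases "t D \<in> D")
      case True
      then have "card D = Suc (card (\<iota> D))"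
        unfolding \<iota>_def using card_Suc_Diff1[OF fD True] by (simp only: if_True)
      then show ?thesis by simp
    next
      case False
      then have "card (\<iota> D) = Suc (card D)" using fD by (simp add: \<iota>_def)
      then show ?thesis by simp
    qed
  qed
  have "(\<Sum>D\<in>?S. (-1) ^ card D :: int) = (\<Sum>D\<in>?S. (-1) ^ card (\<iota> D))"
    by (rule sum.reindex_bij_witness[of _ \<iota> \<iota>]) (use \<iota>S \<iota>\<iota> in auto)
  also have "\<dots> = - (\<Sum>D\<in>?S. (-1) ^ card D)"
    by (simp add: sign sum_negf)
  finally show ?thesis by simp
qed

text \<open>Expansion of the product over \<open>A\<close> in \<open>D\<close> of
  \<open>of_bool (A \<notin> V) - 1\<close>, whose factors are -1 on \<open>V\<close> and 0
  elsewhere. With \<open>V\<close> the violated inequalities, it trades "all members are violated"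
  for conditions "no member is violated".\<close>

lemma sum_subset_signs:
  assumes "finite D"
  shows "(-1) ^ card D * of_bool (D \<subseteq> V) = (\<Sum>C\<in>Pow D. (-1) ^ card (D - C) * of_bool (C \<inter> V = {}) :: int)"
proof -
  have "(\<Prod>A\<in>D. of_bool (A \<notin> V) + (- 1)) = (-1) ^ card D * (of_bool (D \<subseteq> V) :: int)"
    using assms by (induction D rule: finite_induct) auto
  moreover have "(\<Prod>A\<in>C. of_bool (A \<notin> V)) = (of_bool (C \<inter> V = {}) :: int)" if "finite C" for C
    using that by (induction C rule: finite_induct) auto
  ultimately show ?thesis
    using prod_add[OF assms, of "\<lambda>A. of_bool (A \<notin> V)" "\<lambda>_. - 1 :: int"] finite_subset[OF _ assms]
    by (auto simp: mult.commute intro!: sum.cong)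
qed

lemma matroids_D:
  assumes "M \<in> matroids r n"
  shows "is_matroid M" "ground M = {1..n}" "matroid_rank M = r" "rank_in M {1..n} = r"
  using assms by (auto simp: matroids_def matroid_rank_def)

lemma schuberts_subset: "schuberts r n \<subseteq> matroids r n"
  by (auto simp: schuberts_def)

lemma finite_matroids: "finite (matroids r n)"
proof -
  have "matroids r n \<subseteq> (\<lambda>\<B>. \<lparr>ground = {1..n}, bases = \<B>\<rparr>) ` Pow (Pow {1..n})"
  proof
    fix M assume M: "M \<in> matroids r n"
    have "bases M \<in> Pow (Pow {1..n})" using matroid_finite(4)[OF matroids_D(1)[OF M]] matroids_D(2)[OF M] by auto
    moreover have "M = \<lparr>ground = {1..n}, bases = bases M\<rparr>" using matroids_D(2)[OF M] by (metis matroid.surjective old.unit.exhaust)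
    ultimately show "M \<in> (\<lambda>\<B>. \<lparr>ground = {1..n}, bases = \<B>\<rparr>) ` Pow (Pow {1..n})" by blast
  qed
  then show ?thesis by (rule finite_subset) simp
qed

lemma finite_schuberts: "finite (schuberts r n)"
  by (rule finite_subset[OF schuberts_subset finite_matroids])

lemma matroid_nested_chain:
  assumes M: "is_matroid M" and C: "C \<subseteq> Pow (ground M)" "chain\<^sub>\<subseteq> C"
  shows "nested_chain (ground M) (insert (ground M) C) (rank_in M)"
proof
  show "finite (ground M)" by (rule matroid_finite(1)[OF M])
  show "insert (ground M) C \<subseteq> Pow (ground M)" using C by blast
  show "chain\<^sub>\<subseteq> (insert (ground M) C)" using C by (rule chain_subset_insert_top)
  show "ground M \<in> insert (ground M) C" by blast
  obtain B where B: "B \<in> bases M" using matroid_finite(3)[OF M] by blast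
  then have "B \<in> bases (nested (ground M) (insert (ground M) C) (rank_in M))"
    using matroid_finite(4)[OF M B] card_basis[OF M B] rank_ge_card_Int[OF M B]
    by (auto simp: bases_nested matroid_rank_def)
  then show "bases (nested (ground M) (insert (ground M) C) (rank_in M)) \<noteq> {}" by blast
qed

lemma matroid_nested_in_schuberts:
  assumes M: "M \<in> matroids r n" and C: "C \<subseteq> Pow {1..n}" "chain\<^sub>\<subseteq> C"
  shows "nested {1..n} (insert {1..n} C) (rank_in M) \<in> schuberts r n"
proof -
  interpret nested_chain "{1..n}" "insert {1..n} C" "rank_in M"
    using matroid_nested_chain[OF matroids_D(1)[OF M], of C] C matroids_D(2)[OF M] by simp
  show ?thesis
    using nested_matroid nested_schubert matroid_rank_nested matroids_D(4)[OF M]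
    by (simp add: schuberts_def matroids_def)
qed

text \<open>If \<open>x\<close> violates no rank inequality, only the empty chain survives and
  contributes 1. Otherwise the excess \<open>weight x A - rank_in M A\<close> is supermodular, so
  the violated sets are closed under union with a maximizer \<open>A0\<close> of the excess, and the
  alternating sum vanishes.\<close>

lemma indicator_base_polytope_chains:
  assumes M: "M \<in> matroids r n"
    and x: "\<forall>i\<in>{1..n}. 0 \<le> Poly_Mapping.lookup x i"
      "\<forall>i. i \<notin> {1..n} \<longrightarrow> Poly_Mapping.lookup x i = 0" "weight x {1..n} = r"
  shows "indicator (base_polytope M) x =
    (\<Sum>D | D \<subseteq> Pow {1..n} \<and> chain\<^sub>\<subseteq> D.
       (-1) ^ card D * of_bool (D \<subseteq> {A. rank_in M A < weight x A}) :: int)"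
proof -
  let ?E = "{1..n}"
  note m = matroids_D[OF M]
  define V where "V = {A \<in> Pow ?E. rank_in M A < weight x A}"
  let ?S = "{D. D \<subseteq> Pow ?E \<and> chain\<^sub>\<subseteq> D}"
  have "(\<Sum>D\<in>?S. (-1) ^ card D * of_bool (D \<subseteq> {A. rank_in M A < weight x A}) :: int) =
     (\<Sum>D | D \<subseteq> V \<and> chain\<^sub>\<subseteq> D. (-1) ^ card D)"
  proof (rule sum.mono_neutral_cong_right)
    have "finite (Pow (Pow ?E))" by simp
    then show "finite ?S" by (rule finite_subset[rotated]) blast
    show "{D. D \<subseteq> V \<and> chain\<^sub>\<subseteq> D} \<subseteq> ?S" unfolding V_def by blast
    show "\<forall>D\<in>?S - {D. D \<subseteq> V \<and> chain\<^sub>\<subseteq> D}.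
        (-1) ^ card D * of_bool (D \<subseteq> {A. rank_in M A < weight x A}) = (0 :: int)"
    proof
      fix D assume "D \<in> ?S - {D. D \<subseteq> V \<and> chain\<^sub>\<subseteq> D}"
      then have "\<not> D \<subseteq> {A. rank_in M A < weight x A}" unfolding V_def by blast
      then show "(-1) ^ card D * of_bool (D \<subseteq> {A. rank_in M A < weight x A}) = (0 :: int)" by simp
    qed
    fix D assume "D \<in> {D. D \<subseteq> V \<and> chain\<^sub>\<subseteq> D}"
    then have "D \<subseteq> {A. rank_in M A < weight x A}" unfolding V_def by blast
    then show "(-1) ^ card D * of_bool (D \<subseteq> {A. rank_in M A < weight x A}) = ((-1) ^ card D :: int)" by simp
  qed
  also have "\<dots> = indicator (base_polytope M) x"
  proof (cases "V = {}")
    case True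
    then have "weight x A \<le> rank_in M A" if "A \<subseteq> ?E" for A
      using that unfolding V_def by (metis (mono_tags, lifting) Pow_iff empty_iff linorder_not_less mem_Collect_eq)
    then have "x \<in> rank_polytope M" using x m by (simp add: rank_polytope_def)
    moreover have "{D. D \<subseteq> V \<and> chain\<^sub>\<subseteq> D} = {{}}" using True by (auto simp: chain_subset_def)
    ultimately show ?thesis using base_polytope_eq_rank_polytope[OF m(1)] by simp
  next
    case False
    define f where "f A = weight x A - rank_in M A" for A
    obtain A0 where A0: "A0 \<in> Pow ?E" "\<And>A. A \<in> Pow ?E \<Longrightarrow> f A \<le> f A0"
    proof -
      have "Max (f ` Pow ?E) \<in> f ` Pow ?E" by (rule Max_in) auto
      then obtain A0 where "A0 \<in> Pow ?E" "f A0 = Max (f ` Pow ?E)" by (metis imageE)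
      then show ?thesis using that by simp
    qed
    have A0V: "A0 \<in> V"
    proof -
      obtain A where "A \<in> V" using False by blast
      then have "A \<in> Pow ?E" "0 < f A" by (auto simp: V_def f_def)
      then have "0 < f A0" using A0(2)[of A] by simp
      then show ?thesis using A0(1) by (simp add: V_def f_def)
    qed
    have "A \<union> A0 \<in> V" if A: "A \<in> V" for A
    proof -
      have AE: "A \<subseteq> ?E" "A0 \<subseteq> ?E" "0 < f A" using A A0 by (auto simp: V_def f_def)
      have "real (rank_in M (A \<union> A0)) + rank_in M (A \<inter> A0) \<le> real (rank_in M A) + rank_in M A0"
        using rank_submodular[OF m(1), of A A0] by (metis of_nat_add of_nat_le_iff)
      moreover have "weight x (A \<union> A0) + weight x (A \<inter> A0) = weight x A + weight x A0"
        using AE by (intro weight_Un_Int) (auto intro: finite_subset)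
      ultimately have "f A + f A0 \<le> f (A \<union> A0) + f (A \<inter> A0)" by (simp add: f_def)
      moreover have "f (A \<inter> A0) \<le> f A0" using AE by (intro A0(2)) auto
      ultimately have "0 < f (A \<union> A0)" using AE(3) by linarith
      then show ?thesis using AE by (simp add: V_def f_def)
    qed
    then have "(\<Sum>D | D \<subseteq> V \<and> chain\<^sub>\<subseteq> D. (-1) ^ card D) = (0::int)"
      using A0V by (intro alternating_sum_chains) (auto simp: V_def)
    moreover have "x \<notin> base_polytope M"
    proof
      assume "x \<in> base_polytope M"
      then have "weight x A0 \<le> rank_in M A0"
        using A0(1) m(2) base_polytope_eq_rank_polytope[OF m(1)] by (auto simp: rank_polytope_def)
      then show False using A0V by (simp add: V_def)
    qed
    ultimately show ?thesis by simp
  qed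
  finally show ?thesis by simp
qed

text \<open>Each term of the sum over chains of violated sets is rewritten by
  \<open>sum_subset_signs\<close>; that no member of \<open>C\<close> is violated says that
  \<open>x\<close> lies in the polytope of the nested matroid of \<open>C\<close>. Outside the slice
  of the cube of total weight \<open>r\<close> both sides vanish.\<close>

lemma indicator_base_polytope_expansion:
  assumes M: "M \<in> matroids r n"
  shows "indicator (base_polytope M) x =
    (\<Sum>D | D \<subseteq> Pow {1..n} \<and> chain\<^sub>\<subseteq> D. \<Sum>C\<in>Pow D. (-1) ^ card (D - C) *
       indicator (base_polytope (nested {1..n} (insert {1..n} C) (rank_in M))) x :: int)"
proof -
  let ?E = "{1..n}"
  let ?N = "\<lambda>C. nested ?E (insert ?E C) (rank_in M)"
  note m = matroids_D[OF M]
  let ?\<Delta> = "(\<forall>i. i \<notin> ?E \<longrightarrow> Poly_Mapping.lookup x i = 0) \<and>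
    (\<forall>i\<in>?E. 0 \<le> Poly_Mapping.lookup x i \<and> Poly_Mapping.lookup x i \<le> 1) \<and> weight x ?E = r"
  have N: "x \<in> base_polytope (?N C) \<longleftrightarrow> ?\<Delta> \<and> (\<forall>A\<in>C. weight x A \<le> rank_in M A)"
    if "C \<subseteq> Pow ?E" "chain\<^sub>\<subseteq> C" for C
  proof -
    have "nested_chain ?E (insert ?E C) (rank_in M)"
      using matroid_nested_chain[OF m(1), of C] that m(2) by simp
    then show ?thesis using m(4) by (subst base_polytope_nested) auto
  qed
  have sub: "C \<subseteq> Pow ?E" "chain\<^sub>\<subseteq> C" if "C \<subseteq> D" "D \<subseteq> Pow ?E" "chain\<^sub>\<subseteq> D" for C D
    using that chain_subset_mono by auto
  show ?thesis
  proof (cases ?\<Delta>)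
    case True
    let ?V = "{A. rank_in M A < weight x A}"
    have "indicator (base_polytope (?N C)) x = (of_bool (C \<inter> ?V = {}) :: int)"
      if "C \<subseteq> Pow ?E" "chain\<^sub>\<subseteq> C" for C
    proof -
      have "x \<in> base_polytope (?N C) \<longleftrightarrow> C \<inter> ?V = {}"
        using N[OF that] True by (auto simp: not_less disjoint_iff)
      then show ?thesis by (simp add: indicator_def)
    qed
    then have "(\<Sum>C\<in>Pow D. (-1) ^ card (D - C) * indicator (base_polytope (?N C)) x :: int) =
        (-1) ^ card D * of_bool (D \<subseteq> ?V)" if "D \<subseteq> Pow ?E" "chain\<^sub>\<subseteq> D" for D
      using sub[OF _ that] that finite_subset[of D "Pow ?E"]
      by (subst sum_subset_signs) (auto intro!: sum.cong)
    then show ?thesis using indicator_base_polytope_chains[OF M, of x] True by simp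
  next
    case False
    then have "x \<notin> base_polytope (?N C)" if "C \<subseteq> Pow ?E" "chain\<^sub>\<subseteq> C" for C using N[OF that] by blast
    then have "(\<Sum>C\<in>Pow D. (-1) ^ card (D - C) * indicator (base_polytope (?N C)) x :: int) = 0"
      if "D \<subseteq> Pow ?E" "chain\<^sub>\<subseteq> D" for D
      using sub[OF _ that] by (intro sum.neutral) auto
    moreover have "x \<notin> base_polytope M"
    proof
      assume "x \<in> base_polytope M"
      then have x: "x \<in> rank_polytope M" using base_polytope_eq_rank_polytope[OF m(1)] by simp
      then have ?\<Delta> using rank_polytope_cube[OF m(1) x] m by (auto simp: rank_polytope_def)
      then show False using False by blast
    qed
    ultimately show ?thesis by simp
  qed
qed

lemma schubert_expansion_exists:
  assumes M: "M \<in> matroids r n"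
  shows "\<exists>a. (\<forall>S. S \<notin> schuberts r n \<longrightarrow> a S = 0) \<and>
        (\<forall>x. indicator (base_polytope M) x =
              (\<Sum>S\<in>schuberts r n. a S * indicator (base_polytope S) x :: int))"
proof -
  let ?E = "{1..n}"
  let ?N = "\<lambda>C. nested ?E (insert ?E C) (rank_in M)"
  let ?S = "{D. D \<subseteq> Pow ?E \<and> chain\<^sub>\<subseteq> D}"
  \<comment> \<open>Different chains can give the same nested matroid, so the coefficient of
    \<open>S\<close> collects all of them.\<close>
  define a :: "nat matroid \<Rightarrow> int" where
    "a S = (\<Sum>D\<in>?S. \<Sum>C\<in>Pow D. if ?N C = S then (-1) ^ card (D - C) else 0)" for S
  have N: "?N C \<in> schuberts r n" if "C \<subseteq> D" "D \<in> ?S" for C D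
  proof (rule matroid_nested_in_schuberts[OF M])
    show "C \<subseteq> Pow ?E" "chain\<^sub>\<subseteq> C" using that chain_subset_mono by auto
  qed
  have "a S = 0" if "S \<notin> schuberts r n" for S
    unfolding a_def using N that by (intro sum.neutral ballI) auto
  moreover have "indicator (base_polytope M) x =
      (\<Sum>S\<in>schuberts r n. a S * indicator (base_polytope S) x)" for x
  proof -
    have "(\<Sum>S\<in>schuberts r n. a S * indicator (base_polytope S) x) =
      (\<Sum>S\<in>schuberts r n. \<Sum>D\<in>?S. \<Sum>C\<in>Pow D.
         if ?N C = S then (-1) ^ card (D - C) * indicator (base_polytope S) x else 0)"
      unfolding a_def sum_distrib_right by (intro sum.cong refl) auto
    also have "\<dots> = (\<Sum>D\<in>?S. \<Sum>C\<in>Pow D. \<Sum>S\<in>schuberts r n.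
         if ?N C = S then (-1) ^ card (D - C) * indicator (base_polytope S) x else 0)"
      by (subst sum.swap) (intro sum.cong refl sum.swap)
    also have "\<dots> = (\<Sum>D\<in>?S. \<Sum>C\<in>Pow D. (-1) ^ card (D - C) * indicator (base_polytope (?N C)) x)"
      using N by (intro sum.cong refl) (auto simp: finite_schuberts)
    finally show ?thesis using indicator_base_polytope_expansion[OF M] by simp
  qed
  ultimately show ?thesis by blast
qed

text \<open>The cyclic flats of a Schubert matroid with their ranks determine it as a largest matroid;
  both uniqueness of Schubert expansions and independence of their invariants are triangularity
  with respect to inclusion of sets of bases.\<close>

definition flag_of :: "nat \<Rightarrow> nat matroid \<Rightarrow> nat set set" where
  "flag_of n S = insert {1..n} (cyclic_flats S)"

lemma flag_of_chain:
  assumes "S \<in> schuberts r n"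
  shows "flag_of n S \<subseteq> Pow {1..n}" "chain\<^sub>\<subseteq> (flag_of n S)"
proof -
  have S: "ground S = {1..n}" "chain\<^sub>\<subseteq> (cyclic_flats S)"
    using assms by (auto simp: schuberts_def is_schubert_def matroids_def)
  show sub: "flag_of n S \<subseteq> Pow {1..n}" using S by (auto simp: flag_of_def cyclic_flats_def flats_def)
  then show "chain\<^sub>\<subseteq> (flag_of n S)"
    using S(2) unfolding flag_of_def by (intro chain_subset_insert_top) auto
qed

text \<open>A basis of \<open>T\<close> meets a cyclic flat of \<open>S\<close> in at most its rank
  in \<open>T\<close>, which is its rank in \<open>S\<close>; \<open>basisI_cyclic_flats\<close>
  does the rest.\<close>

lemma bases_subset_schubert:
  assumes S: "S \<in> schuberts r n" and T: "T \<in> matroids r n"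
    and eq: "\<And>A. A \<in> flag_of n S \<Longrightarrow> rank_in T A = rank_in S A"
  shows "bases T \<subseteq> bases S"
proof
  fix B assume B: "B \<in> bases T"
  note s = matroids_D[OF subsetD[OF schuberts_subset S]] and t = matroids_D[OF T]
  show "B \<in> bases S"
  proof (rule basisI_cyclic_flats[OF s(1)])
    show "B \<subseteq> ground S" using matroid_finite(4)[OF t(1) B] s t by simp
    show "card B = matroid_rank S" using card_basis[OF t(1) B] s t by simp
    show "card (B \<inter> F) \<le> rank_in S F" if "F \<in> cyclic_flats S" for F
      using rank_ge_card_Int[OF t(1) B, of F] eq[of F] that by (simp add: flag_of_def)
  qed
qed

lemma matroids_eqI:
  assumes "S \<in> matroids r n" "T \<in> matroids r n" "bases S = bases T"
  shows "S = T"
  using assms matroids_D(2) by (metis (full_types) matroid.equality old.unit.exhaust)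

text \<open>The valuative test "same ranks as \<open>S\<close> on its flag" is passed by
  \<open>S\<close> and otherwise only by Schubert matroids with strictly fewer bases, whose
  coefficients vanish by induction.\<close>

lemma schubert_indicators_independent:
  fixes d :: "nat matroid \<Rightarrow> real"
  assumes rel: "\<And>x. (\<Sum>S\<in>schuberts r n. d S * indicator (base_polytope S) x) = 0"
    and S: "S \<in> schuberts r n"
  shows "d S = 0"
  using S
proof (induction "card (bases S)" arbitrary: S rule: less_induct)
  case less
  note S = less.prems
  have r: "polytope_relation {1..n} (schuberts r n) (\<lambda>S. S) d"
    unfolding polytope_relation_def
  proof (intro conjI ballI allI rel finite_schuberts)
    fix T assume "T \<in> schuberts r n"
    then have "T \<in> matroids r n" using schuberts_subset by blast
    then show "is_matroid T" "ground T = {1..n}" by (rule matroids_D)+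
  qed
  let ?f = "\<lambda>T. d T * of_bool (\<forall>A\<in>flag_of n S. rank_in T A = rank_in S A)"
  have "?f T = 0" if T: "T \<in> schuberts r n - {S}" for T
  proof (cases "\<forall>A\<in>flag_of n S. rank_in T A = rank_in S A")
    case True
    have TS: "T \<in> matroids r n" "S \<in> matroids r n" using T S schuberts_subset by auto
    have "bases T \<subseteq> bases S" using bases_subset_schubert[OF S TS(1)] True by blast
    moreover have "bases T \<noteq> bases S" using matroids_eqI[OF TS] T by blast
    ultimately have "card (bases T) < card (bases S)"
      using matroid_finite(2)[OF matroids_D(1)[OF TS(2)]] by (simp add: psubset_card_mono psubset_eq)
    then show ?thesis using less.hyps T by simp
  qed simp
  then have "sum ?f (schuberts r n - {S}) = 0" by (rule sum.neutral[OF ballI])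
  then have "(\<Sum>T\<in>schuberts r n. ?f T) = ?f S"
    using sum.remove[OF finite_schuberts S, of ?f] by simp
  moreover have "(\<Sum>T\<in>schuberts r n. ?f T) = 0"
    by (rule polytope_relation_ranks[OF r flag_of_chain[OF S]])
  ultimately show ?case by simp
qed

lemma schubert_coeff:
  assumes M: "M \<in> matroids r n"
  shows "S \<notin> schuberts r n \<Longrightarrow> schubert_coeff r n M S = 0"
    and "indicator (base_polytope M) x =
      (\<Sum>S\<in>schuberts r n. schubert_coeff r n M S * indicator (base_polytope S) x)"
proof -
  let ?P = "\<lambda>a :: nat matroid \<Rightarrow> int. (\<forall>S. S \<notin> schuberts r n \<longrightarrow> a S = 0) \<and>
        (\<forall>x. indicator (base_polytope M) x =
              (\<Sum>S\<in>schuberts r n. a S * indicator (base_polytope S) x))"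
  have "\<exists>!a. ?P a"
  proof (rule ex_ex1I)
    show "\<exists>a. ?P a" by (rule schubert_expansion_exists[OF M])
    fix a a' assume a: "?P a" and a': "?P a'"
    show "a = a'"
    proof
      fix S
      show "a S = a' S"
      proof (cases "S \<in> schuberts r n")
        case True
        have "(\<Sum>S\<in>schuberts r n. real_of_int (a S - a' S) * indicator (base_polytope S) x) = 0" for x
        proof -
          have "(\<Sum>S\<in>schuberts r n. (a S - a' S) * indicator (base_polytope S) x) = 0"
            using a a' by (simp add: left_diff_distrib sum_subtractf)
          then have "real_of_int (\<Sum>S\<in>schuberts r n. (a S - a' S) * indicator (base_polytope S) x) = 0" by simp
          moreover have "real_of_int (indicator A x) = indicator A x" for A :: "(nat \<Rightarrow>\<^sub>0 real) set"
            by (simp add: indicator_def)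
          ultimately show ?thesis by simp
        qed
        from schubert_indicators_independent[OF this True] show ?thesis by simp
      qed (use a a' in simp)
    qed
  qed
  from theI'[OF this] have "?P (schubert_coeff r n M)" unfolding schubert_coeff_def .
  then show "S \<notin> schuberts r n \<Longrightarrow> schubert_coeff r n M S = 0"
    and "indicator (base_polytope M) x =
      (\<Sum>S\<in>schuberts r n. schubert_coeff r n M S * indicator (base_polytope S) x)" by blast+
qed

section \<open>Shuffle products\<close>

text \<open>A function on words stands for a formal linear combination of words. The second equation
  says that deleting a given first letter is a derivation for the shuffle product.\<close>

fun shuffle :: "('b list \<Rightarrow> real) \<Rightarrow> ('b list \<Rightarrow> real) \<Rightarrow> 'b list \<Rightarrow> real" where
  "shuffle f g [] = f [] * g []"
| "shuffle f g (a # w) = shuffle (\<lambda>u. f (a # u)) g w + shuffle f (\<lambda>u. g (a # u)) w"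

lemma shuffle_sum_left:
  "shuffle (\<lambda>u. \<Sum>x\<in>X. c x * f x u) g w = (\<Sum>x\<in>X. c x * shuffle (f x) g w)"
  by (induction w arbitrary: f g) (simp_all add: sum_distrib_right mult.assoc sum.distrib distrib_left)

lemma shuffle_sum_right:
  "shuffle f (\<lambda>u. \<Sum>x\<in>X. c x * g x u) w = (\<Sum>x\<in>X. c x * shuffle f (g x) w)"
  by (induction w arbitrary: f g)
    (simp_all add: sum_distrib_left mult.left_commute sum.distrib distrib_left)

lemma shuffle_zero: "shuffle (\<lambda>_. 0) g w = 0" "shuffle f (\<lambda>_. 0) w = 0"
  by (induction w arbitrary: f g) simp_all

lemma pascal_sum:
  fixes T :: "nat \<Rightarrow> real"
  shows "(\<Sum>i\<le>j. real (j choose i) * T (Suc i)) + (\<Sum>i\<le>j. real (j choose i) * T i) =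
    (\<Sum>i\<le>Suc j. real (Suc j choose i) * T i)"
proof -
  have "(\<Sum>i\<le>j. real (j choose i) * T i) = (\<Sum>i\<le>Suc j. real (j choose i) * T i)" by simp
  also have "\<dots> = T 0 + (\<Sum>i\<le>j. real (j choose Suc i) * T (Suc i))"
    by (subst sum.atMost_Suc_shift) simp
  finally have "(\<Sum>i\<le>j. real (j choose i) * T (Suc i)) + (\<Sum>i\<le>j. real (j choose i) * T i) =
     T 0 + (\<Sum>i\<le>j. real (Suc j choose Suc i) * T (Suc i))"
    by (simp add: sum.distrib distrib_right)
  also have "\<dots> = (\<Sum>i\<le>Suc j. real (Suc j choose i) * T i)"
    by (subst sum.atMost_Suc_shift) simp
  finally show ?thesis .
qed

text \<open>The higher Leibniz rule for the derivation that deletes a leading \<open>a\<close>; the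
  induction step is Pascal's rule.\<close>

lemma shuffle_leibniz:
  "shuffle f g (replicate j a @ w) =
    (\<Sum>i\<le>j. real (j choose i) *
       shuffle (\<lambda>u. f (replicate i a @ u)) (\<lambda>u. g (replicate (j - i) a @ u)) w)"
proof (induction j arbitrary: f g)
  case 0
  then show ?case by simp
next
  case (Suc j)
  define T where "T i = shuffle (\<lambda>u. f (replicate i a @ u)) (\<lambda>u. g (replicate (Suc j - i) a @ u)) w" for i
  have "shuffle f g (replicate (Suc j) a @ w) =
      shuffle (\<lambda>u. f (a # u)) g (replicate j a @ w) + shuffle f (\<lambda>u. g (a # u)) (replicate j a @ w)"
    by simp
  also have "shuffle (\<lambda>u. f (a # u)) g (replicate j a @ w) = (\<Sum>i\<le>j. real (j choose i) * T (Suc i))"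
    unfolding Suc T_def by (intro sum.cong) auto
  also have "shuffle f (\<lambda>u. g (a # u)) (replicate j a @ w) = (\<Sum>i\<le>j. real (j choose i) * T i)"
    unfolding Suc T_def by (intro sum.cong) (auto simp: Suc_diff_le)
  also note pascal_sum
  finally show ?case unfolding T_def .
qed

text \<open>The shuffle algebra has no zero divisors: apply a power of a derivation that kills neither
  factor but whose next higher powers do.\<close>

lemma shuffle_nonzero:
  fixes f g :: "'b list \<Rightarrow> real"
  assumes "\<And>u. f u \<noteq> 0 \<Longrightarrow> length u = m" "\<And>u. g u \<noteq> 0 \<Longrightarrow> length u = n"
    and "f \<noteq> (\<lambda>_. 0)" "g \<noteq> (\<lambda>_. 0)"
  shows "\<exists>w. shuffle f g w \<noteq> 0"
  using assms
proof (induction "m + n" arbitrary: f g m n rule: less_induct)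
  case less
  note hom = less.prems(1,2)
  obtain u v where u: "f u \<noteq> 0" and v: "g v \<noteq> 0" using less.prems(3,4) by blast
  show ?case
  proof (cases "u = [] \<and> v = []")
    case True
    then have "shuffle f g [] \<noteq> 0" using u v by simp
    then show ?thesis by blast
  next
    case False
    define D where "D a k h = (\<lambda>u. h (replicate k a @ u))" for a k and h :: "'b list \<Rightarrow> real"
    have top: "\<exists>k. D a k h \<noteq> (\<lambda>_. 0) \<and> (\<forall>j>k. D a j h = (\<lambda>_. 0)) \<and> k \<le> p"
      if hom: "\<And>u. h u \<noteq> 0 \<Longrightarrow> length u = p" and "h \<noteq> (\<lambda>_. 0)" for h p a
    proof -
      let ?K = "{k. D a k h \<noteq> (\<lambda>_. 0)}"
      have K: "?K \<subseteq> {..p}"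
      proof
        fix k assume "k \<in> ?K"
        then obtain u where "h (replicate k a @ u) \<noteq> 0" by (auto simp: D_def)
        then show "k \<in> {..p}" using hom by fastforce
      qed
      have "0 \<in> ?K" using \<open>h \<noteq> (\<lambda>_. 0)\<close> by (simp add: D_def)
      moreover have fin: "finite ?K" using K finite_subset by blast
      ultimately have "Max ?K \<in> ?K" by (intro Max_in) auto
      moreover have "D a j h = (\<lambda>_. 0)" if "j > Max ?K" for j
        using that fin Max_ge leD by blast
      ultimately show ?thesis using K by blast
    qed
    \<comment> \<open>A letter whose derivation is nonzero on at least one factor; this is what
      makes the total length drop.\<close>
    obtain a where a: "D a 1 f \<noteq> (\<lambda>_. 0) \<or> D a 1 g \<noteq> (\<lambda>_. 0)"
    proof (cases u)
      case (Cons a u')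
      then have "D a 1 f u' \<noteq> 0" using u by (simp add: D_def)
      then show ?thesis using that by metis
    next
      case Nil
      then obtain b v' where "v = b # v'" using False by (cases v) auto
      then have "D b 1 g v' \<noteq> 0" using v by (simp add: D_def)
      then show ?thesis using that by metis
    qed
    obtain k where k: "D a k f \<noteq> (\<lambda>_. 0)" "\<And>j. j > k \<Longrightarrow> D a j f = (\<lambda>_. 0)" "k \<le> m"
      using top[OF hom(1) less.prems(3)] by metis
    obtain l where l: "D a l g \<noteq> (\<lambda>_. 0)" "\<And>j. j > l \<Longrightarrow> D a j g = (\<lambda>_. 0)" "l \<le> n"
      using top[OF hom(2) less.prems(4)] by metis
    have "k + l > 0" using a k(2)[of 1] l(2)[of 1] by (cases k; cases l) auto
    then have "(m - k) + (n - l) < m + n" using k(3) l(3) by linarith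
    moreover have "length w = m - k" if "D a k f w \<noteq> 0" for w
      using hom(1) that unfolding D_def by fastforce
    moreover have "length w = n - l" if "D a l g w \<noteq> 0" for w
      using hom(2) that unfolding D_def by fastforce
    ultimately obtain w where w: "shuffle (D a k f) (D a l g) w \<noteq> 0"
      using less.hyps[of "m - k" "n - l" "D a k f" "D a l g"] k(1) l(1) by blast
    let ?t = "\<lambda>i. real (k + l choose i) * shuffle (D a i f) (D a (k + l - i) g) w"
    have "shuffle f g (replicate (k + l) a @ w) = (\<Sum>i\<le>k + l. ?t i)"
      unfolding shuffle_leibniz D_def ..
    \<comment> \<open>Of the Leibniz terms of order \<open>k + l\<close>, those with
      \<open>i > k\<close> kill \<open>f\<close> and those with \<open>i < k\<close> kill
      \<open>g\<close>. The survivor carries a binomial coefficient, nonzero in characteristic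
      0.\<close>
    also have "\<dots> = ?t k"
    proof -
      have "?t i = 0" if "i \<in> {..k + l} - {k}" for i
      proof (cases "i > k")
        case True
        then show ?thesis using k(2) by (simp add: shuffle_zero)
      next
        case False
        then have "D a (k + l - i) g = (\<lambda>_. 0)" using that by (intro l(2)) auto
        then show ?thesis by (simp add: shuffle_zero)
      qed
      then have "sum ?t ({..k + l} - {k}) = 0" by (rule sum.neutral[OF ballI])
      then show ?thesis using sum.remove[of "{..k + l}" k ?t] by simp
    qed
    also have "\<dots> \<noteq> 0" using w by simp
    finally show ?thesis by blast
  qed
qed

section \<open>Counting flags by rank jumps\<close>

primrec rank_word :: "('a set \<Rightarrow> int) \<Rightarrow> 'a set \<Rightarrow> 'a list \<Rightarrow> int list" where
  "rank_word \<rho> A [] = []"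
| "rank_word \<rho> A (x # xs) = (\<rho> (insert x A) - \<rho> A) # rank_word \<rho> (insert x A) xs"

text \<open>A complete flag from \<open>A\<close> up to \<open>A \<union> E\<close> is encoded by
  the order in which the elements of \<open>E\<close> are added. The starting set is free because
  deleting the first letter moves an element from \<open>E\<close> to \<open>A\<close>.\<close>

definition flag_count :: "('a set \<Rightarrow> int) \<Rightarrow> 'a set \<Rightarrow> 'a set \<Rightarrow> int list \<Rightarrow> real" where
  "flag_count \<rho> A E w = real (card {xs \<in> permutations_of_set E. rank_word \<rho> A xs = w})"

lemma length_rank_word [simp]: "length (rank_word \<rho> A xs) = length xs"
  by (induction xs arbitrary: A) auto

lemma flag_count_nonzeroI:
  assumes "xs \<in> permutations_of_set E"
  shows "flag_count \<rho> A E (rank_word \<rho> A xs) \<noteq> 0"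
  unfolding flag_count_def using assms by (auto simp: card_eq_0_iff)

lemma flag_count_nonzeroE:
  assumes "flag_count \<rho> A E w \<noteq> 0"
  obtains xs where "xs \<in> permutations_of_set E" "rank_word \<rho> A xs = w"
proof -
  have "{xs \<in> permutations_of_set E. rank_word \<rho> A xs = w} \<noteq> {}"
    using assms unfolding flag_count_def by (metis card.empty of_nat_0)
  then show ?thesis using that by blast
qed

lemma flag_count_length: "flag_count \<rho> A E w \<noteq> 0 \<Longrightarrow> length w = card E"
  by (erule flag_count_nonzeroE) (auto dest: length_finite_permutations_of_set)

lemma flag_count_Nil: "finite E \<Longrightarrow> flag_count \<rho> A E [] = of_bool (E = {})"
proof (cases "E = {}")
  case True
  then have "{xs \<in> permutations_of_set E. rank_word \<rho> A xs = []} = {[]}" by auto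
  then show ?thesis using True by (simp add: flag_count_def)
next
  case False
  assume "finite E"
  then show ?thesis using False flag_count_length[of \<rho> A E "[]"] by auto
qed

lemma flag_count_Cons:
  assumes "finite E"
  shows "flag_count \<rho> A E (a # w) =
    (\<Sum>x\<in>E. of_bool (\<rho> (insert x A) - \<rho> A = a) * flag_count \<rho> (insert x A) (E - {x}) w)"
proof (cases "E = {}")
  case True
  then show ?thesis by (simp add: flag_count_def)
next
  case False
  let ?X = "{x \<in> E. \<rho> (insert x A) - \<rho> A = a}"
  let ?P = "\<lambda>x. (\<lambda>xs. x # xs) ` {xs \<in> permutations_of_set (E - {x}). rank_word \<rho> (insert x A) xs = w}"
  have "{xs \<in> permutations_of_set E. rank_word \<rho> A xs = a # w} = (\<Union>x\<in>?X. ?P x)"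
    unfolding permutations_of_set_nonempty[OF False] by auto
  also have "card \<dots> = (\<Sum>x\<in>?X. card (?P x))"
    using assms by (intro card_UN_disjoint) auto
  also have "\<dots> = (\<Sum>x\<in>?X. card {xs \<in> permutations_of_set (E - {x}). rank_word \<rho> (insert x A) xs = w})"
    by (intro sum.cong card_image) auto
  finally have "flag_count \<rho> A E (a # w) = (\<Sum>x\<in>?X. flag_count \<rho> (insert x A) (E - {x}) w)"
    by (simp add: flag_count_def)
  also have "\<dots> = (\<Sum>x\<in>E. of_bool (\<rho> (insert x A) - \<rho> A = a) * flag_count \<rho> (insert x A) (E - {x}) w)"
    using assms by (simp add: sum.inter_filter of_bool_def if_distrib if_distribR cong: if_cong)
  finally show ?thesis .
qed

lemma flag_count_image:
  assumes "finite E" "inj_on f (A \<union> E)"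
  shows "flag_count \<rho> (f ` A) (f ` E) w = flag_count (\<lambda>X. \<rho> (f ` X)) A E w"
  using assms
proof (induction w arbitrary: A E)
  case Nil
  then show ?case by (simp add: flag_count_Nil)
next
  case (Cons a w)
  have inj: "inj_on f E" using Cons.prems(2) inj_on_subset by blast
  have "flag_count \<rho> (insert (f x) (f ` A)) (f ` E - {f x}) w =
      flag_count (\<lambda>X. \<rho> (f ` X)) (insert x A) (E - {x}) w" if x: "x \<in> E" for x
  proof -
    have "f ` E - {f x} = f ` (E - {x})" using inj x by (auto simp: inj_on_def)
    moreover have "insert x A \<union> (E - {x}) = A \<union> E" using x by blast
    ultimately show ?thesis using Cons.IH[of "E - {x}" "insert x A"] Cons.prems by simp
  qed
  then show ?case using Cons.prems(1) by (simp add: flag_count_Cons sum.reindex[OF inj])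
qed

text \<open>The first element of a flag comes from \<open>U\<close> or from \<open>V\<close>, and
  its jump is seen by only one of \<open>\<rho>1\<close> and \<open>\<rho>2\<close>. This matches
  the recursion that defines \<open>shuffle\<close>.\<close>

lemma flag_count_sum:
  assumes fin: "finite U" "finite V" and sub: "U \<subseteq> E1" "V \<subseteq> E2" "E1 \<inter> E2 = {}"
    and \<rho>: "\<And>X. \<rho> X = \<rho>1 (X \<inter> E1) + \<rho>2 (X \<inter> E2)"
  shows "flag_count \<rho> A (U \<union> V) w =
    shuffle (flag_count \<rho>1 (A \<inter> E1) U) (flag_count \<rho>2 (A \<inter> E2) V) w"
  using fin sub
proof (induction w arbitrary: A U V)
  case Nil
  then show ?case by (simp add: flag_count_Nil)
next
  case (Cons a w)
  note prems = Cons.prems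
  let ?f = "flag_count \<rho>1 (A \<inter> E1) U" and ?g = "flag_count \<rho>2 (A \<inter> E2) V"
  let ?t = "\<lambda>x. of_bool (\<rho> (insert x A) - \<rho> A = a) * flag_count \<rho> (insert x A) (U \<union> V - {x}) w"
  have disj: "U \<inter> V = {}" using prems by blast
  have U: "?t x = of_bool (\<rho>1 (insert x (A \<inter> E1)) - \<rho>1 (A \<inter> E1) = a) *
      shuffle (flag_count \<rho>1 (insert x (A \<inter> E1)) (U - {x})) ?g w" if x: "x \<in> U" for x
  proof -
    have e: "insert x A \<inter> E1 = insert x (A \<inter> E1)" "insert x A \<inter> E2 = A \<inter> E2" using x prems by auto
    have d: "U \<union> V - {x} = (U - {x}) \<union> V" using x disj by blast
    have "flag_count \<rho> (insert x A) (U \<union> V - {x}) w =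
        shuffle (flag_count \<rho>1 (insert x (A \<inter> E1)) (U - {x})) ?g w"
      unfolding d using Cons.IH[of "U - {x}" V "insert x A"] prems e by auto
    then show ?thesis using \<rho>[of "insert x A"] \<rho>[of A] e by simp
  qed
  have V: "?t x = of_bool (\<rho>2 (insert x (A \<inter> E2)) - \<rho>2 (A \<inter> E2) = a) *
      shuffle ?f (flag_count \<rho>2 (insert x (A \<inter> E2)) (V - {x})) w" if x: "x \<in> V" for x
  proof -
    have e: "insert x A \<inter> E1 = A \<inter> E1" "insert x A \<inter> E2 = insert x (A \<inter> E2)" using x prems by auto
    have d: "U \<union> V - {x} = U \<union> (V - {x})" using x disj by blast
    have "flag_count \<rho> (insert x A) (U \<union> V - {x}) w =
        shuffle ?f (flag_count \<rho>2 (insert x (A \<inter> E2)) (V - {x})) w"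
      unfolding d using Cons.IH[of U "V - {x}" "insert x A"] prems e by auto
    then show ?thesis using \<rho>[of "insert x A"] \<rho>[of A] e by simp
  qed
  have "flag_count \<rho> A (U \<union> V) (a # w) = sum ?t U + sum ?t V"
    unfolding flag_count_Cons[OF finite_UnI[OF prems(1,2)]]
    using prems(1,2) disj by (rule sum.union_disjoint)
  also have "sum ?t U = shuffle (\<lambda>u. ?f (a # u)) ?g w"
    unfolding flag_count_Cons[OF prems(1)] shuffle_sum_left by (rule sum.cong[OF refl U])
  also have "sum ?t V = shuffle ?f (\<lambda>u. ?g (a # u)) w"
    unfolding flag_count_Cons[OF prems(2)] shuffle_sum_right by (rule sum.cong[OF refl V])
  finally show ?case by simp
qed

section \<open>Flags as chains of prefixes\<close>

primrec prefix_sets :: "'a set \<Rightarrow> 'a list \<Rightarrow> 'a set set" where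
  "prefix_sets A [] = {A}"
| "prefix_sets A (x # xs) = insert A (prefix_sets (insert x A) xs)"

lemma prefix_sets_bounds: "X \<in> prefix_sets A xs \<Longrightarrow> A \<subseteq> X \<and> X \<subseteq> A \<union> set xs"
  by (induction xs arbitrary: A) auto

lemma start_in_prefix_sets: "A \<in> prefix_sets A xs"
  by (cases xs) auto

lemma prefix_sets_chain: "chain\<^sub>\<subseteq> (prefix_sets A xs)"
proof (induction xs arbitrary: A)
  case Nil
  then show ?case by (simp add: chain_subset_def)
next
  case (Cons x xs)
  have "A \<subseteq> X" if "X \<in> prefix_sets (insert x A) xs" for X
    using prefix_sets_bounds[OF that] by blast
  then show ?case using Cons[of "insert x A"] by (auto simp: chain_subset_def)
qed

lemma prefix_sets_append:
  "prefix_sets A (xs @ ys) = prefix_sets A xs \<union> prefix_sets (A \<union> set xs) ys"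
proof (induction xs arbitrary: A)
  case Nil
  then show ?case using start_in_prefix_sets[of A ys] by auto
qed simp

lemma end_in_prefix_sets: "A \<union> set xs \<in> prefix_sets A xs"
proof (induction xs arbitrary: A)
  case (Cons x xs)
  then show ?case using Cons[of "insert x A"] by simp
qed simp

text \<open>From a common starting value the jumps determine all values along the prefixes. A word
  realized by some matroid is thus a prescription of ranks on a chain, the kind of condition covered
  by \<open>polytope_relation_ranks\<close>.\<close>

lemma rank_word_eq_iff:
  assumes "\<rho> A = \<sigma> A"
  shows "rank_word \<rho> A xs = rank_word \<sigma> A xs \<longleftrightarrow> (\<forall>X\<in>prefix_sets A xs. \<rho> X = \<sigma> X)"
  using assms
proof (induction xs arbitrary: A)
  case Nil
  then show ?case by simp
next
  case (Cons x xs)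
  show ?case
  proof (cases "\<rho> (insert x A) = \<sigma> (insert x A)")
    case True
    then show ?thesis using Cons.IH[OF True] Cons.prems by simp
  next
    case False
    then show ?thesis using Cons.prems start_in_prefix_sets[of "insert x A" xs] by auto
  qed
qed

text \<open>Any chain refines to a complete flag: order the union of the members other than
  \<open>E\<close> by induction, then append the rest of \<open>E\<close>.\<close>

lemma chain_in_prefix_sets:
  assumes "finite E" "C \<subseteq> Pow E" "chain\<^sub>\<subseteq> C"
  obtains xs where "xs \<in> permutations_of_set E" "C \<subseteq> prefix_sets {} xs"
proof -
  have "\<exists>xs\<in>permutations_of_set E. C \<subseteq> prefix_sets {} xs" using assms
  proof (induction "card E" arbitrary: E C rule: less_induct)
    case less
    define C' where "C' = C - {E}"
    have C': "C' \<subseteq> Pow E" "chain\<^sub>\<subseteq> C'" using less.prems chain_subset_mono[of C' C] by (auto simp: C'_def)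
    define Y where "Y = \<Union>C'"
    have YE: "Y \<subseteq> E" using C' by (auto simp: Y_def)
    have "\<exists>xs\<in>permutations_of_set Y. C' \<subseteq> prefix_sets {} xs"
    proof (cases "C' = {}")
      case True
      then show ?thesis by (auto simp: Y_def)
    next
      case False
      have "finite (Pow E)" using less.prems(1) by simp
      then have "Y \<in> C'" unfolding Y_def using C' False by (intro chain_Union_in) (auto intro: finite_subset)
      then have "Y \<subset> E" using YE by (auto simp: C'_def)
      then have "card Y < card E" using less.prems(1) by (simp add: psubset_card_mono)
      moreover have "finite Y" using YE less.prems(1) by (rule finite_subset)
      moreover have "C' \<subseteq> Pow Y" by (auto simp: Y_def)
      ultimately show ?thesis using less.hyps C'(2) by blast
    qed
    then obtain xs where xs: "xs \<in> permutations_of_set Y" "C' \<subseteq> prefix_sets {} xs" by blast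
    obtain ys where ys: "set ys = E - Y" "distinct ys"
      using finite_distinct_list[of "E - Y"] less.prems(1) by auto
    have "xs @ ys \<in> permutations_of_set E"
      using xs(1) ys YE by (auto simp: permutations_of_set_def)
    moreover from this have "E \<in> prefix_sets {} (xs @ ys)"
      using end_in_prefix_sets[of "{}" "xs @ ys"] by (simp add: permutations_of_set_def)
    ultimately show ?case using xs(2) unfolding C'_def prefix_sets_append
      by (intro bexI[of _ "xs @ ys"]) (auto simp: prefix_sets_append)
  qed
  then show ?thesis using that by blast
qed

section \<open>The \<open>\<G>\<close>-invariant\<close>

definition g_invariant :: "'a matroid \<Rightarrow> int list \<Rightarrow> real" where
  "g_invariant M = flag_count (\<lambda>X. int (rank_in M X)) {} (ground M)"

text \<open>For a fixed order of the ground set, either no member has the word \<open>w\<close>, or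
  having it means having the same ranks on the prefix chain as one member that does. Summing these
  valuative tests over all orders gives G.\<close>

lemma polytope_relation_g_invariant:
  assumes rel: "polytope_relation E I m b"
  shows "(\<Sum>i\<in>I. b i * g_invariant (m i) w) = 0"
proof -
  let ?rk = "\<lambda>i X. int (rank_in (m i) X)"
  have M: "is_matroid (m i)" "ground (m i) = E" if "i \<in> I" for i
    using rel that by (auto simp: polytope_relation_def)
  have "(\<Sum>i\<in>I. b i * of_bool (rank_word (?rk i) {} xs = w)) = 0" if xs: "xs \<in> permutations_of_set E" for xs
  proof (cases "\<exists>i\<in>I. rank_word (?rk i) {} xs = w")
    case False
    then show ?thesis by (intro sum.neutral) auto
  next
    case True
    then obtain k where k: "k \<in> I" "rank_word (?rk k) {} xs = w" by blast
    have "rank_word (?rk i) {} xs = w \<longleftrightarrow> (\<forall>X\<in>prefix_sets {} xs. rank_in (m i) X = rank_in (m k) X)"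
      if i: "i \<in> I" for i
      unfolding k(2)[symmetric] using rank_empty[OF M(1)[OF i]] rank_empty[OF M(1)[OF k(1)]]
      by (subst rank_word_eq_iff) auto
    then have "(\<Sum>i\<in>I. b i * of_bool (rank_word (?rk i) {} xs = w)) =
      (\<Sum>i\<in>I. b i * of_bool (\<forall>X\<in>prefix_sets {} xs. rank_in (m i) X = rank_in (m k) X))"
      by (intro sum.cong) auto
    also have "\<dots> = 0"
    proof (rule polytope_relation_ranks[OF rel _ prefix_sets_chain])
      show "prefix_sets {} xs \<subseteq> Pow E"
        using prefix_sets_bounds[of _ "{}" xs] xs by (force simp: permutations_of_set_def)
    qed
    finally show ?thesis .
  qed
  then have "0 = (\<Sum>xs\<in>permutations_of_set E. \<Sum>i\<in>I. b i * of_bool (rank_word (?rk i) {} xs = w))"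
    by simp
  also have "\<dots> = (\<Sum>i\<in>I. \<Sum>xs\<in>permutations_of_set E. b i * of_bool (rank_word (?rk i) {} xs = w))"
    by (rule sum.swap)
  also have "\<dots> = (\<Sum>i\<in>I. b i * g_invariant (m i) w)"
  proof (rule sum.cong)
    fix i assume i: "i \<in> I"
    have "(\<Sum>xs\<in>permutations_of_set E. of_bool (rank_word (?rk i) {} xs = w)) = g_invariant (m i) w"
      unfolding g_invariant_def flag_count_def M(2)[OF i]
      by (simp add: of_bool_def sum.If_cases Int_def)
    then show "(\<Sum>xs\<in>permutations_of_set E. b i * of_bool (rank_word (?rk i) {} xs = w)) =
        b i * g_invariant (m i) w" by (simp flip: sum_distrib_left)
  qed simp
  finally show ?thesis by simp
qed

section \<open>Transport along injections\<close>

lemma ground_map_matroid [simp]: "ground (map_matroid f M) = f ` ground M"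
  by (simp add: map_matroid_def)

lemma bases_map_matroid [simp]: "bases (map_matroid f M) = image f ` bases M"
  by (simp add: map_matroid_def)

lemma is_matroid_map:
  assumes M: "is_matroid M" and f: "inj_on f (ground M)"
  shows "is_matroid (map_matroid f M)"
  unfolding is_matroid_def
proof (intro conjI ballI)
  show "finite (ground (map_matroid f M))" "bases (map_matroid f M) \<noteq> {}"
    using matroid_finite(1,3)[OF M] by auto
  show "B \<subseteq> ground (map_matroid f M)" if "B \<in> bases (map_matroid f M)" for B
    using that matroid_finite(4)[OF M] by auto
  fix B B' x assume "B \<in> bases (map_matroid f M)" "B' \<in> bases (map_matroid f M)" and x: "x \<in> B - B'"
  then obtain D D' where D: "D \<in> bases M" "B = f ` D" and D': "D' \<in> bases M" "B' = f ` D'" by auto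
  have sub: "D \<subseteq> ground M" "D' \<subseteq> ground M" using matroid_finite(4)[OF M] D D' by auto
  obtain u where u: "u \<in> D - D'" "x = f u" using x D D' by blast
  obtain v where v: "v \<in> D' - D" "insert v (D - {u}) \<in> bases M"
    using basis_exchange[OF M D(1) D'(1) u(1)] .
  have "f v \<in> B' - B" using v(1) D D' sub f by (auto simp: inj_on_def)
  moreover have "insert (f v) (B - {x}) = f ` insert v (D - {u})"
    using D(2) u sub f by (auto simp: inj_on_def)
  ultimately show "\<exists>y\<in>B' - B. insert y (B - {x}) \<in> bases (map_matroid f M)"
    using v(2) unfolding bases_map_matroid by (metis imageI)
qed

lemma rank_map_matroid:
  assumes M: "is_matroid M" and f: "inj_on f (ground M)" and X: "X \<subseteq> ground M"
  shows "rank_in (map_matroid f M) (f ` X) = rank_in M X"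
proof -
  have "card (f ` B \<inter> f ` X) = card (B \<inter> X)" if "B \<in> bases M" for B
  proof -
    have B: "B \<subseteq> ground M" using matroid_finite(4)[OF M that] .
    have "f ` B \<inter> f ` X = f ` (B \<inter> X)" using inj_on_image_Int[OF f B X] by simp
    moreover have "inj_on f (B \<inter> X)" using f B by (auto intro: inj_on_subset)
    ultimately show ?thesis by (simp add: card_image)
  qed
  then show ?thesis unfolding rank_in_def by (simp add: image_image cong: image_cong_simp)
qed

lemma matroid_rank_map:
  assumes "is_matroid M" "inj_on f (ground M)"
  shows "matroid_rank (map_matroid f M) = matroid_rank M"
  using rank_map_matroid[OF assms] by (simp add: matroid_rank_def)

lemma card_bases_map:
  assumes M: "is_matroid M" and f: "inj_on f (ground M)"
  shows "card (bases (map_matroid f M)) = card (bases M)"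
proof -
  have "inj_on (image f) (bases M)"
    using inj_on_image_Pow[OF f] by (rule inj_on_subset) (use matroid_finite(4)[OF M] in auto)
  then show ?thesis by (simp add: card_image)
qed

lemma flag_count_cong:
  assumes "finite E" "\<And>X. A \<subseteq> X \<Longrightarrow> X \<subseteq> A \<union> E \<Longrightarrow> \<rho> X = \<sigma> X"
  shows "flag_count \<rho> A E w = flag_count \<sigma> A E w"
  using assms
proof (induction w arbitrary: A E)
  case Nil
  then show ?case by (simp add: flag_count_Nil)
next
  case (Cons a w)
  have "\<rho> (insert x A) = \<sigma> (insert x A)" if "x \<in> E" for x using that Cons.prems(2) by blast
  moreover have "\<rho> A = \<sigma> A" using Cons.prems(2) by blast
  moreover have "flag_count \<rho> (insert x A) (E - {x}) w = flag_count \<sigma> (insert x A) (E - {x}) w"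
    if x: "x \<in> E" for x
    using Cons.prems x by (intro Cons.IH) auto
  ultimately show ?case using Cons.prems(1) by (simp add: flag_count_Cons)
qed

lemma g_invariant_map:
  assumes M: "is_matroid M" and f: "inj_on f (ground M)"
  shows "g_invariant (map_matroid f M) = g_invariant M"
proof
  fix w
  note fin = matroid_finite(1)[OF M]
  have "g_invariant (map_matroid f M) w =
      flag_count (\<lambda>X. int (rank_in (map_matroid f M) X)) (f ` {}) (f ` ground M) w"
    by (simp add: g_invariant_def)
  also have "\<dots> = flag_count (\<lambda>X. int (rank_in (map_matroid f M) (f ` X))) {} (ground M) w"
    using f fin by (subst flag_count_image) auto
  also have "\<dots> = g_invariant M w"
    unfolding g_invariant_def using rank_map_matroid[OF M f] fin by (intro flag_count_cong) auto
  finally show "g_invariant (map_matroid f M) w = g_invariant M w" .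
qed

lemma rank_word_map:
  "rank_word \<rho> (f ` A) (map f xs) = rank_word (\<lambda>X. \<rho> (f ` X)) A xs"
proof (induction xs arbitrary: A)
  case (Cons x xs)
  then show ?case using Cons[of "insert x A"] by simp
qed simp

lemma rank_word_cong:
  assumes "\<And>X. A \<subseteq> X \<Longrightarrow> X \<subseteq> A \<union> set xs \<Longrightarrow> \<rho> X = \<sigma> X"
  shows "rank_word \<rho> A xs = rank_word \<sigma> A xs"
proof -
  have "\<rho> A = \<sigma> A" using assms by blast
  then show ?thesis using prefix_sets_bounds assms by (subst rank_word_eq_iff) blast+
qed

section \<open>Class vectors and the \<open>\<G>\<close>-invariant\<close>

lemma map_matroid_comp: "map_matroid g (map_matroid f M) = map_matroid (g \<circ> f) M"
  by (simp add: map_matroid_def image_comp image_image o_def)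

lemma map_matroid_ident:
  assumes M: "is_matroid M" and f: "\<And>x. x \<in> ground M \<Longrightarrow> f x = x"
  shows "map_matroid f M = M"
proof -
  have im: "f ` X = X" if "X \<subseteq> ground M" for X
    using f that by (simp add: subset_iff)
  have "image f ` bases M = bases M" using im[OF matroid_finite(4)[OF M]] by simp
  then show ?thesis using im[of "ground M"] unfolding map_matroid_def by simp
qed

lemma map_matroid_inv_into:
  assumes "is_matroid M" "inj_on f (ground M)"
  shows "map_matroid (inv_into (ground M) f) (map_matroid f M) = M"
  unfolding map_matroid_comp using assms by (intro map_matroid_ident) auto

lemma map_matroid_in_matroids:
  assumes M: "is_matroid M" and f: "bij_betw f (ground M) {1..n}"
  shows "map_matroid f M \<in> matroids (matroid_rank M) n"
  using is_matroid_map[OF M] matroid_rank_map[OF M] f by (auto simp: matroids_def bij_betw_def)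

lemma equiv_iso_rel: "equiv (matroids r n) (iso_rel r n)"
proof (rule equivI)
  show "iso_rel r n \<subseteq> matroids r n \<times> matroids r n" by (auto simp: iso_rel_def)
  show "refl_on (matroids r n) (iso_rel r n)"
  proof (rule refl_onI)
    fix M assume M: "M \<in> matroids r n"
    have "map_matroid id M = M" by (rule map_matroid_ident[OF matroids_D(1)[OF M]]) simp
    then have "matroid_iso M M" unfolding matroid_iso_def by (intro exI[of _ id]) simp
    then show "(M, M) \<in> iso_rel r n" using M by (simp add: iso_rel_def)
  qed
  show "sym (iso_rel r n)"
  proof (rule symI)
    fix M N assume MN: "(M, N) \<in> iso_rel r n"
    then obtain f where f: "bij_betw f (ground M) (ground N)" "map_matroid f M = N"
      by (auto simp: iso_rel_def matroid_iso_def)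
    have "is_matroid M" using MN matroids_D(1) by (auto simp: iso_rel_def)
    then have "map_matroid (inv_into (ground M) f) N = M"
      using map_matroid_inv_into f by (auto simp: bij_betw_def)
    then have "matroid_iso N M" unfolding matroid_iso_def using bij_betw_inv_into[OF f(1)] by blast
    then show "(N, M) \<in> iso_rel r n" using MN by (simp add: iso_rel_def)
  qed
  show "trans (iso_rel r n)"
  proof (rule transI)
    fix M N P assume a: "(M, N) \<in> iso_rel r n" "(N, P) \<in> iso_rel r n"
    then obtain f g where "bij_betw f (ground M) (ground N)" "map_matroid f M = N"
      "bij_betw g (ground N) (ground P)" "map_matroid g N = P"
      by (auto simp: iso_rel_def matroid_iso_def)
    then have "matroid_iso M P" unfolding matroid_iso_def
      by (intro exI[of _ "g \<circ> f"]) (auto simp: bij_betw_trans simp flip: map_matroid_comp)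
    then show "(M, P) \<in> iso_rel r n" using a by (simp add: iso_rel_def)
  qed
qed

lemma iso_g_invariant:
  assumes "(M, N) \<in> iso_rel r n"
  shows "g_invariant M = g_invariant N"
proof -
  obtain f where "inj_on f (ground M)" "map_matroid f M = N"
    using assms by (auto simp: iso_rel_def matroid_iso_def bij_betw_def)
  moreover have "is_matroid M" using assms matroids_D(1) by (auto simp: iso_rel_def)
  ultimately show ?thesis using g_invariant_map by metis
qed

lemma schubert_classes_quotient: "schubert_classes r n \<subseteq> matroids r n // iso_rel r n"
  using schuberts_subset unfolding schubert_classes_def quotient_def by blast

lemma finite_schubert_classes: "finite (schubert_classes r n)"
  unfolding schubert_classes_def quotient_def using finite_schuberts by simp

lemma schubert_class_subset: "c \<in> schubert_classes r n \<Longrightarrow> c \<subseteq> matroids r n"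
  by (auto simp: schubert_classes_def quotient_def iso_rel_def)

definition class_g :: "nat matroid set \<Rightarrow> int list \<Rightarrow> real" where
  "class_g c = g_invariant (SOME S. S \<in> c)"

lemma class_g_eq:
  assumes c: "c \<in> schubert_classes r n" and S: "S \<in> c"
  shows "g_invariant S = class_g c"
proof -
  have "(SOME S. S \<in> c) \<in> c" using S by (rule someI)
  moreover have "c \<in> matroids r n // iso_rel r n" using c schubert_classes_quotient by blast
  ultimately have "(S, SOME S. S \<in> c) \<in> iso_rel r n"
    using S equiv_iso_rel by (metis quotient_eq_iff)
  then show ?thesis unfolding class_g_def by (rule iso_g_invariant)
qed

lemma lookup_class_vec:
  "Poly_Mapping.lookup (class_vec r n M) c =
    (if c \<in> schubert_classes r n then real_of_int (\<Sum>S\<in>c. schubert_coeff r n M S) else 0)"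
proof -
  have "Poly_Mapping.lookup (class_vec r n M) c = (\<Sum>d\<in>schubert_classes r n.
      if d = c then real_of_int (\<Sum>S\<in>d. schubert_coeff r n M S) else 0)"
    unfolding class_vec_def lookup_sum by (intro sum.cong) (simp_all add: lookup_single when_def)
  then show ?thesis using finite_schubert_classes by simp
qed

lemma g_invariant_class_vec:
  assumes M: "M \<in> matroids r n"
  shows "g_invariant M w =
    (\<Sum>c\<in>schubert_classes r n. Poly_Mapping.lookup (class_vec r n M) c * class_g c w)"
proof -
  let ?a = "\<lambda>S. real_of_int (schubert_coeff r n M S)"
  \<comment> \<open>The expansion with everything on one side: \<open>None\<close> carries
    \<open>M\<close> with coefficient 1, \<open>Some S\<close> carries \<open>S\<close> with its
    negated coefficient.\<close>
  let ?I = "insert None (Some ` schuberts r n)"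
  let ?m = "case_option M (\<lambda>S. S)" and ?b = "case_option 1 (\<lambda>S. - ?a S)"
  have sum_I: "(\<Sum>i\<in>?I. ?b i * h (?m i)) = h M - (\<Sum>S\<in>schuberts r n. ?a S * h S)" for h :: "_ \<Rightarrow> real"
    using finite_schuberts by (simp add: sum.reindex sum_negf)
  have "polytope_relation {1..n} ?I ?m ?b"
    unfolding polytope_relation_def
  proof (intro conjI ballI allI)
    show "finite ?I" using finite_schuberts by simp
    fix i assume "i \<in> ?I"
    then have "?m i \<in> matroids r n" using M by (auto intro: subsetD[OF schuberts_subset])
    then show "is_matroid (?m i)" "ground (?m i) = {1..n}" by (rule matroids_D)+
  next
    fix x :: "nat \<Rightarrow>\<^sub>0 real"
    have ind: "real_of_int (indicator A x) = indicator A x" for A by (simp add: indicator_def)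
    have "indicator (base_polytope M) x =
        (\<Sum>S\<in>schuberts r n. schubert_coeff r n M S * indicator (base_polytope S) x)"
      by (rule schubert_coeff(2)[OF M])
    from arg_cong[OF this, of real_of_int]
    show "(\<Sum>i\<in>?I. ?b i * indicator (base_polytope (?m i)) x) = 0"
      unfolding sum_I[of "\<lambda>N. indicator (base_polytope N) x"] by (simp add: ind)
  qed
  from polytope_relation_g_invariant[OF this, of w]
  have "g_invariant M w = (\<Sum>S\<in>schuberts r n. ?a S * g_invariant S w)"
    unfolding sum_I[of "\<lambda>N. g_invariant N w"] by simp
  \<comment> \<open>The classes are taken in \<open>iso_rel\<close>, which relates all matroids;
    coefficients vanish off \<open>schuberts r n\<close>, so summing over whole classes changes
    nothing.\<close>
  also have "\<dots> = (\<Sum>S\<in>\<Union>(schubert_classes r n). ?a S * g_invariant S w)"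
  proof (rule sum.mono_neutral_left)
    show "finite (\<Union>(schubert_classes r n))"
      by (rule finite_subset[OF _ finite_matroids]) (use schubert_class_subset in blast)
    show "schuberts r n \<subseteq> \<Union>(schubert_classes r n)"
    proof
      fix S assume S: "S \<in> schuberts r n"
      then have "(S, S) \<in> iso_rel r n"
        using equiv_class_self[OF equiv_iso_rel, of S r n] schuberts_subset by blast
      then show "S \<in> \<Union>(schubert_classes r n)" using S by (auto simp: schubert_classes_def quotient_def)
    qed
    show "\<forall>S\<in>\<Union>(schubert_classes r n) - schuberts r n. ?a S * g_invariant S w = 0"
      using schubert_coeff(1)[OF M] by simp
  qed
  also have "\<dots> = (\<Sum>c\<in>schubert_classes r n. \<Sum>S\<in>c. ?a S * g_invariant S w)"
  proof -
    have "finite c" if "c \<in> schubert_classes r n" for c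
      by (rule finite_subset[OF schubert_class_subset[OF that] finite_matroids])
    moreover have "c \<inter> d = {}" if "c \<in> schubert_classes r n" "d \<in> schubert_classes r n" "c \<noteq> d" for c d
      using quotient_disj[OF equiv_iso_rel subsetD[OF schubert_classes_quotient that(1)]
          subsetD[OF schubert_classes_quotient that(2)]] that(3) by simp
    ultimately show ?thesis by (subst sum.Union_disjoint) auto
  qed
  also have "\<dots> = (\<Sum>c\<in>schubert_classes r n. Poly_Mapping.lookup (class_vec r n M) c * class_g c w)"
    by (intro sum.cong refl) (simp add: lookup_class_vec class_g_eq sum_distrib_right)
  finally show ?thesis .
qed

lemma ex_map_eq: "distinct ys \<Longrightarrow> length ys = length xs \<Longrightarrow> \<exists>f. map f ys = xs"
proof (induction ys arbitrary: xs)
  case (Cons y ys)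
  then obtain x xs' where xs: "xs = x # xs'" "length ys = length xs'" by (cases xs) auto
  then obtain f where "map f ys = xs'" using Cons by auto
  then have "map (f(y := x)) (y # ys) = xs" using Cons.prems(1) xs by auto
  then show ?case by blast
qed simp

text \<open>Word by word, choosing the rank jumps of a flag through the cyclic flats of \<open>S\<close>, the
  \<open>\<G>\<close>-invariants of Schubert classes are triangular for the number of bases.\<close>

lemma class_g_independent:
  assumes rel: "\<And>w. (\<Sum>c\<in>schubert_classes r n. q c * class_g c w) = 0"
    and S: "S \<in> schuberts r n"
  shows "q (iso_rel r n `` {S}) = 0"
  using S
proof (induction "card (bases S)" arbitrary: S rule: less_induct)
  case less
  note S = less.prems
  let ?cl = "\<lambda>S. iso_rel r n `` {S}"
  have SM: "S \<in> matroids r n" using S schuberts_subset by blast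
  have cl: "?cl T \<in> schubert_classes r n" if "T \<in> schuberts r n" for T
    using that unfolding schubert_classes_def by (rule quotientI)
  have self: "T \<in> ?cl T" if "T \<in> matroids r n" for T
    using equiv_class_self[OF equiv_iso_rel that] .
  obtain xs where xs: "xs \<in> permutations_of_set {1..n}" "flag_of n S \<subseteq> prefix_sets {} xs"
    using chain_in_prefix_sets[OF _ flag_of_chain[OF S]] by blast
  define w where "w = rank_word (\<lambda>X. int (rank_in S X)) {} xs"
  let ?t = "\<lambda>c. q c * class_g c w"
  have "?t c = 0" if c: "c \<in> schubert_classes r n - {?cl S}" for c
  proof (cases "class_g c w = 0")
    case False
    obtain T where T: "T \<in> schuberts r n" "c = ?cl T"
      using c unfolding schubert_classes_def quotient_def by blast
    have TM: "T \<in> matroids r n" using T(1) schuberts_subset by blast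
    note t = matroids_D[OF TM] and s = matroids_D[OF SM]
    have "g_invariant T w \<noteq> 0" using False class_g_eq[OF cl[OF T(1)] self[OF TM]] T(2) by simp
    then obtain ys where ys: "ys \<in> permutations_of_set {1..n}"
        "rank_word (\<lambda>X. int (rank_in T X)) {} ys = w"
      unfolding g_invariant_def t(2) by (rule flag_count_nonzeroE)
    \<comment> \<open>\<open>f\<close> carries the flag \<open>ys\<close> of \<open>T\<close> with
      word \<open>w\<close> onto the chosen flag \<open>xs\<close>. The isomorphic copy
      \<open>T'\<close> then has the ranks of \<open>S\<close> along \<open>xs\<close>, hence on
      \<open>flag_of n S\<close>.\<close>
    obtain f where f: "map f ys = xs"
      using ex_map_eq[of ys xs] xs(1) ys(1) length_finite_permutations_of_set
      by (metis permutations_of_setD(2))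
    have bij: "bij_betw f {1..n} {1..n}"
    proof -
      have "set xs = {1..n}" "distinct xs" "set ys = {1..n}" "distinct ys"
        using xs(1) ys(1) by (auto simp: permutations_of_set_def)
      moreover have "set xs = f ` set ys" using f by auto
      moreover have "inj_on f (set ys)" using f \<open>distinct xs\<close> by (metis distinct_map)
      ultimately show ?thesis by (simp add: bij_betw_def)
    qed
    define T' where "T' = map_matroid f T"
    have inj: "inj_on f (ground T)" using bij t(2) by (simp add: bij_betw_def)
    have T'M: "T' \<in> matroids r n"
      using map_matroid_in_matroids[OF t(1), of f n] bij t by (simp add: T'_def)
    have "rank_word (\<lambda>X. int (rank_in T' X)) {} xs =
        rank_word (\<lambda>X. int (rank_in T' (f ` X))) {} ys"
      using rank_word_map[of "\<lambda>X. int (rank_in T' X)" f "{}" ys] f by simp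
    also have "\<dots> = rank_word (\<lambda>X. int (rank_in T X)) {} ys"
    proof (rule rank_word_cong)
      fix X assume "X \<subseteq> {} \<union> set ys"
      then have "X \<subseteq> ground T" using ys(1) t(2) by (simp add: permutations_of_set_def)
      then show "int (rank_in T' (f ` X)) = int (rank_in T X)"
        unfolding T'_def using rank_map_matroid[OF t(1) inj] by simp
    qed
    also have "\<dots> = w" by (rule ys(2))
    finally have "\<forall>X\<in>prefix_sets {} xs. int (rank_in T' X) = int (rank_in S X)"
      unfolding w_def using rank_empty[OF matroids_D(1)[OF T'M]] rank_empty[OF s(1)]
      by (subst (asm) rank_word_eq_iff) auto
    then have sub: "bases T' \<subseteq> bases S"
      using xs(2) by (intro bases_subset_schubert[OF S T'M]) auto
    have iso: "(T, T') \<in> iso_rel r n"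
      using TM T'M bij t(2) matroids_D(2)[OF T'M] by (auto simp: iso_rel_def matroid_iso_def T'_def)
    have "T' \<noteq> S"
    proof
      assume "T' = S"
      then have "?cl T = ?cl S" using iso equiv_class_eq[OF equiv_iso_rel] by metis
      then show False using c T(2) by blast
    qed
    then have "bases T' \<noteq> bases S" using matroids_eqI[OF T'M SM] by blast
    then have "card (bases T') < card (bases S)"
      using sub matroid_finite(2)[OF s(1)] by (simp add: psubset_card_mono psubset_eq)
    \<comment> \<open>Only the copy \<open>T'\<close> is known to have its bases among those of
      \<open>S\<close>, which is why the induction runs on the number of bases, an isomorphism
      invariant, and not on inclusion.\<close>
    then have "card (bases T) < card (bases S)"
      using card_bases_map[OF t(1) inj] by (simp add: T'_def)
    then show ?thesis using less.hyps[OF _ T(1)] T(2) by simp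
  qed simp
  then have "sum ?t (schubert_classes r n - {?cl S}) = 0" by (rule sum.neutral[OF ballI])
  then have "?t (?cl S) = 0"
    using rel[of w] sum.remove[OF finite_schubert_classes cl[OF S], of ?t] by simp
  moreover have "class_g (?cl S) w \<noteq> 0"
  proof -
    have "g_invariant S w \<noteq> 0"
      unfolding g_invariant_def w_def matroids_D(2)[OF SM] using xs(1) by (rule flag_count_nonzeroI)
    then show ?thesis using class_g_eq[OF cl[OF S] self[OF SM]] by simp
  qed
  ultimately show ?case by simp
qed

text \<open>The equivalence of class vector and G-invariant in the form used: both satisfy the same
  linear relations. One direction is linearity of G in the class vector, the other the independence
  of the \<open>class_g c\<close>.\<close>

lemma class_vec_relation_iff:
  assumes m: "\<And>i. i \<in> I \<Longrightarrow> m i \<in> matroids r n"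
  shows "(\<Sum>i\<in>I. b i *\<^sub>R class_vec r n (m i)) = 0 \<longleftrightarrow>
    (\<forall>w. (\<Sum>i\<in>I. b i * g_invariant (m i) w) = 0)"
proof -
  define q where "q c = (\<Sum>i\<in>I. b i * Poly_Mapping.lookup (class_vec r n (m i)) c)" for c
  have q: "Poly_Mapping.lookup (\<Sum>i\<in>I. b i *\<^sub>R class_vec r n (m i)) c = q c" for c
    by (simp add: lookup_sum lookup_scaleR q_def)
  have g: "(\<Sum>i\<in>I. b i * g_invariant (m i) w) = (\<Sum>c\<in>schubert_classes r n. q c * class_g c w)" for w
  proof -
    have "(\<Sum>i\<in>I. b i * g_invariant (m i) w) = (\<Sum>i\<in>I. \<Sum>c\<in>schubert_classes r n.
        b i * Poly_Mapping.lookup (class_vec r n (m i)) c * class_g c w)"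
      using g_invariant_class_vec[OF m] by (intro sum.cong) (simp_all add: sum_distrib_left mult.assoc)
    also have "\<dots> = (\<Sum>c\<in>schubert_classes r n. q c * class_g c w)"
      by (subst sum.swap) (simp add: q_def sum_distrib_right)
    finally show ?thesis .
  qed
  show ?thesis
  proof
    assume "(\<Sum>i\<in>I. b i *\<^sub>R class_vec r n (m i)) = 0"
    then have "q c = 0" for c using q[of c] by simp
    then show "\<forall>w. (\<Sum>i\<in>I. b i * g_invariant (m i) w) = 0" unfolding g by simp
  next
    assume 0: "\<forall>w. (\<Sum>i\<in>I. b i * g_invariant (m i) w) = 0"
    have "q c = 0" for c
    proof (cases "c \<in> schubert_classes r n")
      case True
      then obtain S where "S \<in> schuberts r n" "c = iso_rel r n `` {S}"
        unfolding schubert_classes_def quotient_def by blast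
      then show ?thesis using class_g_independent[where q = q] 0 unfolding g by blast
    next
      case False
      then show ?thesis by (simp add: q_def lookup_class_vec)
    qed
    then show "(\<Sum>i\<in>I. b i *\<^sub>R class_vec r n (m i)) = 0"
      using q by (intro poly_mapping_eqI) simp
  qed
qed

section \<open>Direct sums\<close>

lemma ground_direct_sum [simp]: "ground (direct_sum s M) = (SIGMA i:{1..s}. ground (M i))"
  by (simp add: direct_sum_def)

lemma bases_direct_sum:
  "X \<in> bases (direct_sum s M) \<longleftrightarrow> (\<exists>B. (\<forall>i\<in>{1..s}. B i \<in> bases (M i)) \<and> X = (SIGMA i:{1..s}. B i))"
  by (auto simp: direct_sum_def)

lemma is_matroid_direct_sum:
  assumes M: "\<And>i. i \<in> {1..s} \<Longrightarrow> is_matroid (M i)"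
  shows "is_matroid (direct_sum s M)"
  unfolding is_matroid_def
proof (intro conjI ballI)
  show "finite (ground (direct_sum s M))" using matroid_finite(1)[OF M] by auto
  have "\<forall>i\<in>{1..s}. \<exists>B. B \<in> bases (M i)" using matroid_finite(3)[OF M] by blast
  then obtain B where "\<forall>i\<in>{1..s}. B i \<in> bases (M i)" by metis
  then show "bases (direct_sum s M) \<noteq> {}" unfolding direct_sum_def by auto
  show "X \<subseteq> ground (direct_sum s M)" if "X \<in> bases (direct_sum s M)" for X
    using that matroid_finite(4)[OF M] unfolding bases_direct_sum by fastforce
  fix X Y p assume "X \<in> bases (direct_sum s M)" "Y \<in> bases (direct_sum s M)" and p: "p \<in> X - Y"
  then obtain A B where A: "\<And>i. i \<in> {1..s} \<Longrightarrow> A i \<in> bases (M i)" "X = (SIGMA i:{1..s}. A i)"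
    and B: "\<And>i. i \<in> {1..s} \<Longrightarrow> B i \<in> bases (M i)" "Y = (SIGMA i:{1..s}. B i)"
    unfolding bases_direct_sum by blast
  obtain i x where "p = (i, x)" by (cases p)
  then have ix: "p = (i, x)" "i \<in> {1..s}" "x \<in> A i - B i" using p A(2) B(2) by auto
  obtain y where y: "y \<in> B i - A i" "insert y (A i - {x}) \<in> bases (M i)"
    using basis_exchange[OF M[OF ix(2)] A(1)[OF ix(2)] B(1)[OF ix(2)] ix(3)] .
  let ?A = "A(i := insert y (A i - {x}))"
  have eq: "insert (i, y) (X - {p}) = (SIGMA j:{1..s}. ?A j)"
    using A(2) ix by (auto split: if_splits)
  have "\<forall>j\<in>{1..s}. ?A j \<in> bases (M j)" using A(1) y(2) by simp
  then have "insert (i, y) (X - {p}) \<in> bases (direct_sum s M)"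
    unfolding bases_direct_sum using eq by (intro exI[of _ ?A] conjI)
  moreover have "(i, y) \<in> Y - X" using A(2) B(2) ix y(1) by auto
  ultimately show "\<exists>q\<in>Y - X. insert q (X - {p}) \<in> bases (direct_sum s M)" by blast
qed

lemma rank_direct_sum:
  assumes M: "\<And>i. i \<in> {1..s} \<Longrightarrow> is_matroid (M i)"
  shows "rank_in (direct_sum s M) X = (\<Sum>i\<in>{1..s}. rank_in (M i) (Pair i -` X))"
proof -
  note D = is_matroid_direct_sum[of s M, OF M]
  have card: "card ((SIGMA i:{1..s}. B i) \<inter> X) = (\<Sum>i\<in>{1..s}. card (B i \<inter> Pair i -` X))"
    if "\<And>i. i \<in> {1..s} \<Longrightarrow> B i \<in> bases (M i)" for B
  proof -
    have "(SIGMA i:{1..s}. B i) \<inter> X = (SIGMA i:{1..s}. B i \<inter> Pair i -` X)" by auto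
    moreover have "\<forall>i\<in>{1..s}. finite (B i \<inter> Pair i -` X)" using that matroid_finite(5)[OF M] by blast
    ultimately show ?thesis by (simp add: card_SigmaI)
  qed
  show ?thesis
  proof (rule antisym)
    show "rank_in (direct_sum s M) X \<le> (\<Sum>i\<in>{1..s}. rank_in (M i) (Pair i -` X))"
    proof (rule rank_leI[OF D])
      fix Y assume "Y \<in> bases (direct_sum s M)"
      then obtain B where B: "\<And>i. i \<in> {1..s} \<Longrightarrow> B i \<in> bases (M i)" "Y = (SIGMA i:{1..s}. B i)"
        unfolding bases_direct_sum by blast
      show "card (Y \<inter> X) \<le> (\<Sum>i\<in>{1..s}. rank_in (M i) (Pair i -` X))"
        unfolding B(2) by (subst card[OF B(1)]) (simp_all only: sum_mono rank_ge_card_Int M B(1))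
    qed
    have "\<forall>i\<in>{1..s}. \<exists>B. B \<in> bases (M i) \<and> card (B \<inter> Pair i -` X) = rank_in (M i) (Pair i -` X)"
      using rank_attained[OF M] by metis
    then obtain B where B: "\<And>i. i \<in> {1..s} \<Longrightarrow> B i \<in> bases (M i)"
      "\<And>i. i \<in> {1..s} \<Longrightarrow> card (B i \<inter> Pair i -` X) = rank_in (M i) (Pair i -` X)" by metis
    have "(\<Sum>i\<in>{1..s}. rank_in (M i) (Pair i -` X)) = card ((SIGMA i:{1..s}. B i) \<inter> X)"
      by (subst card[OF B(1)]) (use B(2) in \<open>auto intro!: sum.cong\<close>)
    also have "\<dots> \<le> rank_in (direct_sum s M) X"
      by (rule rank_ge_card_Int[OF D]) (use B(1) in \<open>auto simp: bases_direct_sum intro!: exI[of _ B]\<close>)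
    finally show "(\<Sum>i\<in>{1..s}. rank_in (M i) (Pair i -` X)) \<le> rank_in (direct_sum s M) X" .
  qed
qed

definition cofactor_ground :: "nat \<Rightarrow> nat \<Rightarrow> (nat \<Rightarrow> 'a matroid) \<Rightarrow> (nat \<times> 'a) set" where
  "cofactor_ground i s M = (SIGMA j:{1..s} - {i}. ground (M j))"

text \<open>The G-invariant of the sum of the summands other than \<open>M i\<close>. It is written
  with the rank function because \<open>direct_sum\<close> takes only index sets
  \<open>{1..s}\<close>; keeping the original indices avoids a renumbering.\<close>

definition cofactor :: "nat \<Rightarrow> nat \<Rightarrow> (nat \<Rightarrow> 'a matroid) \<Rightarrow> int list \<Rightarrow> real" where
  "cofactor i s M = flag_count (\<lambda>X. \<Sum>j\<in>{1..s} - {i}. int (rank_in (M j) (Pair j -` X)))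
     {} (cofactor_ground i s M)"

lemma finite_cofactor_ground:
  assumes "\<And>j. j \<in> {1..s} \<Longrightarrow> is_matroid (M j)"
  shows "finite (cofactor_ground i s M)"
  unfolding cofactor_ground_def using matroid_finite(1)[OF assms] by auto

text \<open>The rank of the sum splits into a function of the fibre over \<open>i\<close> and one of
  the other fibres, so \<open>flag_count_sum\<close> applies. The cofactor does not depend on
  \<open>N\<close>, hence the result is linear in \<open>g_invariant N\<close>.\<close>

lemma g_invariant_direct_sum:
  assumes M: "\<And>j. j \<in> {1..s} \<Longrightarrow> is_matroid (M j)" and i: "i \<in> {1..s}"
    and N: "is_matroid N" "ground N = ground (M i)"
  shows "g_invariant (direct_sum s (M(i := N))) w = shuffle (g_invariant N) (cofactor i s M) w"
proof -
  let ?M = "M(i := N)"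
  define E1 where "E1 = Pair i ` ground N"
  let ?E2 = "cofactor_ground i s M"
  let ?\<rho>1 = "\<lambda>X. int (rank_in N (Pair i -` X))"
  let ?\<rho>2 = "\<lambda>X. \<Sum>j\<in>{1..s} - {i}. int (rank_in (M j) (Pair j -` X))"
  have M': "is_matroid (?M j)" if "j \<in> {1..s}" for j using M that N(1) by simp
  have split: "int (rank_in (direct_sum s ?M) X) = ?\<rho>1 (X \<inter> E1) + ?\<rho>2 (X \<inter> ?E2)" for X
  proof -
    have "rank_in (direct_sum s ?M) X = (\<Sum>j\<in>{1..s}. rank_in (?M j) (Pair j -` X))"
      by (rule rank_direct_sum[OF M'])
    also have "\<dots> = rank_in (?M i) (Pair i -` X) + (\<Sum>j\<in>{1..s} - {i}. rank_in (?M j) (Pair j -` X))"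
      using i by (intro sum.remove) auto
    also have "(\<Sum>j\<in>{1..s} - {i}. rank_in (?M j) (Pair j -` X)) =
        (\<Sum>j\<in>{1..s} - {i}. rank_in (M j) (Pair j -` (X \<inter> ?E2)))"
    proof (rule sum.cong)
      fix j assume j: "j \<in> {1..s} - {i}"
      have "Pair j -` (X \<inter> ?E2) = Pair j -` X \<inter> ground (M j)"
        using j by (auto simp: cofactor_ground_def)
      then show "rank_in (?M j) (Pair j -` X) = rank_in (M j) (Pair j -` (X \<inter> ?E2))"
        using j rank_Int_ground[OF M[of j]] by simp
    qed simp
    also have "rank_in (?M i) (Pair i -` X) = rank_in N (Pair i -` (X \<inter> E1))"
    proof -
      have "Pair i -` (X \<inter> E1) = Pair i -` X \<inter> ground N" by (auto simp: E1_def)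
      then show ?thesis using rank_Int_ground[OF N(1)] by simp
    qed
    finally show ?thesis by (simp only: of_nat_add of_nat_sum)
  qed
  have ground: "ground (direct_sum s ?M) = E1 \<union> ?E2"
    using i by (auto simp: E1_def cofactor_ground_def split: if_splits)
  have "g_invariant (direct_sum s ?M) w =
      shuffle (flag_count ?\<rho>1 ({} \<inter> E1) E1) (flag_count ?\<rho>2 ({} \<inter> ?E2) ?E2) w"
    unfolding g_invariant_def ground
  proof (rule flag_count_sum[where ?E1.0 = E1 and ?E2.0 = ?E2])
    show "finite E1" using matroid_finite(1)[OF N(1)] by (simp add: E1_def)
    show "finite ?E2" by (rule finite_cofactor_ground[OF M])
    show "E1 \<inter> ?E2 = {}" by (auto simp: E1_def cofactor_ground_def)
  qed (use split in auto)
  also have "flag_count ?\<rho>1 ({} \<inter> E1) E1 = g_invariant N"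
  proof
    fix u
    have "flag_count ?\<rho>1 ({} \<inter> E1) E1 u = flag_count ?\<rho>1 (Pair i ` {}) (Pair i ` ground N) u"
      by (simp add: E1_def)
    also have "\<dots> = flag_count (\<lambda>X. ?\<rho>1 (Pair i ` X)) {} (ground N) u"
      using matroid_finite(1)[OF N(1)] by (intro flag_count_image) (auto simp: inj_on_def)
    also have "(\<lambda>X. ?\<rho>1 (Pair i ` X)) = (\<lambda>X. int (rank_in N X))"
      by (simp add: inj_vimage_image_eq inj_on_def)
    finally show "flag_count ?\<rho>1 ({} \<inter> E1) E1 u = g_invariant N u" by (simp add: g_invariant_def)
  qed
  finally show ?thesis by (simp only: cofactor_def Int_empty_left)
qed

text \<open>Multiplication by the cofactor is injective on homogeneous \<open>f\<close>: the
  cofactor is itself homogeneous, and nonzero because a finite set can be listed in some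
  order.\<close>

lemma shuffle_cofactor_zero_iff:
  assumes M: "\<And>j. j \<in> {1..s} \<Longrightarrow> is_matroid (M j)"
    and hom: "\<And>u. f u \<noteq> 0 \<Longrightarrow> length u = m"
  shows "(\<forall>w. shuffle f (cofactor i s M) w = 0) \<longleftrightarrow> f = (\<lambda>_. 0)"
proof
  assume zero: "\<forall>w. shuffle f (cofactor i s M) w = 0"
  have "finite (cofactor_ground i s M)" by (rule finite_cofactor_ground[OF M])
  then have "permutations_of_set (cofactor_ground i s M) \<noteq> {}"
    by (simp add: permutations_of_set_empty_iff)
  then obtain xs where "xs \<in> permutations_of_set (cofactor_ground i s M)" by blast
  from flag_count_nonzeroI[OF this] have "\<exists>u. cofactor i s M u \<noteq> 0"
    unfolding cofactor_def by (rule exI)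
  then have nonzero: "cofactor i s M \<noteq> (\<lambda>_. 0)" by auto
  have len: "length u = card (cofactor_ground i s M)" if "cofactor i s M u \<noteq> 0" for u
    using that unfolding cofactor_def by (rule flag_count_length)
  show "f = (\<lambda>_. 0)"
  proof (rule ccontr)
    assume "f \<noteq> (\<lambda>_. 0)"
    from shuffle_nonzero[OF hom len this nonzero] show False using zero by simp
  qed
qed (simp add: shuffle_zero)

section \<open>Extremality of the summands\<close>

text \<open>The coefficients are indexed by \<open>A\<close> and not by points: isomorphic matroids
  share a class vector, and the same coefficients have to be applied to a second family of
  vectors.\<close>

lemma convex_hull_image_finite:
  assumes "finite A"
  shows "x \<in> convex hull (f ` A) \<longleftrightarrow>
    (\<exists>u. (\<forall>a\<in>A. 0 \<le> u a) \<and> sum u A = 1 \<and> x = (\<Sum>a\<in>A. u a *\<^sub>R f a))"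
proof
  assume "x \<in> convex hull (f ` A)"
  then obtain v where v: "\<forall>y\<in>f ` A. 0 \<le> v y" "sum v (f ` A) = 1" "(\<Sum>y\<in>f ` A. v y *\<^sub>R y) = x"
    using convex_hull_finite[of "f ` A"] assms by auto
  obtain A' where A': "A' \<subseteq> A" "inj_on f A'" "f ` A' = f ` A"
    using subset_image_inj[of "f ` A" f A] by auto
  \<comment> \<open>\<open>A'\<close> holds one preimage of each point; all other indices receive
    coefficient 0.\<close>
  define u where "u a = (if a \<in> A' then v (f a) else 0)" for a
  have "sum u A = sum (\<lambda>a. v (f a)) A'"
    unfolding u_def using assms A'(1) by (intro sum.mono_neutral_cong_right) auto
  moreover have "(\<Sum>a\<in>A. u a *\<^sub>R f a) = (\<Sum>a\<in>A'. v (f a) *\<^sub>R f a)"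
    unfolding u_def using assms A'(1) by (intro sum.mono_neutral_cong_right) auto
  moreover have "sum v (f ` A) = sum (\<lambda>a. v (f a)) A'"
    unfolding A'(3)[symmetric] using A'(2) by (simp add: sum.reindex)
  moreover have "(\<Sum>y\<in>f ` A. v y *\<^sub>R y) = (\<Sum>a\<in>A'. v (f a) *\<^sub>R f a)"
    unfolding A'(3)[symmetric] using A'(2) by (simp add: sum.reindex)
  moreover have "\<forall>a\<in>A. 0 \<le> u a" using v(1) by (simp add: u_def)
  ultimately show "\<exists>u. (\<forall>a\<in>A. 0 \<le> u a) \<and> sum u A = 1 \<and> x = (\<Sum>a\<in>A. u a *\<^sub>R f a)"
    using v by (intro exI[of _ u]) simp
next
  assume "\<exists>u. (\<forall>a\<in>A. 0 \<le> u a) \<and> sum u A = 1 \<and> x = (\<Sum>a\<in>A. u a *\<^sub>R f a)"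
  then obtain u where u: "\<forall>a\<in>A. 0 \<le> u a" "sum u A = 1" "x = (\<Sum>a\<in>A. u a *\<^sub>R f a)" by blast
  show "x \<in> convex hull (f ` A)"
    unfolding u(3) using u(1,2)
    by (intro convex_sum[OF assms convex_convex_hull]) (auto intro: hull_inc)
qed

lemma extremal_summand:
  fixes M :: "nat \<Rightarrow> 'a matroid"
  assumes M: "\<And>j. j \<in> {1..s} \<Longrightarrow> is_matroid (M j)"
    and ext: "extremal (direct_sum s M)" and i: "i \<in> {1..s}"
  shows "extremal (M i)"
proof -
  define D where "D = direct_sum s M"
  define r where "r = matroid_rank D"
  define n where "n = card (ground D)"
  define r0 where "r0 = matroid_rank (M i)"
  define n0 where "n0 = card (ground (M i))"
  let ?cv = "class_vec r n" and ?cvi = "class_vec r0 n0"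
  note Mi = M[OF i]
  have DM: "is_matroid D" unfolding D_def by (rule is_matroid_direct_sum[OF M])
  obtain g where g: "bij_betw g (ground D) {1..n}"
    using ex_bij_betw_nat_finite_1[OF matroid_finite(1)[OF DM]] bij_betw_inv unfolding n_def by blast
  have extD: "?cv (map_matroid g D) extreme_point_of Omega r n"
    using ext g unfolding extremal_def D_def[symmetric] r_def n_def Let_def by blast
  have "?cvi (map_matroid f (M i)) extreme_point_of Omega r0 n0"
    if f: "bij_betw f (ground (M i)) {1..n0}" for f
  proof -
    \<comment> \<open>\<open>pull N\<close> carries a matroid on \<open>{1..n0}\<close> to the
      ground set of \<open>M i\<close>, and \<open>R N\<close> is the direct sum with it in place of
      \<open>M i\<close>, numbered by \<open>g\<close>. The copy \<open>N0\<close> of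
      \<open>M i\<close> gives back \<open>D\<close>.\<close>
    define pull where "pull N = map_matroid (inv_into (ground (M i)) f) N" for N
    define R where "R N = map_matroid g (direct_sum s (M(i := pull N)))" for N
    define A where "A = matroids r0 n0"
    define N0 where "N0 = map_matroid f (M i)"
    have finA: "finite A" unfolding A_def by (rule finite_matroids)
    have N0A: "N0 \<in> A" unfolding A_def N0_def r0_def by (rule map_matroid_in_matroids[OF Mi f])
    have "pull N0 = M i"
      unfolding pull_def N0_def using f by (intro map_matroid_inv_into[OF Mi]) (simp add: bij_betw_def)
    then have R0: "R N0 = map_matroid g D" by (simp add: R_def D_def)
    have invf: "bij_betw (inv_into (ground (M i)) f) {1..n0} (ground (M i))"
      by (rule bij_betw_inv_into[OF f])
    have pull: "is_matroid (pull N)" "ground (pull N) = ground (M i)" "matroid_rank (pull N) = r0"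
        "g_invariant (pull N) = g_invariant N" if "N \<in> A" for N
    proof -
      note N = matroids_D[OF that[unfolded A_def]]
      have inj: "inj_on (inv_into (ground (M i)) f) (ground N)" using invf N(2) by (simp add: bij_betw_def)
      show "is_matroid (pull N)" unfolding pull_def by (rule is_matroid_map[OF N(1) inj])
      show "ground (pull N) = ground (M i)" using invf N(2) by (simp add: pull_def bij_betw_def)
      show "matroid_rank (pull N) = r0" using matroid_rank_map[OF N(1) inj] N(3) by (simp add: pull_def)
      show "g_invariant (pull N) = g_invariant N" unfolding pull_def by (rule g_invariant_map[OF N(1) inj])
    qed
    have sum': "is_matroid (direct_sum s (M(i := pull N)))"
        "ground (direct_sum s (M(i := pull N))) = ground D"
        "matroid_rank (direct_sum s (M(i := pull N))) = r" if N: "N \<in> A" for N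
    proof -
      have M': "is_matroid ((M(i := pull N)) j)" if "j \<in> {1..s}" for j
        using M that pull(1)[OF N] by simp
      show "is_matroid (direct_sum s (M(i := pull N)))" by (rule is_matroid_direct_sum[of s "M(i := pull N)", OF M'])
      show gr: "ground (direct_sum s (M(i := pull N))) = ground D"
        using pull(2)[OF N] by (auto simp: D_def split: if_splits)
      have fib: "Pair j -` ground D = ground (M j)" if "j \<in> {1..s}" for j
        using that by (auto simp: D_def)
      have "rank_in ((M(i := pull N)) j) (ground (M j)) = rank_in (M j) (ground (M j))" for j
        using pull(2,3)[OF N] by (simp add: matroid_rank_def r0_def)
      then have "rank_in (direct_sum s (M(i := pull N))) (ground D) = rank_in (direct_sum s M) (ground D)"
        using rank_direct_sum[of s "M(i := pull N)" "ground D", OF M'] rank_direct_sum[of s M "ground D", OF M]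
          fib by (metis (no_types, lifting) sum.cong)
      then show "matroid_rank (direct_sum s (M(i := pull N))) = r"
        unfolding matroid_rank_def r_def gr D_def .
    qed
    have RM: "R N \<in> matroids r n" if "N \<in> A" for N
      using map_matroid_in_matroids[OF sum'(1)[OF that], of g n] g sum'(2,3)[OF that]
      unfolding R_def by simp
    have RG: "g_invariant (R N) w = shuffle (g_invariant N) (cofactor i s M) w" if "N \<in> A" for N w
    proof -
      have "inj_on g (ground (direct_sum s (M(i := pull N))))"
        using g sum'(2)[OF that] by (simp add: bij_betw_def)
      then have "g_invariant (R N) = g_invariant (direct_sum s (M(i := pull N)))"
        unfolding R_def by (rule g_invariant_map[OF sum'(1)[OF that]])
      then show ?thesis
        using g_invariant_direct_sum[of s M i "pull N" w, OF M i pull(1,2)[OF that]] pull(4)[OF that]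
        by simp
    qed
    \<comment> \<open>Both sides translate into relations between G-invariants, which differ by the
      injective multiplication with the cofactor; on the side of the summand all words have length
      \<open>n0\<close>, which is the homogeneity it asks for.\<close>
    have transfer: "(\<Sum>N\<in>A. b N *\<^sub>R ?cvi N) = 0 \<longleftrightarrow> (\<Sum>N\<in>A. b N *\<^sub>R ?cv (R N)) = 0" for b
    proof -
      let ?h = "\<lambda>w. \<Sum>N\<in>A. b N * g_invariant N w"
      have hom: "length u = n0" if u: "?h u \<noteq> 0" for u
      proof -
        have "\<not> (\<forall>N\<in>A. g_invariant N u = 0)" using u by (metis (no_types, lifting) mult_zero_right sum.neutral)
        then obtain N where N: "N \<in> A" "g_invariant N u \<noteq> 0" by blast
        then show ?thesis
          using flag_count_length[of _ "{}" "ground N" u] matroids_D(2)[of N r0 n0]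
          by (simp add: g_invariant_def A_def)
      qed
      have "(\<Sum>N\<in>A. b N *\<^sub>R ?cv (R N)) = 0 \<longleftrightarrow> (\<forall>w. (\<Sum>N\<in>A. b N * g_invariant (R N) w) = 0)"
        by (rule class_vec_relation_iff[OF RM])
      also have "\<dots> \<longleftrightarrow> (\<forall>w. shuffle ?h (cofactor i s M) w = 0)"
        unfolding shuffle_sum_left using RG by simp
      also have "\<dots> \<longleftrightarrow> ?h = (\<lambda>_. 0)"
        by (rule shuffle_cofactor_zero_iff[of s M ?h n0 i, OF M hom])
      also have "\<dots> \<longleftrightarrow> (\<forall>w. ?h w = 0)" by (simp add: fun_eq_iff)
      also have "\<dots> \<longleftrightarrow> (\<Sum>N\<in>A. b N *\<^sub>R ?cvi N) = 0"
        by (rule class_vec_relation_iff[symmetric]) (simp add: A_def)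
      finally show ?thesis by simp
    qed
    show ?thesis unfolding extreme_point_of_def N0_def[symmetric]
    proof (intro conjI ballI notI)
      show "?cvi N0 \<in> Omega r0 n0" unfolding Omega_def using N0A A_def by (intro hull_inc imageI) simp
      fix a b assume a: "a \<in> Omega r0 n0" and b: "b \<in> Omega r0 n0"
        and "?cvi N0 \<in> open_segment a b"
      then obtain t where ab: "a \<noteq> b" and t: "0 < t" "t < 1" "?cvi N0 = (1 - t) *\<^sub>R a + t *\<^sub>R b"
        by (auto simp: in_segment)
      obtain u where u: "\<forall>N\<in>A. 0 \<le> u N" "sum u A = 1" "a = (\<Sum>N\<in>A. u N *\<^sub>R ?cvi N)"
        using a convex_hull_image_finite[OF finA] unfolding Omega_def A_def by blast
      obtain v where v: "\<forall>N\<in>A. 0 \<le> v N" "sum v A = 1" "b = (\<Sum>N\<in>A. v N *\<^sub>R ?cvi N)"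
        using b convex_hull_image_finite[OF finA] unfolding Omega_def A_def by blast
      define a' where "a' = (\<Sum>N\<in>A. u N *\<^sub>R ?cv (R N))"
      define b' where "b' = (\<Sum>N\<in>A. v N *\<^sub>R ?cv (R N))"
      have sub: "convex hull ((\<lambda>N. ?cv (R N)) ` A) \<subseteq> Omega r n"
        unfolding Omega_def using RM by (intro hull_mono) auto
      have a'O: "a' \<in> Omega r n" and b'O: "b' \<in> Omega r n"
        using sub u v convex_hull_image_finite[OF finA, of _ "\<lambda>N. ?cv (R N)"]
        unfolding a'_def b'_def by blast+
      \<comment> \<open>The coefficients of the relation that places the vector of \<open>N0\<close>
        between \<open>a\<close> and \<open>b\<close>; \<open>transfer\<close> yields the same
        relation for the vectors of the sums.\<close>
      define c where "c N = (1 - t) * u N + t * v N - of_bool (N = N0)" for N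
      have c: "(\<Sum>N\<in>A. c N *\<^sub>R F N) =
          (1 - t) *\<^sub>R (\<Sum>N\<in>A. u N *\<^sub>R F N) + t *\<^sub>R (\<Sum>N\<in>A. v N *\<^sub>R F N) - F N0"
        for F :: "nat matroid \<Rightarrow> (nat matroid set \<Rightarrow>\<^sub>0 real)"
      proof -
        have "(\<Sum>N\<in>A. of_bool (N = N0) *\<^sub>R F N) = F N0"
          using N0A finA by (simp add: of_bool_def if_distribR if_distrib cong: if_cong)
        then show ?thesis unfolding c_def
          by (simp add: scaleR_diff_left scaleR_add_left sum_subtractf sum.distrib scaleR_sum_right)
      qed
      have "(\<Sum>N\<in>A. c N *\<^sub>R ?cvi N) = 0" unfolding c using t(3) u(3) v(3) by simp
      then have "(\<Sum>N\<in>A. c N *\<^sub>R ?cv (R N)) = 0" by (simp only: transfer)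
      then have seg: "?cv (R N0) = (1 - t) *\<^sub>R a' + t *\<^sub>R b'" unfolding c a'_def b'_def by simp
      have "a' = b'"
      proof (rule ccontr)
        assume "a' \<noteq> b'"
        then have "?cv (R N0) \<in> open_segment a' b'" using seg t(1,2) by (auto simp: in_segment)
        then show False using extD a'O b'O unfolding extreme_point_of_def R0 by blast
      qed
      \<comment> \<open>The end points coincide in the larger polytope by extremality, so the
        coefficients \<open>u - v\<close> form a relation there; \<open>transfer\<close> takes it
        back to \<open>a = b\<close>.\<close>
      then have "(\<Sum>N\<in>A. (u N - v N) *\<^sub>R ?cv (R N)) = 0"
        by (simp add: a'_def b'_def scaleR_diff_left sum_subtractf)
      then have "(\<Sum>N\<in>A. (u N - v N) *\<^sub>R ?cvi N) = 0" by (simp only: transfer)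
      then have "a = b" using u(3) v(3) by (simp add: scaleR_diff_left sum_subtractf)
      then show False using ab by simp
    qed
  qed
  then show ?thesis using Mi unfolding extremal_def Let_def r0_def n0_def by blast
qed

theorem theorem4p9:
  fixes s :: nat and M :: "nat \<Rightarrow> 'a matroid"
  assumes "\<And>i. i \<in> {1..s} \<Longrightarrow> is_matroid (M i)"
    and "extremal (direct_sum s M)"
  shows "\<forall>i\<in>{1..s}. extremal (M i)"
  using extremal_summand[of s M] assms by blast

end
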